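(* The class $\mathcal{K}$ of finite $L_1$ diversities, viewed as relational metric structures, satisfies HP, JEP, bAP, PP and CP, and is therefore a Fraïssé class with a separable ultrahomogeneous limit. Furthermore, the limit is universal with respect to separable $L_1$ diversities (every separable $L_1$ diversity embeds into it), and it is, up to isomorphism, the unique such $L_1$ diversity.
   Context: **$L_1$ diversities.** A diversity is a pair $(X,\delta)$ where $X$ is a set and $\delta$ maps finite subsets of $X$ to $\mathbb{R}$ such that, for all finite $A,B,C\subseteq X$: (D1) $\delta(A)\ge0$, and $\delta(A)=0$ if and only if $|A|\le1$; (D2) if $B\ne\emptyset$ then $\delta(A\cup B)+\delta(B\cup C)\ge\delta(A\cup C)$. Its induced metric is $d(x,y)=\delta(\{x,y\})$; a diversity is separable (complete) if its induced metric is. For a measure space $(\Omega,\mathcal{A},\mu)$, the space $L_1(\Omega,\mathcal{A},\mu)$ carries the diversity function $$\delta(F)=\int_\Omega\Big(\max_{f\in F}f(\omega)-\min_{g\in F}g(\omega)\Big)\,d\mu(\omega)$$ for finite nonempty $F$ (and $\delta(\emptyset)=0$). An $L_1$ diversity is a diversity that can be embedded (by a map preserving $\delta$ on all finite sets) in $L_1(\Omega,\mathcal{A},\mu)$ with this diversity function, for some measure space. A diversity is viewed as a relational metric structure with metric $d$ and one $k$-ary predicate $\delta_k$ for each $k\ge1$, given by $\delta_k(x_1,\dots,x_k)=\delta(\{x_1,\dots,x_k\})$. **Structures.** A relational language $\mathcal{L}$ is a collection of predicate symbols with finite arities, including a distinguished binary symbol $d$. An $\mathcal{L}$-structure $\mathfrak{A}$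 is a complete metric space $(A,d)$ together with, for each $n$-ary $R\in\mathcal{L}$, a uniformly continuous function $R^{\mathfrak{A}}\colon A^n\to\mathbb{R}$ ($d$ being interpreted by the metric). An embedding is a map preserving the values of all predicates (hence isometric). $\mathfrak{A}$ is a substructure of $\mathfrak{B}$ if there is an embedding $\mathfrak{A}\to\mathfrak{B}$. An isomorphism is a surjective embedding; an automorphism is an isomorphism from a structure to itself. A separable structure $\mathfrak{M}$ is ultrahomogeneous if every embedding $A_0\to M$ with $A_0\subseteq M$ finite extends to an automorphism of $\mathfrak{M}$. In the uniqueness assertion, "such" means a (complete) separable $L_1$ diversity that is ultrahomogeneous and universal with respect to separable $L_1$ diversities. **Properties of a class $\mathcal{K}$ of finite structures.** A $\mathcal{K}$-structure is an $\mathcal{L}$-structure all of whose finite substructures are in $\mathcal{K}$. - HP: all members of $\mathcal{K}$ are $\mathcal{K}$-structures. - JEP: every two structures in $\mathcal{K}$ embed into a third one in $\mathcal{K}$. - AP: for all $\mathfrak{A},\mathfrak{B},\mathfrak{C}\in\mathcal{K}$ and embeddings $f_B\colon\mathfrak{A}\to\mathfrak{B}$, $f_C\colon\mathfrak{A}\to\mathfrak{C}$ there are $\mathfrak{D}\in\mathcal{K}$ and embeddings $g_B\colon\mathfrak{B}\to\mathfrak{D}$, $g_C\colon\mathfrak{C}\to\mathfrak{D}$ with $g_B\circ f_B=g_C\circ f_C$. $\mathcal{K}_n$ is the set of enumerated structures of length $n$: all $n$-tuples $\bar a$ (repetitions allowed) of elements of some structure in $\mathcal{K}$; an embedding of $\bar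 a$ is a map on its entries preserving all predicate values. For $\bar a,\bar b\in\mathcal{K}_n$, $$d_{\mathcal{K}}(\bar a,\bar b)=\inf_{\bar a',\bar b'}\max_i d(a_i',b_i'),$$ over images $\bar a',\bar b'$ of $\bar a,\bar b$ under embeddings into a common structure in $\mathcal{K}$; and $$d_\infty(\bar a,\bar b)=\max_{m\le n}\ \max_{X\subseteq\{1,\dots,n\},\,|X|=m,\ R\text{ of arity }m}|R(\bar a_X)-R(\bar b_X)|,$$ where $R$ ranges over the predicates including $d$ and $\bar a_X$ is the subtuple indexed by $X$. - PP: for every $n$, $\mathcal{K}_n$ is separable and complete under the pseudometric $d_{\mathcal{K}}$. - CP: for every $n$-ary predicate $P$, the map $\mathcal{K}_n\to\mathbb{R}$, $\bar a\mapsto P(\bar a)$, is continuous with respect to $d_{\mathcal{K}}$. - bAP: for each $n$ there is a constant $c$ depending only on $n$ such that if $(\bar a,w)$ and $(\bar a,z)$ are enumerated structures in $\mathcal{K}_n$ with common substructure $\bar a$, then there is an amalgamation $B=(\bar a,w,z)$ in $\mathcal{K}_{n+1}$ (its subtuples $(\bar a,w)$, $(\bar a,z)$ carry the given predicate values) with $d_B(w,z)\le c\,d_\infty((\bar a,w),(\bar a,z))$. **Fraïssé classes and limits.** $\mathcal{K}$ is a Fraïssé class if it satisfies HP, JEP, AP, PP and CP. Its limit is the (unique up to isomorphism) separable $\mathcal{K}$-structure $\mathfrak{M}$ with the approximate extension property: for every finite $\mathcal{K}$-structure $\mathfrak{B}$, finite (possibly empty) tuple $\bar a$ of elements of $B$,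 embedding $h\colon\bar a\to\mathfrak{M}$ and $\epsilon>0$, there is an embedding $f\colon\mathfrak{B}\to\mathfrak{M}$ with $\max_i d(f(a_i),h(a_i))<\epsilon$. *)

theory Defs
  imports "HOL-Analysis.Analysis"
begin

section \<open>Diversities\<close>

definition diversity :: "'a set \<Rightarrow> ('a set \<Rightarrow> real) \<Rightarrow> bool" where
  "diversity X \<delta> \<longleftrightarrow>
     (\<forall>A\<in>Fpow X. 0 \<le> \<delta> A \<and> (\<delta> A = 0 \<longleftrightarrow> card A \<le> 1)) \<and>
     (\<forall>A\<in>Fpow X. \<forall>B\<in>Fpow X. \<forall>C\<in>Fpow X. B \<noteq> {} \<longrightarrow> \<delta> (A \<union> C) \<le> \<delta> (A \<union> B) + \<delta> (B \<union> C))"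

definition L1_div :: "'w measure \<Rightarrow> ('w \<Rightarrow> real) set \<Rightarrow> real" where
  "L1_div M F =
     (if F = {} then 0
      else \<integral>\<omega>. Max ((\<lambda>f. f \<omega>) ` F) - Min ((\<lambda>f. f \<omega>) ` F) \<partial>M)"

text \<open>
  Elements of \<open>L\<^sub>1\<close> are given by integrable representatives; \<open>L1_div\<close> does not depend on
  the choice of representatives.
\<close>

definition L1_embedding ::
  "('a \<Rightarrow> 'w \<Rightarrow> real) \<Rightarrow> 'a set \<Rightarrow> ('a set \<Rightarrow> real) \<Rightarrow> 'w measure \<Rightarrow> bool" where
  "L1_embedding \<phi> X \<delta> M \<longleftrightarrow>
     (\<forall>x\<in>X. integrable M (\<phi> x)) \<and> (\<forall>F\<in>Fpow X. L1_div M (\<phi> ` F) = \<delta> F)"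

text \<open>
  The measure space is an arbitrary one. HOL cannot quantify over its underlying type, but
  measures on \<open>'a \<Rightarrow> real\<close> suffice: given an embedding \<open>\<phi>\<close> into \<open>L\<^sub>1\<close> of any measure space,
  push the measure forward along \<open>\<omega> \<mapsto> (\<lambda>x. \<phi> x \<omega>)\<close>. This is lemma \<open>L1_diversityI\<close>.
\<close>

definition L1_diversity :: "'a set \<Rightarrow> ('a set \<Rightarrow> real) \<Rightarrow> bool" where
  "L1_diversity X \<delta> \<longleftrightarrow>
     diversity X \<delta> \<and> (\<exists>(M :: ('a \<Rightarrow> real) measure) \<phi>. L1_embedding \<phi> X \<delta> M)"

lemma L1_diversityI:
  fixes X :: "'a set" and M :: "'w measure"
  assumes "diversity X \<delta>" and emb: "L1_embedding \<phi> X \<delta> M"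
  shows "L1_diversity X \<delta>"
proof -
  define P where "P = PiM X (\<lambda>_. borel :: real measure)"
  define T where "T = (\<lambda>\<omega>. \<lambda>x\<in>X. \<phi> x \<omega>)"
  define N where "N = distr M P T"
  define \<psi> :: "'a \<Rightarrow> ('a \<Rightarrow> real) \<Rightarrow> real" where "\<psi> = (\<lambda>x g. g x)"
  have int: "integrable M (\<phi> x)" if "x \<in> X" for x
    using emb that by (simp add: L1_embedding_def)
  have T: "T \<in> measurable M P"
    unfolding T_def P_def using int by (intro measurable_restrict) auto
  have \<psi>: "\<psi> x \<in> borel_measurable P" if "x \<in> X" for x
    unfolding P_def \<psi>_def using that by (rule measurable_component_singleton)
  have \<psi>T: "\<psi> x (T \<omega>) = \<phi> x \<omega>" if "x \<in> X" for x \<omega>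
    using that by (simp add: \<psi>_def T_def)
  have eq: "L1_div M (\<phi> ` F) = \<delta> F" if "F \<in> Fpow X" for F
    using emb that unfolding L1_embedding_def by blast
  have "integrable N (\<psi> x)" if "x \<in> X" for x
    unfolding N_def integrable_distr_eq[OF T \<psi>[OF that]] using int that by (simp add: \<psi>T)
  moreover have "L1_div N (\<psi> ` F) = \<delta> F" if F: "F \<in> Fpow X" for F
  proof (cases "F = {}")
    case True
    then show ?thesis using eq[OF F] by (simp add: L1_div_def)
  next
    case False
    have fin: "finite F" and sub: "F \<subseteq> X" using F by (auto simp: Fpow_def)
    define h where
      "h = (\<lambda>g. Max ((\<lambda>f. f g) ` \<psi> ` F) - Min ((\<lambda>f. f g) ` \<psi> ` F))"
    have h: "h \<in> borel_measurable P"
      unfolding h_def image_image using fin sub \<psi>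
      by (intro borel_measurable_diff borel_measurable_Max borel_measurable_Min) auto
    have img: "(\<lambda>x. \<psi> x (T \<omega>)) ` F = (\<lambda>x. \<phi> x \<omega>) ` F" for \<omega>
      using sub \<psi>T by (intro image_cong) auto
    have "L1_div N (\<psi> ` F) = integral\<^sup>L N h"
      using False by (simp add: L1_div_def h_def)
    also have "\<dots> = (\<integral>\<omega>. h (T \<omega>) \<partial>M)"
      unfolding N_def by (rule integral_distr[OF T h])
    also have "\<dots> = L1_div M (\<phi> ` F)"
      using False by (simp add: L1_div_def h_def image_image img)
    finally show ?thesis using eq[OF F] by simp
  qed
  ultimately have "L1_embedding \<psi> X \<delta> N" by (simp add: L1_embedding_def)
  with assms(1) show ?thesis unfolding L1_diversity_def by blast
qed


section \<open>Relational metric structures\<close>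

text \<open>
  Tuples are lists. Only the values of \<open>interp\<close> at symbols of the language and tuples of the right
  length over \<open>univ\<close> are meaningful, and all notions below look at these values only.
\<close>

record 'r language =
  symbols :: "'r set"
  arity :: "'r \<Rightarrow> nat"
  dist_sym :: 'r

record ('a, 'r) rel_struct =
  univ :: "'a set"
  interp :: "'r \<Rightarrow> 'a list \<Rightarrow> real"

definition sdist :: "'r language \<Rightarrow> ('a, 'r) rel_struct \<Rightarrow> 'a \<Rightarrow> 'a \<Rightarrow> real" where
  "sdist L A x y = (if x \<in> univ A \<and> y \<in> univ A then interp A (dist_sym L) [x, y] else 0)"

definition tuples :: "('a, 'r) rel_struct \<Rightarrow> nat \<Rightarrow> 'a list set" where
  "tuples A n = {xs. set xs \<subseteq> univ A \<and> length xs = n}"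

definition complete_structure :: "'r language \<Rightarrow> ('a, 'r) rel_struct \<Rightarrow> bool" where
  "complete_structure L A \<longleftrightarrow> Metric_space.mcomplete (univ A) (sdist L A)"

definition separable_structure :: "'r language \<Rightarrow> ('a, 'r) rel_struct \<Rightarrow> bool" where
  "separable_structure L A \<longleftrightarrow> separable_space (Metric_space.mtopology (univ A) (sdist L A))"

definition L_structure :: "'r language \<Rightarrow> ('a, 'r) rel_struct \<Rightarrow> bool" where
  "L_structure L A \<longleftrightarrow>
     Metric_space (univ A) (sdist L A) \<and> complete_structure L A \<and>
     (\<forall>R\<in>symbols L. \<forall>\<epsilon>>0. \<exists>\<eta>>0. \<forall>xs\<in>tuples A (arity L R). \<forall>ys\<in>tuples A (arity L R).
        (\<forall>i<arity L R. sdist L A (xs ! i) (ys ! i) < \<eta>) \<longrightarrow>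
        \<bar>interp A R xs - interp A R ys\<bar> < \<epsilon>)"

definition induced :: "('a, 'r) rel_struct \<Rightarrow> 'a set \<Rightarrow> ('a, 'r) rel_struct" where
  "induced A S = A\<lparr>univ := S\<rparr>"

definition embedding ::
  "'r language \<Rightarrow> ('a \<Rightarrow> 'b) \<Rightarrow> ('a, 'r) rel_struct \<Rightarrow> ('b, 'r) rel_struct \<Rightarrow> bool" where
  "embedding L f A B \<longleftrightarrow>
     f ` univ A \<subseteq> univ B \<and>
     (\<forall>R\<in>symbols L. \<forall>xs\<in>tuples A (arity L R). interp B R (map f xs) = interp A R xs)"

definition isomorphism ::
  "'r language \<Rightarrow> ('a \<Rightarrow> 'b) \<Rightarrow> ('a, 'r) rel_struct \<Rightarrow> ('b, 'r) rel_struct \<Rightarrow> bool" where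
  "isomorphism L f A B \<longleftrightarrow> embedding L f A B \<and> f ` univ A = univ B"

definition isomorphic ::
  "'r language \<Rightarrow> ('a, 'r) rel_struct \<Rightarrow> ('b, 'r) rel_struct \<Rightarrow> bool" where
  "isomorphic L A B \<longleftrightarrow> (\<exists>f. isomorphism L f A B)"

definition substructure ::
  "'r language \<Rightarrow> ('a, 'r) rel_struct \<Rightarrow> ('b, 'r) rel_struct \<Rightarrow> bool" where
  "substructure L A B \<longleftrightarrow> (\<exists>f. embedding L f A B)"

definition ultrahomogeneous :: "'r language \<Rightarrow> ('a, 'r) rel_struct \<Rightarrow> bool" where
  "ultrahomogeneous L M \<longleftrightarrow>
     separable_structure L M \<and>
     (\<forall>S f. finite S \<and> S \<subseteq> univ M \<and> embedding L f (induced M S) M \<longrightarrow>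
        (\<exists>g. isomorphism L g M M \<and> (\<forall>x\<in>S. g x = f x)))"


section \<open>Classes of finite structures\<close>

text \<open>
  A class of finite structures is represented by a set of structures whose universes are (finite)
  subsets of \<open>nat\<close>; up to isomorphism these are all finite structures.
\<close>

type_synonym 'r fin_class = "(nat, 'r) rel_struct set"

definition K_structure :: "'r language \<Rightarrow> 'r fin_class \<Rightarrow> ('a, 'r) rel_struct \<Rightarrow> bool" where
  "K_structure L K A \<longleftrightarrow>
     L_structure L A \<and>
     (\<forall>B :: (nat, 'r) rel_struct.
        L_structure L B \<and> finite (univ B) \<and> substructure L B A \<longrightarrow> B \<in> K)"

definition HP :: "'r language \<Rightarrow> 'r fin_class \<Rightarrow> bool" where
  "HP L K \<longleftrightarrow> (\<forall>A\<in>K. K_structure L K A)"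

definition JEP :: "'r language \<Rightarrow> 'r fin_class \<Rightarrow> bool" where
  "JEP L K \<longleftrightarrow> (\<forall>A\<in>K. \<forall>B\<in>K. \<exists>C\<in>K. substructure L A C \<and> substructure L B C)"

definition AP :: "'r language \<Rightarrow> 'r fin_class \<Rightarrow> bool" where
  "AP L K \<longleftrightarrow>
     (\<forall>A\<in>K. \<forall>B\<in>K. \<forall>C\<in>K. \<forall>f\<^sub>B f\<^sub>C. embedding L f\<^sub>B A B \<and> embedding L f\<^sub>C A C \<longrightarrow>
        (\<exists>D\<in>K. \<exists>g\<^sub>B g\<^sub>C. embedding L g\<^sub>B B D \<and> embedding L g\<^sub>C C D \<and>
           (\<forall>x\<in>univ A. g\<^sub>B (f\<^sub>B x) = g\<^sub>C (f\<^sub>C x))))"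

type_synonym ('a, 'r) enum_struct = "('a, 'r) rel_struct \<times> 'a list"

definition enumerated :: "'r fin_class \<Rightarrow> nat \<Rightarrow> (nat, 'r) enum_struct set" where
  "enumerated K n = {(A, as). A \<in> K \<and> as \<in> tuples A n}"

text \<open>Equality as enumerated structures: \<open>a\<^sub>i \<mapsto> b\<^sub>i\<close> preserves all predicate values.\<close>

definition same_values ::
  "'r language \<Rightarrow> ('a, 'r) enum_struct \<Rightarrow> ('b, 'r) enum_struct \<Rightarrow> bool" where
  "same_values L = (\<lambda>(A, as) (B, bs).
     length as = length bs \<and>
     (\<forall>R\<in>symbols L. \<forall>is. length is = arity L R \<and> set is \<subseteq> {..<length as} \<longrightarrow>
        interp A R (map ((!) as) is) = interp B R (map ((!) bs) is)))"

text \<open>In both maxima the inserted \<open>0\<close> only matters for tuples of length \<open>0\<close>.\<close>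

definition max_dist :: "'r language \<Rightarrow> ('a, 'r) rel_struct \<Rightarrow> 'a list \<Rightarrow> 'a list \<Rightarrow> real" where
  "max_dist L C xs ys = Max (insert 0 (set (map2 (sdist L C) xs ys)))"

definition d_inf ::
  "'r language \<Rightarrow> ('a, 'r) enum_struct \<Rightarrow> ('b, 'r) enum_struct \<Rightarrow> real" where
  "d_inf L = (\<lambda>(A, as) (B, bs).
     Max (insert 0 {\<bar>interp A R (nths as X) - interp B R (nths bs X)\<bar> | X R.
       X \<subseteq> {..<length as} \<and> R \<in> symbols L \<and> arity L R = card X}))"

definition d_K ::
  "'r language \<Rightarrow> 'r fin_class \<Rightarrow> (nat, 'r) enum_struct \<Rightarrow> (nat, 'r) enum_struct \<Rightarrow> real" where
  "d_K L K = (\<lambda>(A, as) (B, bs).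
     Inf {max_dist L C (map f as) (map g bs) | C f g.
       C \<in> K \<and> embedding L f (induced A (set as)) C \<and> embedding L g (induced B (set bs)) C})"

definition pseudometric_on :: "'s set \<Rightarrow> ('s \<Rightarrow> 's \<Rightarrow> real) \<Rightarrow> bool" where
  "pseudometric_on S d \<longleftrightarrow>
     (\<forall>x\<in>S. d x x = 0) \<and> (\<forall>x\<in>S. \<forall>y\<in>S. 0 \<le> d x y \<and> d x y = d y x) \<and>
     (\<forall>x\<in>S. \<forall>y\<in>S. \<forall>z\<in>S. d x z \<le> d x y + d y z)"

definition separable_pm :: "'s set \<Rightarrow> ('s \<Rightarrow> 's \<Rightarrow> real) \<Rightarrow> bool" where
  "separable_pm S d \<longleftrightarrow>
     (\<exists>Q. countable Q \<and> Q \<subseteq> S \<and> (\<forall>x\<in>S. \<forall>\<epsilon>>0. \<exists>q\<in>Q. d x q < \<epsilon>))"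

definition complete_pm :: "'s set \<Rightarrow> ('s \<Rightarrow> 's \<Rightarrow> real) \<Rightarrow> bool" where
  "complete_pm S d \<longleftrightarrow>
     (\<forall>\<sigma> :: nat \<Rightarrow> 's. range \<sigma> \<subseteq> S \<and> (\<forall>\<epsilon>>0. \<exists>N. \<forall>m\<ge>N. \<forall>n\<ge>N. d (\<sigma> m) (\<sigma> n) < \<epsilon>) \<longrightarrow>
        (\<exists>x\<in>S. (\<lambda>n. d (\<sigma> n) x) \<longlonglongrightarrow> 0))"

definition PP :: "'r language \<Rightarrow> 'r fin_class \<Rightarrow> bool" where
  "PP L K \<longleftrightarrow>
     (\<forall>n. pseudometric_on (enumerated K n) (d_K L K) \<and>
          separable_pm (enumerated K n) (d_K L K) \<and> complete_pm (enumerated K n) (d_K L K))"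

definition CP :: "'r language \<Rightarrow> 'r fin_class \<Rightarrow> bool" where
  "CP L K \<longleftrightarrow>
     (\<forall>R\<in>symbols L. \<forall>(A, as)\<in>enumerated K (arity L R). \<forall>\<epsilon>>0. \<exists>\<eta>>0.
        \<forall>(B, bs)\<in>enumerated K (arity L R).
          d_K L K (A, as) (B, bs) < \<eta> \<longrightarrow> \<bar>interp A R as - interp B R bs\<bar> < \<epsilon>)"

definition bAP :: "'r language \<Rightarrow> 'r fin_class \<Rightarrow> bool" where
  "bAP L K \<longleftrightarrow>
     (\<forall>n. \<exists>c :: real. \<forall>A as w B bs z.
        (A, as @ [w]) \<in> enumerated K n \<and> (B, bs @ [z]) \<in> enumerated K n \<and>
        same_values L (A, as) (B, bs) \<longrightarrow>
        (\<exists>D ds w' z'. (D, ds @ [w', z']) \<in> enumerated K (n + 1) \<and>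
           same_values L (D, ds @ [w']) (A, as @ [w]) \<and>
           same_values L (D, ds @ [z']) (B, bs @ [z]) \<and>
           sdist L D w' z' \<le> c * d_inf L (A, as @ [w]) (B, bs @ [z])))"

definition Fraisse_class :: "'r language \<Rightarrow> 'r fin_class \<Rightarrow> bool" where
  "Fraisse_class L K \<longleftrightarrow> HP L K \<and> JEP L K \<and> AP L K \<and> PP L K \<and> CP L K"

definition Fraisse_limit :: "'r language \<Rightarrow> 'r fin_class \<Rightarrow> ('m, 'r) rel_struct \<Rightarrow> bool" where
  "Fraisse_limit L K M \<longleftrightarrow>
     K_structure L K M \<and> separable_structure L M \<and>
     (\<forall>B :: (nat, 'r) rel_struct. finite (univ B) \<and> K_structure L K B \<longrightarrow>
        (\<forall>as h \<epsilon>. set as \<subseteq> univ B \<and> embedding L h (induced B (set as)) M \<and> 0 < \<epsilon> \<longrightarrow>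
           (\<exists>f. embedding L f B M \<and> (\<forall>a\<in>set as. sdist L M (f a) (h a) < \<epsilon>))))"


section \<open>Diversities as structures\<close>

datatype div_symbol = Dist | Delta nat

definition div_language :: "div_symbol language" where
  "div_language =
     \<lparr>symbols = insert Dist (Delta ` {1..}),
      arity = (\<lambda>R. case R of Dist \<Rightarrow> 2 | Delta k \<Rightarrow> k),
      dist_sym = Dist\<rparr>"

definition div_structure :: "'a set \<Rightarrow> ('a set \<Rightarrow> real) \<Rightarrow> ('a, div_symbol) rel_struct" where
  "div_structure X \<delta> = \<lparr>univ = X, interp = (\<lambda>_ xs. \<delta> (set xs))\<rparr>"

text \<open>
  The identity being an isomorphism says that the structures agree on all meaningful values.
\<close>

definition L1_structure :: "('a, div_symbol) rel_struct \<Rightarrow> bool" where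
  "L1_structure A \<longleftrightarrow>
     (\<exists>\<delta>. L1_diversity (univ A) \<delta> \<and>
          isomorphism div_language (\<lambda>x. x) A (div_structure (univ A) \<delta>))"

definition finite_L1_diversities :: "div_symbol fin_class" where
  "finite_L1_diversities = {A. finite (univ A) \<and> L1_structure A}"

text \<open>
  The diversities embedded need not be complete. The first argument fixes the type of their points;
  \<open>TYPE(real)\<close> covers all separable diversities up to isomorphism, as a separable metric
  space has at most continuum many points.
\<close>

definition universal_L1 :: "'x itself \<Rightarrow> ('m, div_symbol) rel_struct \<Rightarrow> bool" where
  "universal_L1 _ M \<longleftrightarrow>
     (\<forall>(X :: 'x set) \<delta>.
        L1_diversity X \<delta> \<and> separable_structure div_language (div_structure X \<delta>) \<longrightarrow>
        (\<exists>f. embedding div_language f (div_structure X \<delta>) M))"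

end

theory Submission
  imports Defs
begin

text \<open>
  The value of a finite \<open>L\<^sub>1\<close> diversity is a combination of cuts with nonnegative weights: maximum minus
  minimum of finitely many functions measures the levels \<open>t\<close> that separate them, and sorting these
  levels by the set of functions above \<open>t\<close> gives one weight for each cut of the index set
  (\<open>L1_embedding_cut_rep\<close>). Conversely, a combination of cuts is realized by sets of finite measure
  whose Venn diagram has one cell for each cut, of measure equal to its weight. If one index is kept on
  the negative side of all cuts, the weights of nonempty cuts are determined by the set function:
  Moebius inversion recovers them, so they depend on its values in a Lipschitz way
  (\<open>cut_weights_stable\<close>).

  This exhibits the limit. Take the Borel subsets of the line of finite Lebesgue measure modulo null
  sets, and let \<open>\<delta> F\<close> be the measure of the set of points that belong to some but not to all members
  of \<open>F\<close>. Let finitely many sets be given, together with a one-point extension of the diversity on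
  them which is again a combination of cuts. As Lebesgue measure has no atoms, every cell of their Venn
  diagram can be divided in the prescribed ratio, and the chosen parts form a set that realizes the
  extension. If a set \<open>w\<close> realizes the extension up to an error, the parts can be chosen comparable
  with \<open>w\<close> inside each cell, so that the new set is within a constant times the error of \<open>w\<close>
  (\<open>extend_sets\<close>). All assertions are derived from this quantitative extension property, together with
  completeness and separability of the space (\<open>universal_L1_space\<close>).

  The properties of the class are checked inside this space. Two extensions of a finite diversity are
  amalgamated by embedding the first one and extending the embedding of the common part to the second.
  The bound required by the bounded amalgamation property is the one just described. The distance of two
  enumerated structures is less than \<open>r\<close> if and only if they have copies in the space whose
  corresponding points are at distance less than \<open>r\<close>; thus separability and completeness pass from the
  space to the enumerated structures.

  For the limits, call a structure saturated if it is a complete separable diversity, all of whose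
  finite parts are combinations of cuts, and if it realizes all one-point extensions of its finite
  parts that are combinations of cuts. In a Fraisse limit the approximate extension property
  gives approximate realizations, and the quantitative bound makes a sequence of better and
  better ones Cauchy; its limit is exact, so Fraisse limits are saturated. A universal ultrahomogeneous
  diversity is saturated too: universality provides a copy of the extended tuple, and an automorphism
  moves it to the right place. A back-and-forth construction along dense sequences, followed by passage
  to completions, extends each finite partial isomorphism between saturated structures to an isomorphism
  (\<open>back_and_forth\<close>). This yields ultrahomogeneity and uniqueness, and its forth half alone gives
  universality. Finally, a Fraisse limit is an \<open>L\<^sub>1\<close> diversity as a whole, and not just on finite parts,
  because it is isomorphic to the concrete space.
\<close>

abbreviation (input) \<mu> :: "real set \<Rightarrow> real" where "\<mu> \<equiv> measure lborel"
abbreviation (input) \<M> :: "real set set" where "\<M> \<equiv> fmeasurable lborel"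
abbreviation (input) \<L> :: "div_symbol language" where "\<L> \<equiv> div_language"
abbreviation (input) \<K> :: "div_symbol fin_class" where "\<K> \<equiv> finite_L1_diversities"

section \<open>Cut decompositions of set functions\<close>

definition splits :: "'i set \<Rightarrow> 'i set \<Rightarrow> bool" where
  "splits U F \<longleftrightarrow> F \<inter> U \<noteq> {} \<and> F - U \<noteq> {}"

definition cut_sum :: "('i set \<Rightarrow> real) \<Rightarrow> 'i set \<Rightarrow> 'i set \<Rightarrow> real" where
  "cut_sum v I F = (\<Sum>U\<in>Pow I. if splits U F then v U else 0)"

text \<open>
  The cuts \<open>U\<close> and \<open>I - U\<close> separate the same sets, and the trivial cuts \<open>{}\<close> and \<open>I\<close> separate none, so
  the weights are far from unique here. The set function may vanish on larger sets than singletons;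
  hence tuples with repetitions can be treated like tuples without them.
\<close>

definition cut_rep :: "'i set \<Rightarrow> ('i set \<Rightarrow> real) \<Rightarrow> bool" where
  "cut_rep I \<gamma> \<longleftrightarrow> (\<exists>v. (\<forall>U. 0 \<le> v U) \<and> (\<forall>F\<subseteq>I. \<gamma> F = cut_sum v I F))"

text \<open>
  Pulling a cut back along a map gives a cut; the weights of all cuts with the same preimage add up.
\<close>

lemma cut_sum_image:
  assumes "finite I" "finite J" "f ` J \<subseteq> I" "F \<subseteq> J"
  shows "cut_sum v I (f ` F) = cut_sum (\<lambda>V. \<Sum>U | U \<in> Pow I \<and> {j \<in> J. f j \<in> U} = V. v U) J F"
proof -
  define p where "p = (\<lambda>U. {j \<in> J. f j \<in> U})"
  have sp: "splits U (f ` F) \<longleftrightarrow> splits (p U) F" for U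
    using assms(4) unfolding splits_def p_def by blast
  have "cut_sum v I (f ` F) = (\<Sum>U\<in>Pow I. if splits (p U) F then v U else 0)"
    by (simp add: cut_sum_def sp)
  also have "\<dots> = (\<Sum>V\<in>Pow J. \<Sum>U | U \<in> Pow I \<and> p U = V. if splits (p U) F then v U else 0)"
    using assms by (intro sum.group[symmetric]) (auto simp: p_def)
  also have "\<dots> = (\<Sum>V\<in>Pow J. if splits V F then (\<Sum>U | U \<in> Pow I \<and> p U = V. v U) else 0)"
    by (intro sum.cong refl) (auto intro!: sum.cong sum.neutral)
  finally show ?thesis unfolding cut_sum_def p_def .
qed

lemma cut_rep_image:
  assumes "cut_rep I \<gamma>" "finite I" "finite J" "f ` J \<subseteq> I"
  shows "cut_rep J (\<lambda>F. \<gamma> (f ` F))"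
proof -
  obtain v where v: "\<And>U. 0 \<le> v U" "\<And>F. F \<subseteq> I \<Longrightarrow> \<gamma> F = cut_sum v I F"
    using assms(1) by (auto simp: cut_rep_def)
  have "\<gamma> (f ` F) = cut_sum (\<lambda>V. \<Sum>U | U \<in> Pow I \<and> {j \<in> J. f j \<in> U} = V. v U) J F"
    if "F \<subseteq> J" for F
  proof -
    have "f ` F \<subseteq> I" using that assms(4) by (rule order_trans[OF image_mono])
    then show ?thesis using v(2) cut_sum_image[OF assms(2-4) that] by simp
  qed
  then show ?thesis
    unfolding cut_rep_def using v(1) by (intro exI[of _ "\<lambda>V. \<Sum>U | U \<in> Pow I \<and> {j \<in> J. f j \<in> U} = V. v U"]) (auto intro: sum_nonneg)
qed

lemma cut_rep_subset:
  assumes "cut_rep I \<gamma>" "finite I" "J \<subseteq> I"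
  shows "cut_rep J \<gamma>"
  using cut_rep_image[OF assms(1,2), of J "\<lambda>x. x"] assms by (simp add: finite_subset)

lemma cut_rep_trivial: "cut_rep I \<gamma> \<Longrightarrow> F \<subseteq> I \<Longrightarrow> F \<subseteq> {i} \<Longrightarrow> \<gamma> F = 0"
proof -
  assume "cut_rep I \<gamma>" "F \<subseteq> I" "F \<subseteq> {i}"
  moreover have "\<not> splits U F" for U using \<open>F \<subseteq> {i}\<close> unfolding splits_def by blast
  ultimately show ?thesis unfolding cut_rep_def cut_sum_def by auto
qed

text \<open>
  Each cut that contains the base point is replaced by its complement.
\<close>

lemma cut_rep_pointed:
  assumes "cut_rep I \<gamma>" "finite I" "i\<^sub>0 \<in> I"
  obtains v where "\<And>U. 0 \<le> v U" "\<And>U. i\<^sub>0 \<in> U \<Longrightarrow> v U = 0" "\<And>F. F \<subseteq> I \<Longrightarrow> \<gamma> F = cut_sum v I F"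
proof -
  obtain v where v: "\<And>U. 0 \<le> v U" "\<And>F. F \<subseteq> I \<Longrightarrow> \<gamma> F = cut_sum v I F"
    using assms(1) by (auto simp: cut_rep_def)
  define v' where "v' = (\<lambda>U. if i\<^sub>0 \<in> U then 0 else v U + v (I - U))"
  have "cut_sum v I F = cut_sum v' I F" if F: "F \<subseteq> I" for F
  proof -
    let ?P = "Pow (I - {i\<^sub>0})" and ?g = "\<lambda>v U. if splits U F then v U else 0"
    have P: "Pow I = ?P \<union> (\<lambda>U. I - U) ` ?P"
    proof
      show "Pow I \<subseteq> ?P \<union> (\<lambda>U. I - U) ` ?P"
      proof
        fix U assume U: "U \<in> Pow I"
        show "U \<in> ?P \<union> (\<lambda>U. I - U) ` ?P"
        proof (cases "i\<^sub>0 \<in> U")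
          case True
          then have "U = I - (I - U)" "I - U \<in> ?P" using U by auto
          then show ?thesis by blast
        qed (use U in auto)
      qed
    qed (use assms in auto)
    have disj: "?P \<inter> (\<lambda>U. I - U) ` ?P = {}" using assms(3) by auto
    have inj: "inj_on (\<lambda>U. I - U) ?P" by (rule inj_onI) auto
    have comp: "splits (I - U) F = splits U F" if "U \<subseteq> I" for U
      using F that unfolding splits_def by blast
    have split2: "cut_sum u I F = (\<Sum>U\<in>?P. ?g u U) + (\<Sum>U\<in>?P. if splits U F then u (I - U) else 0)" for u
    proof -
      have "cut_sum u I F = (\<Sum>U\<in>?P. ?g u U) + (\<Sum>U\<in>(\<lambda>U. I - U) ` ?P. ?g u U)"
        unfolding cut_sum_def P using disj assms(2) by (intro sum.union_disjoint) auto
      also have "(\<Sum>U\<in>(\<lambda>U. I - U) ` ?P. ?g u U) = (\<Sum>U\<in>?P. ?g u (I - U))"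
        using inj by (simp add: sum.reindex)
      also have "\<dots> = (\<Sum>U\<in>?P. if splits U F then u (I - U) else 0)"
        by (intro sum.cong refl if_cong comp) auto
      finally show ?thesis .
    qed
    have "cut_sum v' I F = (\<Sum>U\<in>?P. ?g v' U) + (\<Sum>U\<in>?P. if splits U F then v' (I - U) else 0)"
      by (rule split2)
    also have "(\<Sum>U\<in>?P. if splits U F then v' (I - U) else 0) = 0"
      using assms(3) by (intro sum.neutral) (auto simp: v'_def)
    also have "(\<Sum>U\<in>?P. ?g v' U) = (\<Sum>U\<in>?P. ?g v U + (if splits U F then v (I - U) else 0))"
      by (intro sum.cong refl) (auto simp: v'_def)
    finally show ?thesis unfolding split2[of v] by (simp add: sum.distrib)
  qed
  then show thesis
    using v by (intro that[of v']) (auto simp: v'_def)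
qed

text \<open>
  Let \<open>T\<close> avoid the base point. Among the cuts that avoid it too, those that split \<open>I\<close> but not \<open>I - T\<close>
  are the nonempty subsets of \<open>T\<close>. So differences of values of the set function are the sums of the weights over the
  subsets of \<open>T\<close>, and Moebius inversion returns the weights. The case \<open>\<epsilon> = 0\<close> is uniqueness of pointed
  weights.
\<close>

lemma cut_weights_stable:
  assumes fin: "finite I" and i0: "i\<^sub>0 \<in> I"
    and v0: "\<And>U. i\<^sub>0 \<in> U \<Longrightarrow> v U = 0" and w0: "\<And>U. i\<^sub>0 \<in> U \<Longrightarrow> w U = 0"
    and close: "\<And>F. F \<subseteq> I \<Longrightarrow> \<bar>cut_sum v I F - cut_sum w I F\<bar> \<le> \<epsilon>"
    and S: "S \<subseteq> I" "S \<noteq> {}" "i\<^sub>0 \<notin> S"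
  shows "\<bar>v S - w S\<bar> \<le> 2 ^ card I * (2 * \<epsilon>)"
proof -
  \<comment> \<open>The weight of the empty cut is arbitrary, so it is set to \<open>0\<close> before inverting.\<close>
  define f where "f = (\<lambda>U. if U \<subseteq> I - {i\<^sub>0} \<and> U \<noteq> {} then v U - w U else 0)"
  define D where "D = (\<lambda>F. cut_sum v I F - cut_sum w I F)"
  have D: "D F = (\<Sum>U\<in>Pow I. if splits U F then f U else 0)" for F
    unfolding D_def cut_sum_def sum_subtractf[symmetric]
    using v0 w0 by (intro sum.cong refl) (auto simp: f_def splits_def)
  have g: "sum f (Pow T) = D I - D (I - T)" if T: "T \<subseteq> S" for T
  proof -
    have "D I - D (I - T) = (\<Sum>U\<in>Pow I. if U \<in> Pow T then f U else 0)"
      unfolding D sum_subtractf[symmetric]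
    proof (intro sum.cong refl)
      fix U assume "U \<in> Pow I"
      show "(if splits U I then f U else 0) - (if splits U (I - T) then f U else 0)
          = (if U \<in> Pow T then f U else 0)"
      proof (cases "U \<subseteq> I - {i\<^sub>0} \<and> U \<noteq> {}")
        case True
        then have "splits U I" "splits U (I - T) \<longleftrightarrow> \<not> U \<subseteq> T"
          using i0 S T unfolding splits_def by blast+
        then show ?thesis by simp
      next
        case False
        then have "f U = 0" unfolding f_def by (rule if_not_P)
        then show ?thesis by simp
      qed
    qed
    also have "\<dots> = sum f (Pow T)"
      using S T fin by (subst sum.inter_restrict[symmetric]) (auto intro!: sum.cong)
    finally show ?thesis by simp
  qed
  have "finite S" using S fin finite_subset by blast
  have "0 \<le> \<epsilon>" using close[of I] abs_ge_zero[of "cut_sum v I I - cut_sum w I I"] by simp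
  have "f S = (\<Sum>T\<in>Pow S. (-1) ^ (card S - card T) * sum f (Pow T))"
    using \<open>finite S\<close> by (intro inclusion_exclusion_mobius) auto
  then have "\<bar>f S\<bar> \<le> (\<Sum>T\<in>Pow S. \<bar>(-1) ^ (card S - card T) * sum f (Pow T)\<bar>)"
    by (metis sum_abs)
  also have "\<dots> \<le> (\<Sum>T\<in>Pow S. 2 * \<epsilon>)"
  proof (rule sum_mono)
    fix T assume "T \<in> Pow S"
    then have "sum f (Pow T) = D I - D (I - T)" using g by auto
    moreover have "\<bar>D I\<bar> \<le> \<epsilon>" "\<bar>D (I - T)\<bar> \<le> \<epsilon>" unfolding D_def by (auto intro!: close)
    ultimately show "\<bar>(-1) ^ (card S - card T) * sum f (Pow T)\<bar> \<le> 2 * \<epsilon>"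
      by (simp add: abs_mult)
  qed
  also have "\<dots> = 2 ^ card S * (2 * \<epsilon>)" using \<open>finite S\<close> by (simp add: card_Pow)
  also have "\<dots> \<le> 2 ^ card I * (2 * \<epsilon>)"
    using S fin \<open>0 \<le> \<epsilon>\<close> by (intro mult_right_mono power_increasing card_mono) auto
  finally show ?thesis using S by (simp add: f_def subset_Diff_insert)
qed

section \<open>Cuts from sets of finite measure and from integrable functions\<close>

text \<open>
  For a nonempty family this is the measure of the union minus the intersection.
\<close>

definition spread :: "real set set \<Rightarrow> real" where
  "spread F = \<mu> {\<omega>. (\<exists>A\<in>F. \<omega> \<in> A) \<and> (\<exists>B\<in>F. \<omega> \<notin> B)}"

text \<open>
  The cells of the Venn diagram of the family.
\<close>

definition cell :: "('i \<Rightarrow> real set) \<Rightarrow> 'i set \<Rightarrow> 'i set \<Rightarrow> real set" where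
  "cell a I U = {\<omega>. {i\<in>I. \<omega> \<in> a i} = U}"

lemma spread_pair: "spread {A, B} = \<mu> (sym_diff A B)"
  unfolding spread_def by (rule arg_cong[of _ _ "\<mu>"]) auto

lemma Icc_fmeasurable: "{a..b :: real} \<in> \<M>"
  by (intro fmeasurableI) (auto intro: emeasure_compact_finite[simplified])

lemma fmeasurable_borel: "A \<in> \<M> \<Longrightarrow> A \<in> sets borel"
  using fmeasurableD by fastforce

lemma cell_sets:
  assumes "finite I" "\<And>i. i \<in> I \<Longrightarrow> a i \<in> sets lborel"
  shows "cell a I U \<in> sets lborel"
proof (cases "U \<subseteq> I")
  case True
  have "{\<omega>\<in>space lborel. \<forall>i\<in>I. \<omega> \<in> a i \<longleftrightarrow> i \<in> U} \<in> sets lborel"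
  proof (intro sets.sets_Collect_finite_All assms)
    fix i assume "i \<in> I"
    then show "{\<omega>\<in>space lborel. \<omega> \<in> a i \<longleftrightarrow> i \<in> U} \<in> sets lborel"
      using assms(2)[of i] by (cases "i \<in> U") (auto simp: Compl_eq[symmetric])
  qed
  moreover have "cell a I U = {\<omega>\<in>space lborel. \<forall>i\<in>I. \<omega> \<in> a i \<longleftrightarrow> i \<in> U}"
    using True by (auto simp: cell_def)
  ultimately show ?thesis by simp
next
  case False
  then have "cell a I U = {}" by (auto simp: cell_def)
  then show ?thesis by simp
qed

lemma cell_fmeasurable:
  assumes "finite I" "\<And>i. i \<in> I \<Longrightarrow> a i \<in> \<M>" "U \<noteq> {}"
  shows "cell a I U \<in> \<M>"
proof (cases "U \<subseteq> I")
  case True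
  then obtain i where "i \<in> U" "i \<in> I" using assms(3) by auto
  then have "cell a I U \<subseteq> a i" by (auto simp: cell_def)
  moreover have "cell a I U \<in> sets lborel" using assms(1) fmeasurableD[OF assms(2)] by (rule cell_sets)
  ultimately show ?thesis by (rule fmeasurableI2[OF assms(2)[OF \<open>i \<in> I\<close>]])
next
  case False
  then have "cell a I U = {}" by (auto simp: cell_def)
  then show ?thesis by simp
qed

text \<open>
  A point is separated by the sets with indices in \<open>F\<close> exactly if the cut given by the indices of the
  sets containing it splits \<open>F\<close>.
\<close>

lemma spread_cut_sum:
  assumes fin: "finite I" and a: "\<And>i. i \<in> I \<Longrightarrow> a i \<in> \<M>" and F: "F \<subseteq> I"
  shows "spread (a ` F) = cut_sum (\<lambda>U. \<mu> (cell a I U)) I F"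
proof -
  let ?S = "{U \<in> Pow I. splits U F}"
  have "{\<omega>. (\<exists>A\<in>a ` F. \<omega> \<in> A) \<and> (\<exists>B\<in>a ` F. \<omega> \<notin> B)} = (\<Union>U\<in>?S. cell a I U)"
  proof (rule set_eqI)
    fix \<omega>
    have "(\<exists>A\<in>a ` F. \<omega> \<in> A) \<and> (\<exists>B\<in>a ` F. \<omega> \<notin> B) \<longleftrightarrow> splits {i\<in>I. \<omega> \<in> a i} F"
    proof -
      have "(\<exists>A\<in>a ` F. \<omega> \<in> A) \<longleftrightarrow> F \<inter> {i\<in>I. \<omega> \<in> a i} \<noteq> {}" using F by auto
      moreover have "(\<exists>B\<in>a ` F. \<omega> \<notin> B) \<longleftrightarrow> F - {i\<in>I. \<omega> \<in> a i} \<noteq> {}" using F by auto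
      ultimately show ?thesis unfolding splits_def by simp
    qed
    moreover have "\<dots> \<longleftrightarrow> \<omega> \<in> (\<Union>U\<in>?S. cell a I U)"
      by (auto simp: cell_def)
    ultimately show "\<omega> \<in> {\<omega>. (\<exists>A\<in>a ` F. \<omega> \<in> A) \<and> (\<exists>B\<in>a ` F. \<omega> \<notin> B)} \<longleftrightarrow> \<omega> \<in> (\<Union>U\<in>?S. cell a I U)"
      by simp
  qed
  then have "spread (a ` F) = \<mu> (\<Union>U\<in>?S. cell a I U)"
    by (simp add: spread_def)
  also have "\<dots> = (\<Sum>U\<in>?S. \<mu> (cell a I U))"
  proof (rule measure_finite_Union)
    show "disjoint_family_on (cell a I) ?S"
      by (auto simp: disjoint_family_on_def cell_def)
    have U: "cell a I U \<in> \<M>" if "U \<in> ?S" for U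
      using that fin a by (intro cell_fmeasurable) (auto simp: splits_def)
    show "emeasure lborel (cell a I U) \<noteq> \<infinity>" if "U \<in> ?S" for U
      using U[OF that] by (auto dest: fmeasurableD2)
    show "cell a I ` ?S \<subseteq> sets lborel" using fmeasurableD[OF U] by blast
  qed (use fin in auto)
  also have "\<dots> = cut_sum (\<lambda>U. \<mu> (cell a I U)) I F"
    unfolding cut_sum_def using fin by (intro sum.inter_filter) auto
  finally show ?thesis .
qed

text \<open>
  This is the previous lemma for the intervals from a common lower bound up to the numbers \<open>x i\<close>: the
  cell of \<open>U\<close> is the interval between the largest number outside \<open>U\<close> and the smallest one in \<open>U\<close>.
\<close>

lemma max_minus_min_cut_sum:
  fixes x :: "'i \<Rightarrow> real"
  assumes fin: "finite I" and F: "F \<subseteq> I" "F \<noteq> {}"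
  shows "Max (x ` F) - Min (x ` F) =
    cut_sum (\<lambda>U. if U = {} \<or> U = I then 0 else max 0 (Min (x ` U) - Max (x ` (I - U)))) I F"
proof -
  have I: "I \<noteq> {}" using F by auto
  have finF: "finite F" using F fin finite_subset by blast
  define m where "m = Min (x ` I)"
  define a where "a = (\<lambda>i. {m..<x i})"
  have m: "m \<le> x i" if "i \<in> I" for i using that fin by (simp add: m_def)
  have fm: "a i \<in> \<M>" for i
    by (rule fmeasurableI2[OF Icc_fmeasurable[of m "x i"]]) (auto simp: a_def)
  have "Max (x ` F) - Min (x ` F) = spread (a ` F)"
  proof -
    have le: "Min (x ` F) \<le> Max (x ` F)" using finF F by simp
    have mF: "m \<le> Min (x ` F)" using finF F m by (subst Min_ge_iff) auto
    have "{\<omega>. (\<exists>A\<in>a ` F. \<omega> \<in> A) \<and> (\<exists>B\<in>a ` F. \<omega> \<notin> B)} = {Min (x ` F)..<Max (x ` F)}" (is "?L = ?R")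
    proof (rule set_eqI)
      fix \<omega>
      have "\<omega> \<in> ?L \<longleftrightarrow> m \<le> \<omega> \<and> (\<exists>i\<in>F. \<omega> < x i) \<and> (\<exists>i\<in>F. x i \<le> \<omega>)"
        by (auto simp: a_def not_le not_less)
      also have "\<dots> \<longleftrightarrow> m \<le> \<omega> \<and> \<omega> < Max (x ` F) \<and> Min (x ` F) \<le> \<omega>"
        using finF F by (simp add: Max_gr_iff Min_le_iff)
      also have "\<dots> \<longleftrightarrow> \<omega> \<in> ?R" using mF by auto
      finally show "\<omega> \<in> ?L \<longleftrightarrow> \<omega> \<in> ?R" .
    qed
    then show ?thesis using le by (simp add: spread_def)
  qed
  also have "\<dots> = cut_sum (\<lambda>U. \<mu> (cell a I U)) I F"
    by (rule spread_cut_sum[OF fin fm F(1)])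
  also have "\<dots> = cut_sum (\<lambda>U. if U = {} \<or> U = I then 0 else max 0 (Min (x ` U) - Max (x ` (I - U)))) I F"
    unfolding cut_sum_def
  proof (intro sum.cong refl)
    fix U assume "U \<in> Pow I"
    then have U: "U \<subseteq> I" by simp
    show "(if splits U F then \<mu> (cell a I U) else 0) =
      (if splits U F then if U = {} \<or> U = I then 0 else max 0 (Min (x ` U) - Max (x ` (I - U))) else 0)"
    proof (cases "splits U F")
      case True
      then have ne: "U \<noteq> {}" "I - U \<noteq> {}" using F U by (auto simp: splits_def)
      have finU: "finite U" "finite (I - U)" using U fin finite_subset by auto
      have "cell a I U = {Max (x ` (I - U))..<Min (x ` U)}" (is "_ = ?R")
      proof (rule set_eqI)
        fix \<omega>
        have "\<omega> \<in> ?R \<longleftrightarrow> (\<forall>i\<in>I-U. x i \<le> \<omega>) \<and> (\<forall>i\<in>U. \<omega> < x i)"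
          using ne finU by (simp add: Max_le_iff Min_gr_iff)
        moreover have "\<omega> \<in> cell a I U \<longleftrightarrow> (\<forall>i\<in>U. m \<le> \<omega> \<and> \<omega> < x i) \<and> (\<forall>i\<in>I-U. \<not> (m \<le> \<omega> \<and> \<omega> < x i))"
          using U by (auto simp: cell_def a_def)
        moreover have "m \<le> \<omega>" if "\<forall>i\<in>I-U. x i \<le> \<omega>"
          using that ne m by force
        moreover obtain j where "j \<in> U" using ne by blast
        ultimately show "\<omega> \<in> cell a I U \<longleftrightarrow> \<omega> \<in> ?R"
          by (meson not_le)
      qed
      then show ?thesis using True ne by (auto simp: max_def)
    qed simp
  qed
  finally show ?thesis .
qed

text \<open>
  Integration of the pointwise decomposition.
\<close>

lemma L1_embedding_cut_rep:
  assumes emb: "L1_embedding \<phi> X \<delta> M" and fin: "finite I" and I: "I \<subseteq> X"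
  shows "cut_rep I \<delta>"
proof -
  define w where "w = (\<lambda>\<omega> U. if U = {} \<or> U = I then 0
    else max 0 (Min ((\<lambda>i. \<phi> i \<omega>) ` U) - Max ((\<lambda>i. \<phi> i \<omega>) ` (I - U))))"
  define v where "v = (\<lambda>U. if U \<subseteq> I then \<integral>\<omega>. w \<omega> U \<partial>M else 0)"
  have int: "integrable M (\<phi> i)" if "i \<in> I" for i
    using emb I that by (auto simp: L1_embedding_def)
  have intw: "integrable M (\<lambda>\<omega>. w \<omega> U)" if U: "U \<subseteq> I" for U
  proof (cases "U = {} \<or> U = I")
    case False
    then have "I - U \<noteq> {}" using U by blast
    have "integrable M (\<lambda>\<omega>. max 0 (Min ((\<lambda>i. \<phi> i \<omega>) ` U) - Max ((\<lambda>i. \<phi> i \<omega>) ` (I - U))))"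
      using False \<open>I - U \<noteq> {}\<close> U fin int finite_subset[OF U fin]
      by (intro integrable_max Bochner_Integration.integrable_diff integrable_MIN integrable_MAX
          integrable_zero) blast+
    then show ?thesis using False by (simp add: w_def)
  qed (auto simp: w_def)
  have "\<delta> F = cut_sum v I F" if F: "F \<subseteq> I" for F
  proof -
    have "F \<in> Fpow X" using F I fin by (auto simp: Fpow_def intro: finite_subset)
    then have \<delta>: "\<delta> F = L1_div M (\<phi> ` F)" using emb by (simp add: L1_embedding_def)
    show ?thesis
    proof (cases "F = {}")
      case True
      then show ?thesis using \<delta> by (simp add: L1_div_def cut_sum_def splits_def)
    next
      case False
      have "\<delta> F = (\<integral>\<omega>. cut_sum (w \<omega>) I F \<partial>M)"
        using False F max_minus_min_cut_sum[OF fin F False]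
        by (simp add: \<delta> L1_div_def image_image w_def)
      also have "\<dots> = (\<Sum>U\<in>Pow I. \<integral>\<omega>. (if splits U F then w \<omega> U else 0) \<partial>M)"
        unfolding cut_sum_def 
      proof (intro Bochner_Integration.integral_sum)
        fix U assume "U \<in> Pow I"
        then show "integrable M (\<lambda>\<omega>. if splits U F then w \<omega> U else 0)"
          using intw[of U] by (cases "splits U F") auto
      qed
      also have "\<dots> = cut_sum v I F"
        unfolding cut_sum_def by (intro sum.cong refl) (auto simp: v_def)
      finally show ?thesis .
    qed
  qed
  moreover have "0 \<le> v U" for U
    unfolding v_def w_def by (auto intro!: integral_nonneg_AE)
  ultimately show ?thesis unfolding cut_rep_def by blast
qed

text \<open>
  Outer regularity reduces the approximation to open sets, and these are increasing unions of finite
  unions of rational intervals.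
\<close>

lemma spread_dense_sequence:
  obtains D :: "nat \<Rightarrow> real set" where "\<And>n. D n \<in> \<M>"
    and "\<And>E \<epsilon>. E \<in> \<M> \<Longrightarrow> 0 < \<epsilon> \<Longrightarrow> \<exists>n. spread {E, D n} < \<epsilon>"
proof
  define ivl where "ivl = (\<lambda>(a, b). {real_of_rat a<..<real_of_rat b})"
  define D where "D = (\<lambda>n. \<Union>(ivl ` set (from_nat n :: (rat \<times> rat) list)))"
  have ivl: "ivl p \<in> \<M>" for p
    by (cases p, rule fmeasurableI2[OF Icc_fmeasurable[of "real_of_rat (fst p)" "real_of_rat (snd p)"]])
      (auto simp: ivl_def)
  show D: "D n \<in> \<M>" for n
    unfolding D_def using ivl by (intro fmeasurable.finite_UN) auto
  fix E :: "real set" and \<epsilon> :: real assume E: "E \<in> \<M>" and "0 < \<epsilon>"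
  obtain U where U: "open U" "E \<subseteq> U" "emeasure lborel (U - E) < ennreal (\<epsilon> / 2)"
    using outer_regular_lborel[of E "\<epsilon> / 2"] E \<open>0 < \<epsilon>\<close> by (auto dest: fmeasurable_borel)
  have UE: "U - E \<in> \<M>"
    using U E by (intro fmeasurableI) (auto dest: fmeasurable_borel intro: less_trans[OF _ ennreal_less_top])
  then have "\<mu> (U - E) < \<epsilon> / 2"
    using U(3) \<open>0 < \<epsilon>\<close> by (simp add: emeasure_eq_measure2 ennreal_less_iff)
  have Ufm: "U \<in> \<M>"
    using fmeasurable.Un[OF UE E] U(2) by (simp add: Un_absorb2)
  define ps where "ps = (\<lambda>m. filter (\<lambda>p. ivl p \<subseteq> U) (map from_nat [0..<m]) :: (rat \<times> rat) list)"
  define V where "V = (\<lambda>m. \<Union>(ivl ` set (ps m)))"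
  have V: "V m \<in> \<M>" for m
    unfolding V_def using ivl by (intro fmeasurable.finite_UN) auto
  have inc: "incseq V" 
  proof (rule incseq_SucI)
    show "V m \<subseteq> V (Suc m)" for m unfolding V_def ps_def by (intro Union_mono image_mono) auto
  qed
  have VU: "(\<Union>m. V m) = U"
  proof
    show "U \<subseteq> (\<Union>m. V m)"
    proof
      fix x assume "x \<in> U"
      then obtain e where e: "e > 0" "ball x e \<subseteq> U" using U(1) openE by blast
      obtain a where a: "x - e < real_of_rat a" "real_of_rat a < x" using of_rat_dense[of "x - e" x] e by auto
      obtain b where b: "x < real_of_rat b" "real_of_rat b < x + e" using of_rat_dense[of x "x + e"] e by auto
      have "ivl (a, b) \<subseteq> ball x e" using a b by (auto simp: ivl_def dist_real_def)
      then have "(a, b) \<in> set (ps (Suc (to_nat (a, b))))"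
        using e(2) unfolding ps_def by (auto intro!: image_eqI[of _ _ "to_nat (a, b)"])
      moreover have "x \<in> ivl (a, b)" using a b by (auto simp: ivl_def)
      ultimately show "x \<in> (\<Union>m. V m)" unfolding V_def by blast
    qed
  qed (auto simp: V_def ps_def)
  have "(\<lambda>m. \<mu> (V m)) \<longlonglongrightarrow> \<mu> (\<Union>m. V m)"
    using V inc Ufm VU by (intro Lim_measure_incseq) (auto dest: fmeasurable_borel fmeasurableD2)
  then have "\<forall>\<^sub>F m in sequentially. \<mu> U - \<epsilon> / 2 < \<mu> (V m)"
    unfolding VU using \<open>0 < \<epsilon>\<close> by (intro order_tendstoD) auto
  then obtain m where m: "\<mu> U - \<epsilon> / 2 < \<mu> (V m)"
    by (auto simp: eventually_sequentially)
  have sub: "V m \<subseteq> U" using VU by blast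
  then have UV: "\<mu> (U - V m) < \<epsilon> / 2"
    using m V Ufm by (subst measure_Diff) (auto dest: fmeasurable_borel fmeasurableD2)
  have "\<mu> (sym_diff E (V m)) \<le> \<mu> ((U - E) \<union> (U - V m))"
  proof (rule measure_mono_fmeasurable)
    show "sym_diff E (V m) \<subseteq> (U - E) \<union> (U - V m)" using sub U(2) by blast
    show "sym_diff E (V m) \<in> sets lborel"
      using fmeasurableD[OF E] fmeasurableD[OF V] by (intro sets.Un sets.Diff)
    show "(U - E) \<union> (U - V m) \<in> \<M>"
      using UE fmeasurable.Diff[OF Ufm V] by (rule fmeasurable.Un)
  qed
  also have "\<dots> \<le> \<mu> (U - E) + \<mu> (U - V m)"
    using UE V Ufm by (intro measure_Un_le) (auto dest: fmeasurable_borel)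
  also have "\<dots> < \<epsilon>" using UV \<open>\<mu> (U - E) < \<epsilon> / 2\<close> by simp
  finally have "spread {E, V m} < \<epsilon>" by (simp add: spread_pair)
  moreover have "V m = D (to_nat (ps m))" by (simp add: V_def D_def)
  ultimately show "\<exists>n. spread {E, D n} < \<epsilon>" by auto
qed

text \<open>
  The limit is the limit superior. A point at which it differs from \<open>A n\<close> lies in one of the symmetric
  differences of consecutive members from \<open>n\<close> on.
\<close>

lemma spread_fast_limit:
  assumes A: "\<And>k. A k \<in> \<M>"
    and fast: "\<And>k. spread {A k, A (Suc k)} \<le> (1/2) ^ k"
  obtains E where "E \<in> \<M>" "\<And>n. spread {A n, E} \<le> 2 * (1/2) ^ n"
proof
  define E where "E = (\<Inter>n. \<Union>k\<in>{n..}. A k)"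
  have sd: "sym_diff (A k) (A (Suc k)) \<in> \<M>" for k
    using A by (intro fmeasurable.Un fmeasurable.Diff) (auto dest: fmeasurable_borel)
  have Esets: "E \<in> sets lborel" unfolding E_def using fmeasurableD[OF A] by auto
  have bound: "sym_diff (A n) E \<in> \<M> \<and> \<mu> (sym_diff (A n) E) \<le> 2 * (1/2) ^ n" for n
  proof -
    let ?T = "\<Union>k. sym_diff (A (n + k)) (A (Suc (n + k)))"
    have sub: "sym_diff (A n) E \<subseteq> ?T"
    proof
      fix \<omega> assume \<omega>: "\<omega> \<in> sym_diff (A n) E"
      show "\<omega> \<in> ?T"
      proof (rule ccontr)
        assume "\<omega> \<notin> ?T"
        then have "\<omega> \<in> A (n + k) \<longleftrightarrow> \<omega> \<in> A (n + Suc k)" for k by auto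
        then have const: "\<omega> \<in> A (n + k) \<longleftrightarrow> \<omega> \<in> A n" for k by (induction k) auto
        have "\<omega> \<in> E \<longleftrightarrow> \<omega> \<in> A n"
        proof
          assume "\<omega> \<in> E"
          then obtain k where "k \<ge> n" "\<omega> \<in> A k" unfolding E_def by blast
          then show "\<omega> \<in> A n" using const[of "k - n"] by simp
        next
          assume n: "\<omega> \<in> A n"
          have "\<omega> \<in> A (max n j)" for j using const[of "max n j - n"] n by simp
          then show "\<omega> \<in> E" unfolding E_def by (auto intro: max.cobounded2)
        qed
        then show False using \<omega> by blast
      qed
    qed
    have "emeasure lborel (sym_diff (A n) E) \<le> emeasure lborel ?T"
      proof (rule emeasure_mono[OF sub])
      show "?T \<in> sets lborel"
        using fmeasurableD[OF sd] by (intro sets.countable_UN) (simp add: image_subset_iff)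
    qed
    also have "\<dots> \<le> (\<Sum>k. emeasure lborel (sym_diff (A (n + k)) (A (Suc (n + k)))))"
      using fmeasurableD[OF sd] by (intro emeasure_subadditive_countably) (simp add: image_subset_iff)
    also have "\<dots> \<le> (\<Sum>k. ennreal ((1/2) ^ n * (1/2) ^ k))"
    proof (intro suminf_le summableI)
      fix k
      have "emeasure lborel (sym_diff (A (n + k)) (A (Suc (n + k)))) = ennreal (spread {A (n + k), A (Suc (n + k))})"
        unfolding spread_pair using sd by (rule emeasure_eq_measure2)
      also have "\<dots> \<le> ennreal ((1/2) ^ n * (1/2) ^ k)"
        using fast[of "n + k"] by (intro ennreal_leI) (simp add: power_add)
      finally show "emeasure lborel (sym_diff (A (n + k)) (A (Suc (n + k)))) \<le> ennreal ((1/2) ^ n * (1/2) ^ k)" .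
    qed
    also have "\<dots> = ennreal ((1/2) ^ n * 2)"
    proof -
      have "(\<lambda>k. (1/2::real) ^ n * (1/2) ^ k) sums ((1/2) ^ n * 2)"
        using geometric_sums[of "1/2 :: real"] by (intro sums_mult) simp
      then show ?thesis by (subst suminf_ennreal2) (auto simp: sums_iff)
    qed
    finally have le: "emeasure lborel (sym_diff (A n) E) \<le> ennreal ((1/2) ^ n * 2)" .
    have "sym_diff (A n) E \<in> sets borel"
      using fmeasurable_borel[OF A[of n]] Esets by auto
    then have fm: "sym_diff (A n) E \<in> \<M>"
      using le by (intro fmeasurableI) (auto dest: fmeasurable_borel intro: le_less_trans)
    then show ?thesis using le by (simp add: emeasure_eq_measure2 mult.commute)
  qed
  show "spread {A n, E} \<le> 2 * (1/2) ^ n" for n using bound[of n] by (simp add: spread_pair)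
  show "E \<in> \<M>"
    using fmeasurable.Un[OF A[of 0] conjunct1[OF bound[of 0]]] Esets by (auto intro: fmeasurableI2)
qed

section \<open>Adding a set to a family\<close>

text \<open>
  The measure of the part of \<open>A\<close> between \<open>-t\<close> and \<open>t\<close> is a continuous function of \<open>t\<close> that increases from
  \<open>0\<close> to the measure of \<open>A\<close>, which may be infinite.
\<close>

lemma subset_of_measure:
  assumes A: "A \<in> sets borel" and r: "0 \<le> r" "ennreal r \<le> emeasure lborel A"
  obtains Y :: "real set" where "Y \<subseteq> A" "Y \<in> \<M>" "\<mu> Y = r"
proof (cases "ennreal r = emeasure lborel A")
  case True
  have "A \<in> \<M>" using A True[symmetric] by (intro fmeasurableI) auto
  moreover have "\<mu> A = r" using True[symmetric] r by (simp add: measure_def)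
  ultimately show ?thesis using that by blast
next
  case False
  then have lt: "ennreal r < emeasure lborel A" using r by simp
  define f where "f = (\<lambda>t. \<mu> (A \<inter> {-t..t}))"
  have fm: "A \<inter> {-t..t} \<in> \<M>" for t
    using A by (intro fmeasurableI2[OF Icc_fmeasurable[of "-t" t]]) auto
  have "(\<lambda>m. emeasure lborel (A \<inter> {-real m..real m})) \<longlonglongrightarrow> emeasure lborel (\<Union>m. A \<inter> {-real m..real m})"
    using A by (intro Lim_emeasure_incseq) (auto simp: incseq_def)
  also have "(\<Union>m. A \<inter> {-real m..real m}) = A"
  proof -
    have "\<exists>m. \<omega> \<in> {-real m..real m}" for \<omega> :: real
      using real_arch_simple[of "\<bar>\<omega>\<bar>"] by (auto simp: abs_le_iff) (metis minus_le_iff)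
    then show ?thesis by auto
  qed
  finally have "\<forall>\<^sub>F m in sequentially. ennreal r < emeasure lborel (A \<inter> {-real m..real m})"
    using lt by (rule order_tendstoD)
  then obtain m where m: "ennreal r < emeasure lborel (A \<inter> {-real m..real m})"
    by (auto simp: eventually_sequentially)
  then have "r \<le> f (real m)"
    using r by (simp add: f_def emeasure_eq_measure2[OF fm] ennreal_less_iff)
  moreover have f0: "f 0 = 0"
  proof -
    have "f 0 \<le> \<mu> {0::real}"
      unfolding f_def using A Icc_fmeasurable[of 0 0] by (intro measure_mono_fmeasurable) auto
    moreover have "0 \<le> f 0" by (simp add: f_def)
    ultimately show ?thesis by simp
  qed
  moreover have "continuous_on {0..real m} f"
  proof -
    have lip: "\<bar>f t - f s\<bar> \<le> 2 * (t - s)" if "0 \<le> s" "s \<le> t" for s t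
    proof -
      have "A \<inter> {-t..t} \<subseteq> (A \<inter> {-s..s}) \<union> ({-t..-s} \<union> {s..t})" by auto
      then have "f t \<le> \<mu> ((A \<inter> {-s..s}) \<union> ({-t..-s} \<union> {s..t}))"
        unfolding f_def using fm[of t] fm[of s]
        by (intro measure_mono_fmeasurable) (auto intro: fmeasurable.Un Icc_fmeasurable dest: fmeasurable_borel)
      also have "\<dots> \<le> f s + \<mu> ({-t..-s} \<union> {s..t})"
        unfolding f_def using A by (intro measure_Un_le) auto
      also have "\<mu> ({-t..-s} \<union> {s..t}) \<le> \<mu> {-t..-s} + \<mu> {s..t}"
        by (intro measure_Un_le) auto
      also have "\<dots> = 2 * (t - s)" using that by simp
      finally have "f t \<le> f s + 2 * (t - s)" by simp
      moreover have "f s \<le> f t"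
        unfolding f_def using fm that A by (intro measure_mono_fmeasurable) auto
      ultimately show ?thesis by simp
    qed
    have "2-lipschitz_on {0..real m} f"
    proof (rule lipschitz_onI)
      fix s t assume "s \<in> {0..real m}" "t \<in> {0..real m}"
      then show "dist (f s) (f t) \<le> 2 * dist s t"
        using lip[of s t] lip[of t s] by (cases "s \<le> t") (auto simp: dist_real_def abs_minus_commute)
    qed simp
    then show ?thesis by (rule lipschitz_on_continuous_on)
  qed
  ultimately obtain t where "f t = r"
    using IVT'[of f 0 r "real m"] r by auto
  then show ?thesis using fm[of t] that[of "A \<inter> {-t..t}"] by (auto simp: f_def)
qed

text \<open>
  The subset is chosen inside or around \<open>W\<close>, according to which of the two measures is larger; this
  makes its distance from \<open>W\<close> as small as possible.
\<close>

lemma comparable_subset_of_measure: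
  assumes E: "E \<in> sets borel" and W: "W \<in> \<M>" "W \<subseteq> E"
    and q: "0 \<le> q" "ennreal q \<le> emeasure lborel E"
  obtains Z :: "real set" where "Z \<subseteq> E" "Z \<in> \<M>" "\<mu> Z = q"
    "\<mu> (sym_diff Z W) = \<bar>q - \<mu> W\<bar>"
proof (cases "q \<le> \<mu> W")
  case True
  then have "ennreal q \<le> emeasure lborel W" using W by (simp add: emeasure_eq_measure2 ennreal_leI)
  then obtain Z where Z: "Z \<subseteq> W" "Z \<in> \<M>" "\<mu> Z = q"
    using subset_of_measure[of W q] W q by (auto dest: fmeasurable_borel)
  have "sym_diff Z W = W - Z" using Z by auto
  also have "\<mu> \<dots> = \<mu> W - \<mu> Z"
    using Z W by (intro measure_Diff) (auto dest: fmeasurable_borel fmeasurableD2)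
  finally show ?thesis using that[of Z] Z W True by auto
next
  case False
  have Wb: "W \<in> sets borel" using W by (simp add: fmeasurable_borel)
  have "emeasure lborel E = emeasure lborel W + emeasure lborel (E - W)"
    using W E Wb by (subst plus_emeasure) (auto simp: Un_absorb1)
  moreover have "emeasure lborel W = ennreal (\<mu> W)" using W by (simp add: emeasure_eq_measure2)
  moreover have "ennreal q = ennreal (\<mu> W) + ennreal (q - \<mu> W)"
    using False by (simp flip: ennreal_plus)
  ultimately have "ennreal (q - \<mu> W) \<le> emeasure lborel (E - W)"
    using q by (simp add: ennreal_add_left_cancel_le)
  then obtain Y where Y: "Y \<subseteq> E - W" "Y \<in> \<M>" "\<mu> Y = q - \<mu> W"
    using subset_of_measure[of "E - W" "q - \<mu> W"] E Wb False by auto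
  have "\<mu> (W \<union> Y) = \<mu> W + \<mu> Y"
    using Y W by (intro measure_Union) (auto dest: fmeasurable_borel fmeasurableD2)
  moreover have "sym_diff (W \<union> Y) W = Y" using Y by auto
  ultimately show ?thesis using that[of "W \<union> Y"] Y W False by (auto intro: fmeasurable.Un)
qed

text \<open>
  Marginal weights: a cut of \<open>I\<close> has two extensions to one more index.
\<close>

lemma cut_sum_insert:
  assumes "finite I" "n \<notin> I" "F \<subseteq> I"
  shows "cut_sum v (insert n I) F = cut_sum (\<lambda>U. v U + v (insert n U)) I F"
proof -
  let ?g = "\<lambda>U. if splits U F then v U else 0"
  have "cut_sum v (insert n I) F = sum ?g (Pow I) + sum ?g (insert n ` Pow I)"
    unfolding cut_sum_def Pow_insert using assms by (intro sum.union_disjoint) auto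
  also have "sum ?g (insert n ` Pow I) = (\<Sum>U\<in>Pow I. ?g (insert n U))"
    using assms(2) by (subst sum.reindex) (auto intro!: inj_onI simp: insert_ident)
  also have "\<dots> = (\<Sum>U\<in>Pow I. if splits U F then v (insert n U) else 0)"
    using assms by (intro sum.cong refl if_cong) (auto simp: splits_def)
  also have "sum ?g (Pow I) + \<dots> = cut_sum (\<lambda>U. v U + v (insert n U)) I F"
    unfolding cut_sum_def sum.distrib[symmetric] by (intro sum.cong refl) auto
  finally show ?thesis .
qed

lemma cell_insert:
  assumes "n \<notin> I" "U \<subseteq> I"
  shows "cell (a(n := z)) (insert n I) (insert n U) = cell a I U \<inter> z"
    and "cell (a(n := z)) (insert n I) U = cell a I U - z"
proof -
  have "{i \<in> insert n I. \<omega> \<in> (a(n := z)) i} = {i \<in> I. \<omega> \<in> a i} \<union> (if \<omega> \<in> z then {n} else {})" for \<omega>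
    using assms by auto
  moreover have "n \<notin> {i \<in> I. \<omega> \<in> a i}" "n \<notin> U" for \<omega> using assms by auto
  ultimately show "cell (a(n := z)) (insert n I) (insert n U) = cell a I U \<inter> z"
    "cell (a(n := z)) (insert n I) U = cell a I U - z"
    unfolding cell_def by (auto simp del: mem_Collect_eq simp: mem_Collect_eq[of _ "\<lambda>\<omega>. _ = _"] insert_ident split: if_splits)
qed

text \<open>
  With the empty set in the family, the weights of the nontrivial cuts are
  the measures of the cells, for the given family as well as for the one to be built. So the new
  set must contain, of each cell \<open>c U\<close>, a part of measure \<open>v (insert n U)\<close>. This amount is available,
  since by uniqueness the measure of \<open>c U\<close> is the marginal weight \<open>v U + v (insert n U)\<close>, and since
  the cell of the empty cut has infinite measure. In the bound, \<open>2 ^ n\<close> counts the cells, and the other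
  factor is the bound of \<open>cut_weights_stable\<close> on \<open>n + 1\<close> indices for the error in each cell.
\<close>

lemma extend_pointed_sets:
  assumes n: "0 < n" and a: "\<And>i. i < n \<Longrightarrow> a i \<in> \<M>" and a0: "a 0 = {}"
    and w: "w \<in> \<M>" and rep: "cut_rep {..n} \<gamma>"
    and match: "\<And>F. F \<subseteq> {..<n} \<Longrightarrow> \<gamma> F = spread (a ` F)"
    and close: "\<And>F. F \<subseteq> {..<n} \<Longrightarrow> \<bar>\<gamma> (insert n F) - spread (insert w (a ` F))\<bar> \<le> \<epsilon>"
  obtains z where "z \<in> \<M>"
    "\<And>F. F \<subseteq> {..<n} \<Longrightarrow> spread (insert z (a ` F)) = \<gamma> (insert n F)"
    "spread {w, z} \<le> 2 ^ n * (2 ^ Suc n * (2 * \<epsilon>))"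
proof -
  let ?I = "{..<n}" and ?J = "insert n {..<n}"
  have J: "{..n} = ?J" by auto
  obtain v where v: "\<And>U. 0 \<le> v U" "\<And>U. 0 \<in> U \<Longrightarrow> v U = 0" "\<And>F. F \<subseteq> ?J \<Longrightarrow> \<gamma> F = cut_sum v ?J F"
    using cut_rep_pointed[OF rep, of 0] unfolding J by auto
  define c where "c = cell a ?I"
  have cs: "c U \<in> sets borel" for U
    using cell_sets[of ?I a U] fmeasurable_borel[OF a] by (auto simp: c_def)
  have c0: "c U = {}" if "0 \<in> U" for U
    using that n a0 by (auto simp: c_def cell_def)
  have cfm: "c U \<in> \<M>" if "U \<noteq> {}" for U
    unfolding c_def using a that by (intro cell_fmeasurable) auto
  \<comment> \<open>Both sides are pointed weights for the given family.\<close>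
  have marg: "\<mu> (c U) = v U + v (insert n U)" if U: "U \<subseteq> ?I" "U \<noteq> {}" "0 \<notin> U" for U
  proof -
    have "\<bar>\<mu> (c U) - (v U + v (insert n U))\<bar> \<le> 2 ^ card ?I * (2 * 0)"
    proof (rule cut_weights_stable[where v = "\<lambda>U. \<mu> (c U)" and w = "\<lambda>U. v U + v (insert n U)"
          and i\<^sub>0 = 0])
      fix F assume F: "F \<subseteq> ?I"
      then have "cut_sum (\<lambda>U. v U + v (insert n U)) ?I F = \<gamma> F"
        using v(3)[of F] F by (subst cut_sum_insert[symmetric]) (auto simp: subset_insertI2)
      moreover have "cut_sum (\<lambda>U. \<mu> (c U)) ?I F = spread (a ` F)"
        unfolding c_def using a F by (intro spread_cut_sum[symmetric]) auto
      ultimately show "\<bar>cut_sum (\<lambda>U. \<mu> (c U)) ?I F - cut_sum (\<lambda>U. v U + v (insert n U)) ?I F\<bar> \<le> 0"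
        using match[OF F] by simp
    qed (use n U c0 v in auto)
    then show ?thesis by simp
  qed
  define q where "q = (\<lambda>U. v (insert n U))"
  have q: "ennreal (q U) \<le> emeasure lborel (c U)" if U: "U \<subseteq> ?I" for U
  proof (cases "U = {}")
    case True
    have "(\<Union>i<n. a i) \<in> \<M>" using a by (intro fmeasurable.finite_UN) auto
    moreover have "UNIV = c U \<union> (\<Union>i<n. a i)" using True by (auto simp: c_def cell_def)
    ultimately have "c U \<notin> \<M>"
      using fmeasurable.Un[of "c U" lborel "\<Union>i<n. a i"] fmeasurableD2[of "UNIV :: real set" lborel] by auto
    then have "emeasure lborel (c U) = \<infinity>" using cs[of U] by (auto simp: fmeasurable_def less_top[symmetric])
    then show ?thesis by simp
  next
    case False
    show ?thesis
    proof (cases "0 \<in> U")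
      case True
      then show ?thesis using v(2) by (simp add: q_def)
    next
      case 0: False
      have "q U \<le> \<mu> (c U)" using marg[OF U False 0] v(1)[of U] by (simp add: q_def)
      then show ?thesis using cfm[OF False] by (simp add: emeasure_eq_measure2 ennreal_leI)
    qed
  qed
  have wc: "w \<inter> c U \<in> \<M>" for U
    using w cs[of U] by (intro fmeasurableI2[OF w]) (auto dest: fmeasurable_borel)
  have "\<forall>U\<in>Pow ?I. \<exists>Z. Z \<subseteq> c U \<and> Z \<in> \<M> \<and> \<mu> Z = q U \<and>
    \<mu> (sym_diff Z (w \<inter> c U)) = \<bar>q U - \<mu> (w \<inter> c U)\<bar>"
  proof
    fix U assume "U \<in> Pow ?I"
    then obtain Z where "Z \<subseteq> c U" "Z \<in> \<M>" "\<mu> Z = q U"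
      "\<mu> (sym_diff Z (w \<inter> c U)) = \<bar>q U - \<mu> (w \<inter> c U)\<bar>"
      using comparable_subset_of_measure[OF cs wc _ _ q, of U U] v(1) by (auto simp: q_def)
    then show "\<exists>Z. Z \<subseteq> c U \<and> Z \<in> \<M> \<and> \<mu> Z = q U \<and>
      \<mu> (sym_diff Z (w \<inter> c U)) = \<bar>q U - \<mu> (w \<inter> c U)\<bar>" by blast
  qed
  from bchoice[OF this] obtain Z where Z: "\<And>U. U \<subseteq> ?I \<Longrightarrow> Z U \<subseteq> c U \<and> Z U \<in> \<M> \<and>
    \<mu> (Z U) = q U \<and> \<mu> (sym_diff (Z U) (w \<inter> c U)) = \<bar>q U - \<mu> (w \<inter> c U)\<bar>"
    by auto
  define z where "z = (\<Union>U\<in>Pow ?I. Z U)"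
  have zfm: "z \<in> \<M>" unfolding z_def using Z by (intro fmeasurable.finite_UN) auto
  have disj: "c U \<inter> c V = {}" if "U \<noteq> V" for U V using that by (auto simp: c_def cell_def)
  have cz: "c U \<inter> z = Z U" if U: "U \<subseteq> ?I" for U
  proof
    show "c U \<inter> z \<subseteq> Z U"
    proof
      fix \<omega> assume \<omega>: "\<omega> \<in> c U \<inter> z"
      then obtain V where V: "V \<subseteq> ?I" "\<omega> \<in> Z V" by (auto simp: z_def)
      then have "\<omega> \<in> c V" using Z by blast
      then have "V = U" using \<omega> disj[of U V] by blast
      then show "\<omega> \<in> Z U" using V by simp
    qed
    show "Z U \<subseteq> c U \<inter> z" using Z[OF U] U by (auto simp: z_def)
  qed
  define b where "b = a(n := z)"
  have b: "b i \<in> \<M>" if "i \<in> ?J" for i using that a zfm by (auto simp: b_def)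
  have ext: "spread (insert z (a ` F)) = \<gamma> (insert n F)" if F: "F \<subseteq> ?I" for F
  proof -
    have "insert z (a ` F) = b ` insert n F" using F by (auto simp: b_def)
    then have "spread (insert z (a ` F)) = cut_sum (\<lambda>U. \<mu> (cell b ?J U)) ?J (insert n F)"
      using b F by (simp only:) (intro spread_cut_sum, auto)
    also have "\<dots> = cut_sum v ?J (insert n F)"
      unfolding cut_sum_def
    proof (intro sum.cong refl)
      fix U assume "U \<in> Pow ?J"
      then have U: "U \<subseteq> ?J" by simp
      have "\<mu> (cell b ?J U) = v U" if ne: "U \<noteq> {}"
      proof (cases "0 \<in> U")
        case True
        then have "cell b ?J U = {}" using n a0 by (auto simp: cell_def b_def)
        then show ?thesis using v(2)[OF True] by simp
      next
        case 0: False
        show ?thesis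
        proof (cases "n \<in> U")
          case True
          define V where "V = U - {n}"
          have V: "V \<subseteq> ?I" "U = insert n V" using U True by (auto simp: V_def)
          then have "cell b ?J U = c V \<inter> z" unfolding b_def c_def V(2) by (intro cell_insert) auto
          then show ?thesis using cz[OF V(1)] Z[OF V(1)] by (simp add: q_def V(2))
        next
          case False
          then have V: "U \<subseteq> ?I" using U by auto
          have "cell b ?J U = c U - z" unfolding b_def c_def using V by (intro cell_insert) auto
          also have "\<dots> = c U - Z U" using cz[OF V] by auto
          finally have "\<mu> (cell b ?J U) = \<mu> (c U) - q U"
            using Z[OF V] cfm[OF ne] by (simp add: measure_Diff fmeasurable_borel fmeasurableD2)
          then show ?thesis using marg[OF V ne 0] by (simp add: q_def)
        qed
      qed
      then show "(if splits U (insert n F) then \<mu> (cell b ?J U) else 0) = (if splits U (insert n F) then v U else 0)"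
        by (auto simp: splits_def)
    qed
    also have "\<dots> = \<gamma> (insert n F)" using F by (intro v(3)[symmetric]) auto
    finally show ?thesis .
  qed
  have "0 \<le> \<epsilon>" using close[of "{}"] abs_ge_zero[of "\<gamma> {n} - spread {w}"] by simp
  \<comment> \<open>The measures of the parts of \<open>w\<close> are weights for the family extended by \<open>w\<close>.\<close>
  have wdist: "\<bar>q U - \<mu> (w \<inter> c U)\<bar> \<le> 2 ^ Suc n * (2 * \<epsilon>)" if U: "U \<subseteq> ?I" for U
  proof (cases "0 \<in> U")
    case True
    then show ?thesis using v(2) c0 \<open>0 \<le> \<epsilon>\<close> by (simp add: q_def)
  next
    case False
    define b' where "b' = a(n := w)"
    have b': "b' i \<in> \<M>" if "i \<in> ?J" for i using that a w by (auto simp: b'_def)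
    have "\<bar>v (insert n U) - \<mu> (cell b' ?J (insert n U))\<bar> \<le> 2 ^ card ?J * (2 * \<epsilon>)"
    proof (rule cut_weights_stable[where v = v and w = "\<lambda>U. \<mu> (cell b' ?J U)" and i\<^sub>0 = 0])
      fix F assume F: "F \<subseteq> ?J"
      have eq: "cut_sum (\<lambda>U. \<mu> (cell b' ?J U)) ?J F = spread (b' ` F)"
        using b' F by (intro spread_cut_sum[symmetric]) auto
      show "\<bar>cut_sum v ?J F - cut_sum (\<lambda>U. \<mu> (cell b' ?J U)) ?J F\<bar> \<le> \<epsilon>"
      proof (cases "n \<in> F")
        case True
        then obtain F' where F': "F = insert n F'" "F' \<subseteq> ?I" using F by (metis Diff_subset_conv insert_Diff insert_is_Un)
        have "b' ` F = insert w (a ` F')" using F' by (auto simp: b'_def)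
        then show ?thesis unfolding eq v(3)[OF F, symmetric] using close[OF F'(2)] F'(1) by simp
      next
        case False
        then have F': "F \<subseteq> ?I" using F by auto
        have "b' ` F = a ` F" using F' by (auto simp: b'_def)
        then show ?thesis unfolding eq v(3)[OF F, symmetric] using match[OF F'] \<open>0 \<le> \<epsilon>\<close> by simp
      qed
    next
      fix U :: "nat set" assume "0 \<in> U"
      then have "cell b' ?J U = {}" using n a0 by (auto simp: cell_def b'_def)
      then show "\<mu> (cell b' ?J U) = 0" by simp
    qed (use n U False v in auto)
    moreover have "cell b' ?J (insert n U) = w \<inter> c U"
      unfolding b'_def c_def using cell_insert(1)[of n ?I U a w] U by (simp add: Int_commute)
    ultimately show ?thesis by (simp add: q_def)
  qed
  have "spread {w, z} \<le> \<mu> (\<Union>U\<in>Pow ?I. sym_diff (Z U) (w \<inter> c U))"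
  proof -
    have "sym_diff w z \<subseteq> (\<Union>U\<in>Pow ?I. sym_diff (Z U) (w \<inter> c U))"
    proof
      fix \<omega> assume \<omega>: "\<omega> \<in> sym_diff w z"
      define U where "U = {i \<in> ?I. \<omega> \<in> a i}"
      have U: "U \<subseteq> ?I" "\<omega> \<in> c U" by (auto simp: U_def c_def cell_def)
      then have "\<omega> \<in> sym_diff (Z U) (w \<inter> c U)" using \<omega> cz[OF U(1)] by blast
      then show "\<omega> \<in> (\<Union>U\<in>Pow ?I. sym_diff (Z U) (w \<inter> c U))" using U by blast
    qed
    moreover have "(\<Union>U\<in>Pow ?I. sym_diff (Z U) (w \<inter> c U)) \<in> \<M>"
      using Z wc by (intro fmeasurable.finite_UN fmeasurable.Un fmeasurable.Diff) auto
    moreover have "sym_diff w z \<in> sets lborel"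
      using w zfm by (auto dest: fmeasurable_borel)
    ultimately show ?thesis unfolding spread_pair by (intro measure_mono_fmeasurable)
  qed
  also have "\<dots> \<le> (\<Sum>U\<in>Pow ?I. \<mu> (sym_diff (Z U) (w \<inter> c U)))"
  proof (rule measure_subadditive_finite)
    have "sym_diff (Z U) (w \<inter> c U) \<in> \<M>" if "U \<in> Pow ?I" for U
      using Z[of U] wc[of U] that by (intro fmeasurable.Un fmeasurable.Diff) auto
    then show "(\<lambda>U. sym_diff (Z U) (w \<inter> c U)) ` Pow ?I \<subseteq> sets lborel"
      "\<And>U. U \<in> Pow ?I \<Longrightarrow> emeasure lborel (sym_diff (Z U) (w \<inter> c U)) \<noteq> \<infinity>"
      using fmeasurableD2 by (auto simp: image_subset_iff dest: fmeasurable_borel)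
  qed simp
  also have "\<dots> \<le> (\<Sum>U\<in>Pow ?I. 2 ^ Suc n * (2 * \<epsilon>))"
    using Z wdist by (intro sum_mono) auto
  also have "\<dots> = 2 ^ n * (2 ^ Suc n * (2 * \<epsilon>))" by (simp add: card_Pow)
  finally show thesis using that zfm ext by blast
qed

lemma spread_translate: "spread ((\<lambda>A. sym_diff A B) ` F) = spread F"
proof -
  have "{\<omega>. (\<exists>A\<in>(\<lambda>A. sym_diff A B) ` F. \<omega> \<in> A) \<and> (\<exists>C\<in>(\<lambda>A. sym_diff A B) ` F. \<omega> \<notin> C)}
      = {\<omega>. (\<exists>A\<in>F. \<omega> \<in> A) \<and> (\<exists>C\<in>F. \<omega> \<notin> C)}" by auto
  then show ?thesis by (simp add: spread_def)
qed

text \<open>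
  Taking the symmetric difference with a fixed set changes no \<open>spread\<close>, so one of the sets can be moved
  to the empty set. Without any sets given, all values that are prescribed are \<open>0\<close> and \<open>w\<close> itself can be taken.
\<close>

proposition extend_sets:
  assumes a: "\<And>i. i < n \<Longrightarrow> a i \<in> \<M>"
    and w: "w \<in> \<M>" and rep: "cut_rep {..n} \<gamma>"
    and match: "\<And>F. F \<subseteq> {..<n} \<Longrightarrow> \<gamma> F = spread (a ` F)"
    and close: "\<And>F. F \<subseteq> {..<n} \<Longrightarrow> \<bar>\<gamma> (insert n F) - spread (insert w (a ` F))\<bar> \<le> \<epsilon>"
  obtains z where "z \<in> \<M>"
    "\<And>F. F \<subseteq> {..<n} \<Longrightarrow> spread (insert z (a ` F)) = \<gamma> (insert n F)"
    "spread {w, z} \<le> 2 ^ n * (2 ^ Suc n * (2 * \<epsilon>))"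
proof (cases "n = 0")
  case True
  have "spread {w} = 0" by (simp add: spread_def)
  moreover have "\<gamma> {n} = 0" by (rule cut_rep_trivial[OF rep]) auto
  moreover have "0 \<le> \<epsilon>" using close[of "{}"] abs_ge_zero[of "\<gamma> {n} - spread {w}"] by simp
  ultimately show ?thesis using that[of w] w True by simp
next
  case False
  let ?t = "\<lambda>A. sym_diff A (a 0)"
  have tt: "?t (?t A) = A" for A by auto
  have tfm: "?t A \<in> \<M>" if "A \<in> \<M>" for A
    using that a[of 0] False by (auto intro: fmeasurable.Un fmeasurable.Diff)
  have ins: "spread (insert (?t A) ((\<lambda>i. ?t (a i)) ` F)) = spread (insert A (a ` F))" for A F
    using spread_translate[of "a 0" "insert A (a ` F)"] by (simp add: image_image)
  obtain z where z: "z \<in> \<M>"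
    "\<And>F. F \<subseteq> {..<n} \<Longrightarrow> spread (insert z ((\<lambda>i. ?t (a i)) ` F)) = \<gamma> (insert n F)"
    "spread {?t w, z} \<le> 2 ^ n * (2 ^ Suc n * (2 * \<epsilon>))"
  proof (rule extend_pointed_sets[of n "\<lambda>i. ?t (a i)" "?t w" \<gamma> \<epsilon>])
    show "\<gamma> F = spread ((\<lambda>i. ?t (a i)) ` F)" if "F \<subseteq> {..<n}" for F
      using match[OF that] spread_translate[of "a 0" "a ` F"] by (simp add: image_image)
    show "\<bar>\<gamma> (insert n F) - spread (insert (?t w) ((\<lambda>i. ?t (a i)) ` F))\<bar> \<le> \<epsilon>" if "F \<subseteq> {..<n}" for F
      using close[OF that] ins[of w F] by simp
  qed (use False a w rep tfm in auto)
  have "spread {w, ?t z} = spread {?t w, z}"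
    using spread_translate[of "a 0" "{w, ?t z}"] by (simp only: image_insert image_empty tt)
  moreover have "spread (insert (?t z) (a ` F)) = \<gamma> (insert n F)" if "F \<subseteq> {..<n}" for F
    using ins[of "?t z" F] z(2)[OF that] unfolding tt by simp
  ultimately show ?thesis using that[of "?t z"] z(1,3) tfm by simp
qed

section \<open>Diversities and one-point extensions\<close>

lemma diversity_nonneg: "diversity X \<delta> \<Longrightarrow> finite A \<Longrightarrow> A \<subseteq> X \<Longrightarrow> 0 \<le> \<delta> A"
  by (simp add: diversity_def Fpow_def)

lemma diversity_eq_0: "diversity X \<delta> \<Longrightarrow> finite A \<Longrightarrow> A \<subseteq> X \<Longrightarrow> \<delta> A = 0 \<longleftrightarrow> card A \<le> 1"
  by (simp add: diversity_def Fpow_def)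

lemma diversity_empty: "diversity X \<delta> \<Longrightarrow> \<delta> {} = 0"
  by (simp add: diversity_eq_0)

lemma diversity_singleton: "diversity X \<delta> \<Longrightarrow> x \<in> X \<Longrightarrow> \<delta> {x} = 0"
  by (simp add: diversity_eq_0)

lemma diversity_pair_eq_0: "diversity X \<delta> \<Longrightarrow> x \<in> X \<Longrightarrow> y \<in> X \<Longrightarrow> \<delta> {x, y} = 0 \<longleftrightarrow> x = y"
  by (subst diversity_eq_0) (auto simp: card_insert_if)

lemma diversity_through:
  "diversity X \<delta> \<Longrightarrow> finite A \<Longrightarrow> A \<subseteq> X \<Longrightarrow> finite B \<Longrightarrow> B \<subseteq> X \<Longrightarrow> finite C \<Longrightarrow> C \<subseteq> X \<Longrightarrow> B \<noteq> {} \<Longrightarrow>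
    \<delta> (A \<union> C) \<le> \<delta> (A \<union> B) + \<delta> (B \<union> C)"
  by (simp add: diversity_def Fpow_def)

lemma diversity_triangle:
  "diversity X \<delta> \<Longrightarrow> x \<in> X \<Longrightarrow> y \<in> X \<Longrightarrow> z \<in> X \<Longrightarrow> \<delta> {x, z} \<le> \<delta> {x, y} + \<delta> {y, z}"
  using diversity_through[of X \<delta> "{x}" "{y}" "{z}"] by (simp add: insert_commute)

text \<open>
  The points are replaced one after another, and each replacement costs at most one distance by the
  triangle inequality through the new point.
\<close>

lemma move_points:
  fixes \<delta> :: "'a set \<Rightarrow> real"
  assumes through: "\<And>A B C. finite A \<Longrightarrow> A \<subseteq> X \<Longrightarrow> finite B \<Longrightarrow> B \<subseteq> X \<Longrightarrow> finite C \<Longrightarrow> C \<subseteq> X \<Longrightarrow> B \<noteq> {} \<Longrightarrow>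
      \<delta> (A \<union> C) \<le> \<delta> (A \<union> B) + \<delta> (B \<union> C)"
    and "finite J" "x ` J \<subseteq> X" "y ` J \<subseteq> X"
  shows "\<bar>\<delta> (x ` J) - \<delta> (y ` J)\<bar> \<le> (\<Sum>j\<in>J. \<delta> {x j, y j})"
proof -
  have le: "\<delta> (x ` J \<union> B) \<le> \<delta> (y ` J \<union> B) + (\<Sum>j\<in>J. \<delta> {x j, y j})"
    if "x ` J \<subseteq> X" "y ` J \<subseteq> X" "finite B" "B \<subseteq> X" for x y B
    using assms(2) that
  proof (induction J arbitrary: B)
    case (insert j J)
    have "\<delta> (x ` insert j J \<union> B) = \<delta> (x ` J \<union> insert (x j) B)" by (simp add: Un_commute)
    also have "\<dots> \<le> \<delta> (y ` J \<union> insert (x j) B) + (\<Sum>j\<in>J. \<delta> {x j, y j})"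
      using insert.prems by (intro insert.IH) auto
    also have "\<delta> (y ` J \<union> insert (x j) B) \<le> \<delta> (y ` insert j J \<union> B) + \<delta> {x j, y j}"
      using through[of "y ` J \<union> B" "{y j}" "{x j}"] insert.prems insert.hyps
      by (simp add: insert_commute)
    finally show ?case using insert.hyps by simp
  qed simp
  have comm: "(\<Sum>j\<in>J. \<delta> {y j, x j}) = (\<Sum>j\<in>J. \<delta> {x j, y j})" by (simp add: insert_commute)
  show ?thesis using le[of x y "{}"] le[of y x "{}"] assms comm by simp
qed

lemma diversity_move_points:
  assumes "diversity X \<delta>" "finite J" "x ` J \<subseteq> X" "y ` J \<subseteq> X"
  shows "\<bar>\<delta> (x ` J) - \<delta> (y ` J)\<bar> \<le> (\<Sum>j\<in>J. \<delta> {x j, y j})"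
  using diversity_through[OF assms(1)] assms(2-4) by (rule move_points)

lemma diversity_image:
  assumes "diversity X \<delta>" "inj_on f Y" "f ` Y \<subseteq> X"
  shows "diversity Y (\<lambda>A. \<delta> (f ` A))"
proof -
  have F: "f ` A \<in> Fpow X" "card (f ` A) = card A" if "A \<in> Fpow Y" for A
    using that assms by (auto simp: Fpow_def intro!: card_image intro: inj_on_subset)
  have "\<delta> (f ` (A \<union> C)) \<le> \<delta> (f ` (A \<union> B)) + \<delta> (f ` (B \<union> C))"
    if "A \<in> Fpow Y" "B \<in> Fpow Y" "C \<in> Fpow Y" "B \<noteq> {}" for A B C
    unfolding image_Un using F(1)[OF that(1)] F(1)[OF that(2)] F(1)[OF that(3)] that(4)
    by (intro diversity_through[OF assms(1)]) (auto simp: Fpow_def)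
  moreover have "0 \<le> \<delta> (f ` A) \<and> (\<delta> (f ` A) = 0 \<longleftrightarrow> card A \<le> 1)" if "A \<in> Fpow Y" for A
    using F[OF that] diversity_nonneg[OF assms(1), of "f ` A"] diversity_eq_0[OF assms(1), of "f ` A"]
    by (simp add: Fpow_def)
  ultimately show ?thesis unfolding diversity_def by simp
qed

text \<open>
  The finite parts of \<open>L\<^sub>1\<close> diversities are of this kind. For infinite \<open>X\<close> the condition is local: it does
  not provide one measure space for all points.
\<close>

definition cut_diversity :: "'a set \<Rightarrow> ('a set \<Rightarrow> real) \<Rightarrow> bool" where
  "cut_diversity X \<delta> \<longleftrightarrow> diversity X \<delta> \<and> (\<forall>I\<in>Fpow X. cut_rep I \<delta>)"

lemma cut_diversityD: "cut_diversity X \<delta> \<Longrightarrow> diversity X \<delta>"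
  by (simp add: cut_diversity_def)

lemma cut_diversity_tuple:
  fixes a :: "'i \<Rightarrow> 'a"
  assumes "cut_diversity X \<delta>" "finite I" "a ` I \<subseteq> X"
  shows "cut_rep I (\<lambda>F. \<delta> (a ` F))"
  using assms by (intro cut_rep_image[of "a ` I"]) (auto simp: cut_diversity_def Fpow_def)

lemma L1_diversity_imp_cut_diversity: "L1_diversity X \<delta> \<Longrightarrow> cut_diversity X \<delta>"
  unfolding L1_diversity_def cut_diversity_def Fpow_def by (auto intro: L1_embedding_cut_rep)

text \<open>
  The tuple is indexed by the numbers below \<open>n\<close>, and the index \<open>n\<close> stands for the point to be added.
  If the prescribed distance from a given point is \<open>0\<close>, then \<open>z\<close> is that point.
\<close>

definition extension_property :: "'a set \<Rightarrow> ('a set \<Rightarrow> real) \<Rightarrow> bool" where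
  "extension_property X \<delta> \<longleftrightarrow>
     (\<forall>n a \<gamma>. a ` {..<n} \<subseteq> X \<and> cut_rep {..n::nat} \<gamma> \<and> (\<forall>F\<subseteq>{..<n}. \<gamma> F = \<delta> (a ` F)) \<longrightarrow>
        (\<exists>z\<in>X. \<forall>F\<subseteq>{..<n}. \<delta> (insert z (a ` F)) = \<gamma> (insert n F)))"

definition complete_div :: "'a set \<Rightarrow> ('a set \<Rightarrow> real) \<Rightarrow> bool" where
  "complete_div X \<delta> \<longleftrightarrow>
     (\<forall>\<sigma> :: nat \<Rightarrow> 'a. range \<sigma> \<subseteq> X \<and> (\<forall>\<epsilon>>0. \<exists>N. \<forall>m\<ge>N. \<forall>n\<ge>N. \<delta> {\<sigma> m, \<sigma> n} < \<epsilon>) \<longrightarrow>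
        (\<exists>x\<in>X. \<forall>\<epsilon>>0. \<exists>N. \<forall>n\<ge>N. \<delta> {\<sigma> n, x} < \<epsilon>))"

definition separable_div :: "'a set \<Rightarrow> ('a set \<Rightarrow> real) \<Rightarrow> bool" where
  "separable_div X \<delta> \<longleftrightarrow>
     (\<exists>D. countable D \<and> D \<subseteq> X \<and> (\<forall>x\<in>X. \<forall>\<epsilon>>0. \<exists>y\<in>D. \<delta> {y, x} < \<epsilon>))"

lemma extension_propertyE:
  fixes n :: nat
  assumes "extension_property X \<delta>" "a ` {..<n} \<subseteq> X" "cut_rep {..n} \<gamma>"
    "\<And>F. F \<subseteq> {..<n} \<Longrightarrow> \<gamma> F = \<delta> (a ` F)"
  obtains z where "z \<in> X" "\<forall>F\<subseteq>{..<n}. \<delta> (insert z (a ` F)) = \<gamma> (insert n F)"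
  using assms(1)[unfolded extension_property_def, rule_format, of a n \<gamma>] assms(2-4) that by auto

lemma extension_property_nonempty: "extension_property X \<delta> \<Longrightarrow> diversity X \<delta> \<Longrightarrow> X \<noteq> {}"
proof -
  assume "extension_property X \<delta>" "diversity X \<delta>"
  moreover have "cut_rep {..0::nat} (\<lambda>_. 0)"
    unfolding cut_rep_def by (intro exI[of _ "\<lambda>_. 0"]) (simp add: cut_sum_def)
  ultimately show ?thesis
    using extension_propertyE[of X \<delta> "\<lambda>_. undefined" 0 "\<lambda>_. 0"] by (auto simp: diversity_empty)
qed

lemma separable_div_sequence:
  assumes "separable_div X \<delta>" "X \<noteq> {}"
  obtains D :: "nat \<Rightarrow> 'a" where "range D \<subseteq> X" "\<And>x \<epsilon>. x \<in> X \<Longrightarrow> 0 < \<epsilon> \<Longrightarrow> \<exists>i. \<delta> {D i, x} < \<epsilon>"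
proof -
  obtain D where D: "countable D" "D \<subseteq> X" "\<And>x \<epsilon>. x \<in> X \<Longrightarrow> 0 < \<epsilon> \<Longrightarrow> \<exists>y\<in>D. \<delta> {y, x} < \<epsilon>"
    using assms(1) unfolding separable_div_def by blast
  have "D \<noteq> {}" using assms(2) D(3)[of _ 1] by fastforce
  then have "range (from_nat_into D) = D" using D(1) by (rule range_from_nat_into)
  then show ?thesis using D that[of "from_nat_into D"] by (metis (full_types) rangeE)
qed

lemma complete_div_fast:
  assumes div: "diversity X \<delta>" and comp: "complete_div X \<delta>" and \<sigma>: "\<And>k. \<sigma> k \<in> X"
    and fast: "\<And>k. \<delta> {\<sigma> k, \<sigma> (Suc k)} \<le> C * (1/2) ^ k"
  obtains x where "x \<in> X" "\<And>\<epsilon>. 0 < \<epsilon> \<Longrightarrow> \<exists>N. \<forall>n\<ge>N. \<delta> {\<sigma> n, x} < \<epsilon>"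
proof -
  have C: "0 \<le> C" using fast[of 0] diversity_nonneg[OF div, of "{\<sigma> 0, \<sigma> (Suc 0)}"] \<sigma> by simp
  have tail: "\<delta> {\<sigma> n, \<sigma> (n + k)} \<le> C * (1/2) ^ n * (2 - 2 * (1/2) ^ k)" for n k
  proof (induction k)
    case 0
    then show ?case using diversity_singleton[OF div \<sigma>] by simp
  next
    case (Suc k)
    have "\<delta> {\<sigma> n, \<sigma> (n + Suc k)} \<le> \<delta> {\<sigma> n, \<sigma> (n + k)} + \<delta> {\<sigma> (n + k), \<sigma> (Suc (n + k))}"
      using diversity_triangle[OF div \<sigma> \<sigma> \<sigma>] by simp
    then show ?case using Suc fast[of "n + k"] by (simp add: power_add algebra_simps)
  qed
  have tail': "\<delta> {\<sigma> m, \<sigma> n} \<le> 2 * C * (1/2) ^ N" if "N \<le> m" "N \<le> n" for m n N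
  proof -
    have *: "\<delta> {\<sigma> m, \<sigma> n} \<le> 2 * C * (1/2) ^ N" if "N \<le> m" "m \<le> n" for m n
    proof -
      have "\<delta> {\<sigma> m, \<sigma> n} \<le> C * (1/2) ^ m * (2 - 2 * (1/2) ^ (n - m))"
        using tail[of m "n - m"] that by simp
      also have "\<dots> \<le> C * (1/2) ^ m * 2" using C by (intro mult_left_mono) auto
      also have "\<dots> \<le> C * (1/2) ^ N * 2"
        using C that by (intro mult_right_mono mult_left_mono power_decreasing) auto
      finally show ?thesis by simp
    qed
    show ?thesis using *[of m n] *[of n m] that by (cases "m \<le> n") (auto simp: insert_commute)
  qed
  have "\<exists>N. \<forall>m\<ge>N. \<forall>n\<ge>N. \<delta> {\<sigma> m, \<sigma> n} < \<epsilon>" if "0 < \<epsilon>" for \<epsilon>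
  proof -
    have "(\<lambda>N. 2 * C * (1/2::real) ^ N) \<longlonglongrightarrow> 2 * C * 0"
      by (intro tendsto_mult tendsto_const LIMSEQ_power_zero) simp
    then have "\<forall>\<^sub>F N in sequentially. 2 * C * (1/2) ^ N < \<epsilon>"
      using \<open>0 < \<epsilon>\<close> by (intro order_tendstoD) auto
    then obtain N where "2 * C * (1/2) ^ N < \<epsilon>" by (auto simp: eventually_sequentially)
    then have "\<forall>m\<ge>N. \<forall>n\<ge>N. \<delta> {\<sigma> m, \<sigma> n} < \<epsilon>" using tail' by (meson le_less_trans)
    then show ?thesis ..
  qed
  then obtain x where "x \<in> X" "\<forall>\<epsilon>>0. \<exists>N. \<forall>n\<ge>N. \<delta> {\<sigma> n, x} < \<epsilon>"
    using comp \<sigma> unfolding complete_div_def by (metis image_subset_iff)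
  then show ?thesis using that by blast
qed

text \<open>
  Equal entries of \<open>x\<close> correspond to equal entries of \<open>y\<close>, because the distances agree.
\<close>

lemma matching_tuples_map:
  fixes n :: nat
  assumes "diversity X \<delta>" "diversity Y \<epsilon>" "x ` {..<n} \<subseteq> X" "y ` {..<n} \<subseteq> Y"
    and match: "\<And>F. F \<subseteq> {..<n} \<Longrightarrow> \<delta> (x ` F) = \<epsilon> (y ` F)"
  obtains f where "\<And>i. i < n \<Longrightarrow> f (x i) = y i" "\<And>G. G \<subseteq> x ` {..<n} \<Longrightarrow> \<epsilon> (f ` G) = \<delta> G"
proof -
  define f where "f = (\<lambda>p. y (SOME i. i < n \<and> x i = p))"
  have f: "f (x i) = y i" if "i < n" for i
  proof -
    define j where "j = (SOME j. j < n \<and> x j = x i)"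
    have j: "j < n" "x j = x i" using someI[of "\<lambda>j. j < n \<and> x j = x i" i] that by (auto simp: j_def)
    have "\<epsilon> {y j, y i} = \<delta> {x j, x i}" using match[of "{j, i}"] j that by simp
    also have "\<dots> = 0" using j(2) that assms(1,3) by (auto simp: diversity_singleton)
    finally have "y j = y i" using diversity_pair_eq_0[OF assms(2), of "y j" "y i"] j that assms(4) by auto
    then show ?thesis by (simp add: f_def j_def)
  qed
  moreover have "\<epsilon> (f ` G) = \<delta> G" if "G \<subseteq> x ` {..<n}" for G
  proof -
    obtain F where F: "F \<subseteq> {..<n}" "G = x ` F" using \<open>G \<subseteq> x ` {..<n}\<close> by (auto simp: subset_image_iff)
    have "f ` G = y ` F" unfolding F(2) image_image using f F(1) by (intro image_cong) auto
    then show ?thesis using match[OF F(1)] F(2) by simp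
  qed
  ultimately show ?thesis using that by blast
qed

lemma extend_matching_tuple:
  fixes n :: nat
  assumes Y: "cut_diversity Y \<epsilon>" and X: "extension_property X \<delta>"
    and y: "y ` {..<n} \<subseteq> Y" and x: "x ` {..<n} \<subseteq> X"
    and match: "\<And>F. F \<subseteq> {..<n} \<Longrightarrow> \<epsilon> (y ` F) = \<delta> (x ` F)" and p: "p \<in> Y"
  obtains q where "q \<in> X" "\<And>F. F \<subseteq> {..<n} \<Longrightarrow> \<delta> (insert q (x ` F)) = \<epsilon> (insert p (y ` F))"
proof -
  define \<gamma> where "\<gamma> = (\<lambda>F. \<epsilon> ((y(n := p)) ` F))"
  have "cut_rep {..n} \<gamma>"
    unfolding \<gamma>_def using y p by (intro cut_diversity_tuple[OF Y]) (auto simp: less_le)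
  moreover have "\<gamma> F = \<delta> (x ` F)" if "F \<subseteq> {..<n}" for F
  proof -
    have "(y(n := p)) ` F = y ` F" using that by (intro image_cong) auto
    then show ?thesis using match[OF that] by (simp add: \<gamma>_def)
  qed
  ultimately obtain q where q: "q \<in> X" "\<forall>F\<subseteq>{..<n}. \<delta> (insert q (x ` F)) = \<gamma> (insert n F)"
    using extension_propertyE[OF X x] by blast
  have "\<gamma> (insert n F) = \<epsilon> (insert p (y ` F))" if "F \<subseteq> {..<n}" for F
  proof -
    have "(y(n := p)) ` insert n F = insert p (y ` F)" using that by auto
    then show ?thesis by (simp add: \<gamma>_def)
  qed
  then show ?thesis using q that by simp
qed

lemma extend_finite_map:
  assumes Y: "cut_diversity Y \<epsilon>" and X: "extension_property X \<delta>" "diversity X \<delta>"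
    and fin: "finite T'" and T: "T \<subseteq> T'" "T' \<subseteq> Y"
    and f: "f ` T \<subseteq> X" "\<And>G. G \<subseteq> T \<Longrightarrow> \<delta> (f ` G) = \<epsilon> G"
  obtains g where "g ` T' \<subseteq> X" "\<And>G. G \<subseteq> T' \<Longrightarrow> \<delta> (g ` G) = \<epsilon> G" "\<And>t. t \<in> T \<Longrightarrow> g t = f t"
proof -
  have "\<exists>g. g ` (T \<union> R) \<subseteq> X \<and> (\<forall>G\<subseteq>T \<union> R. \<delta> (g ` G) = \<epsilon> G) \<and> (\<forall>t\<in>T. g t = f t)"
    if "finite R" "R \<subseteq> T' - T" for R
    using that
  proof (induction R)
    case empty
    then show ?case using f by (intro exI[of _ f]) auto
  next
    case (insert p R)
    then obtain g where g: "g ` (T \<union> R) \<subseteq> X" "\<And>G. G \<subseteq> T \<union> R \<Longrightarrow> \<delta> (g ` G) = \<epsilon> G" "\<And>t. t \<in> T \<Longrightarrow> g t = f t"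
      by auto
    have finTR: "finite (T \<union> R)" using insert.hyps(1) fin T(1) finite_subset by auto
    then obtain y :: "nat \<Rightarrow> _" and n where y: "T \<union> R = y ` {..<n}"
      using finite_imp_nat_seg_image_inj_on[OF finTR] by (auto simp: lessThan_def)
    have p: "p \<in> Y" "p \<notin> T \<union> R" using insert T by auto
    obtain q where q: "q \<in> X" "\<And>F. F \<subseteq> {..<n} \<Longrightarrow> \<delta> (insert q ((\<lambda>i. g (y i)) ` F)) = \<epsilon> (insert p (y ` F))"
    proof (rule extend_matching_tuple[OF Y X(1), of y n "\<lambda>i. g (y i)" p])
      show "y ` {..<n} \<subseteq> Y" using y insert.prems T by auto
      show "(\<lambda>i. g (y i)) ` {..<n} \<subseteq> X" using g(1) unfolding y by (simp add: image_image)
      show "\<epsilon> (y ` F) = \<delta> ((\<lambda>i. g (y i)) ` F)" if "F \<subseteq> {..<n}" for F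
      proof -
        have "y ` F \<subseteq> T \<union> R" unfolding y using that by (rule image_mono)
        then show ?thesis using g(2)[of "y ` F"] by (simp add: image_image)
      qed
    qed (use p in auto)
    have "\<delta> ((g(p := q)) ` G) = \<epsilon> G" if G: "G \<subseteq> T \<union> insert p R" for G
    proof (cases "p \<in> G")
      case True
      have "G - {p} \<subseteq> y ` {..<n}" using G y by auto
      then obtain F where F: "F \<subseteq> {..<n}" "G - {p} = y ` F" by (auto simp: subset_image_iff)
      have "(g(p := q)) ` G = (g(p := q)) ` insert p (G - {p})" using True by (simp add: insert_absorb)
      also have "\<dots> = insert q (g ` (G - {p}))" by auto
      finally have "\<delta> ((g(p := q)) ` G) = \<epsilon> (insert p (y ` F))"
        using q(2)[OF F(1)] unfolding F(2) by (simp add: image_image)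
      then show ?thesis using F(2) True by (simp add: insert_absorb[symmetric]) (metis insert_Diff)
    next
      case False
      have "(g(p := q)) ` G = g ` G" using False by (intro image_cong) auto
      then show ?thesis using g(2)[of G] G False by auto
    qed
    moreover have "(g(p := q)) ` (T \<union> insert p R) \<subseteq> X" using g(1) q(1) by auto
    moreover have "\<forall>t\<in>T. (g(p := q)) t = f t" using g(3) p(2) by auto
    ultimately show ?case by blast
  qed
  from this[of "T' - T"] show ?thesis using fin T that by (auto simp: Un_absorb1)
qed

text \<open>
  Dependent choice for back-and-forth arguments: pairs of points are added one at a time so that the two
  coordinate sequences have the same values throughout, and \<open>req n\<close> is the task of step \<open>n\<close>.
\<close>

lemma matching_sequence:
  fixes X :: "'a set" and Y :: "'b set"
  assumes "diversity Y \<epsilon>" "diversity X \<delta>"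
    and step: "\<And>n s. (\<And>i. i < n \<Longrightarrow> s i \<in> Y \<times> X) \<Longrightarrow> (\<And>i. i < n \<Longrightarrow> req i (s i)) \<Longrightarrow>
      (\<And>F. F \<subseteq> {..<n} \<Longrightarrow> \<epsilon> (fst ` s ` F) = \<delta> (snd ` s ` F)) \<Longrightarrow>
      \<exists>r\<in>Y \<times> X. req n r \<and> (\<forall>F\<subseteq>{..<n}. \<epsilon> (insert (fst r) (fst ` s ` F)) = \<delta> (insert (snd r) (snd ` s ` F)))"
  obtains s :: "nat \<Rightarrow> 'b \<times> 'a" where "\<And>n. s n \<in> Y \<times> X" "\<And>n. req n (s n)"
    "\<And>F. finite F \<Longrightarrow> \<epsilon> (fst ` s ` F) = \<delta> (snd ` s ` F)"
proof -
  define agree where "agree = (\<lambda>n s. \<forall>F\<subseteq>{..<n::nat}. \<epsilon> (fst ` s ` F) = \<delta> (snd ` s ` F))"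
  define P where "P = (\<lambda>s n r. r \<in> Y \<times> X \<and> req n r \<and> agree (Suc n) (s(n := r)))"
  have agree_cong: "agree n s \<longleftrightarrow> agree n t" if "\<And>i. i < n \<Longrightarrow> s i = t i" for n s t
  proof -
    have "s ` F = t ` F" if "F \<subseteq> {..<n}" for F
      using that \<open>\<And>i. i < n \<Longrightarrow> s i = t i\<close> by (intro image_cong) auto
    then show ?thesis by (simp add: agree_def)
  qed
  have "\<exists>s. \<forall>n. P s n (s n)"
  proof (rule dependent_wellorder_choice)
    fix r and s t :: "nat \<Rightarrow> 'b \<times> 'a" and n :: nat assume "\<And>i. i < n \<Longrightarrow> s i = t i"
    then have "agree (Suc n) (s(n := r)) \<longleftrightarrow> agree (Suc n) (t(n := r))"
      by (intro agree_cong) (auto simp: less_Suc_eq)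
    then show "P s n r = P t n r" by (simp add: P_def)
  next
    fix n s assume IH: "\<And>i. i < n \<Longrightarrow> P s i (s i)"
    have ag: "agree n s"
    proof (cases n)
      case 0
      then show ?thesis using assms(1,2) by (simp add: agree_def diversity_empty)
    next
      case (Suc m)
      then show ?thesis using IH[of m] by (simp add: P_def)
    qed
    obtain r where r: "r \<in> Y \<times> X" "req n r"
      "\<forall>F\<subseteq>{..<n}. \<epsilon> (insert (fst r) (fst ` s ` F)) = \<delta> (insert (snd r) (snd ` s ` F))"
      using step[of n s] IH ag unfolding agree_def P_def by blast
    have "agree (Suc n) (s(n := r))"
      unfolding agree_def
    proof (intro allI impI)
      fix F assume F: "F \<subseteq> {..<Suc n}"
      have same: "(s(n := r)) ` (F - {n}) = s ` (F - {n})" by (intro image_cong) auto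
      have sub: "F - {n} \<subseteq> {..<n}" using F by (auto simp: less_Suc_eq)
      show "\<epsilon> (fst ` (s(n := r)) ` F) = \<delta> (snd ` (s(n := r)) ` F)"
      proof (cases "n \<in> F")
        case True
        have "(s(n := r)) ` F = (s(n := r)) ` insert n (F - {n})" using True by (simp add: insert_absorb)
        also have "\<dots> = insert r (s ` (F - {n}))" by (simp only: image_insert same fun_upd_same)
        finally show ?thesis using r(3) sub by simp
      next
        case False
        then show ?thesis using ag sub same by (simp add: agree_def)
      qed
    qed
    then show "\<exists>r. P s n r" using r by (auto simp: P_def)
  qed
  then obtain s where s: "\<And>n. P s n (s n)" by blast
  have "\<epsilon> (fst ` s ` F) = \<delta> (snd ` s ` F)" if "finite F" for F
  proof -
    obtain n where "F \<subseteq> {..<n}" using finite_nat_iff_bounded[of F] \<open>finite F\<close> by blast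
    then have "F \<subseteq> {..<Suc n}" by (auto simp: less_Suc_eq)
    moreover have "agree (Suc n) s" using s[of n] by (simp add: P_def)
    ultimately show ?thesis by (simp add: agree_def)
  qed
  then show ?thesis using s that unfolding P_def by blast
qed

section \<open>Back and forth\<close>

lemma eq_if_arbitrarily_close:
  assumes div: "diversity X \<delta>" and pts: "x \<in> X" "x' \<in> X"
    and near: "\<And>\<epsilon>. 0 < \<epsilon> \<Longrightarrow> \<delta> {x, x'} < \<epsilon>"
  shows "x = x'"
  using near[of "\<delta> {x, x'}"] diversity_nonneg[OF div, of "{x, x'}"] diversity_pair_eq_0[OF div pts] pts
  by fastforce

text \<open>
  A point \<open>y\<close> approximated by \<open>ya\<close> is the limit of a fast subsequence; the same subsequence of \<open>xa\<close> is
  Cauchy.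
\<close>

lemma matching_limit:
  fixes ya :: "nat \<Rightarrow> 'b" and xa :: "nat \<Rightarrow> 'a"
  assumes Y: "diversity Y \<epsilon>" and X: "diversity X \<delta>" "complete_div X \<delta>"
    and ya: "range ya \<subseteq> Y" and xa: "range xa \<subseteq> X"
    and match: "\<And>i j. \<epsilon> {ya i, ya j} = \<delta> {xa i, xa j}"
    and y: "y \<in> Y" "\<And>e. 0 < e \<Longrightarrow> \<exists>i. \<epsilon> {ya i, y} < e"
  obtains x where "x \<in> X" "\<And>e. 0 < e \<Longrightarrow> \<exists>i. \<epsilon> {ya i, y} < e \<and> \<delta> {xa i, x} < e"
proof -
  have "\<forall>k. \<exists>i. \<epsilon> {ya i, y} < (1/2) ^ k" using y(2) by simp
  then obtain r where r: "\<And>k. \<epsilon> {ya (r k), y} < (1/2) ^ k" by metis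
  have "\<delta> {xa (r k), xa (r (Suc k))} \<le> 2 * (1/2) ^ k" for k
  proof -
    have "\<delta> {xa (r k), xa (r (Suc k))} = \<epsilon> {ya (r k), ya (r (Suc k))}" using match by simp
    also have "\<dots> \<le> \<epsilon> {ya (r k), y} + \<epsilon> {y, ya (r (Suc k))}"
      using ya y(1) by (intro diversity_triangle[OF Y]) auto
    also have "\<dots> \<le> (1/2) ^ k + (1/2) ^ Suc k"
      using r[of k] r[of "Suc k"] by (intro add_mono) (auto simp: insert_commute)
    also have "\<dots> \<le> 2 * (1/2) ^ k" by simp
    finally show ?thesis .
  qed
  then obtain x where x: "x \<in> X" "\<And>e. 0 < e \<Longrightarrow> \<exists>N. \<forall>n\<ge>N. \<delta> {xa (r n), x} < e"
    using complete_div_fast[OF X, of "\<lambda>k. xa (r k)" 2] xa by (metis range_subsetD)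
  have "\<exists>i. \<epsilon> {ya i, y} < e \<and> \<delta> {xa i, x} < e" if "0 < e" for e
  proof -
    obtain N where N: "\<forall>n\<ge>N. \<delta> {xa (r n), x} < e" using x(2)[OF \<open>0 < e\<close>] by blast
    obtain k where k: "(1/2) ^ k < e" using real_arch_pow_inv[OF \<open>0 < e\<close>, of "1/2"] by auto
    have "(1/2::real) ^ max k N \<le> (1/2) ^ k" by (intro power_decreasing) auto
    then have "\<epsilon> {ya (r (max k N)), y} < e" using r[of "max k N"] k by linarith
    then show ?thesis using N by (intro exI[of _ "r (max k N)"]) auto
  qed
  then show ?thesis using x(1) that by blast
qed

text \<open>
  The image of \<open>y\<close> is the point to which \<open>xa\<close> converges along the indices for which \<open>ya\<close> converges to
  \<open>y\<close>. Surjectivity follows from the same construction in the opposite direction.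
\<close>

lemma extend_to_completion:
  fixes ya :: "nat \<Rightarrow> 'b" and xa :: "nat \<Rightarrow> 'a"
  assumes Y: "diversity Y \<epsilon>" and X: "diversity X \<delta>" "complete_div X \<delta>"
    and ya: "range ya \<subseteq> Y" and xa: "range xa \<subseteq> X"
    and match: "\<And>F. finite F \<Longrightarrow> \<epsilon> (ya ` F) = \<delta> (xa ` F)"
    and dense: "\<And>y e. y \<in> Y \<Longrightarrow> 0 < e \<Longrightarrow> \<exists>i. \<epsilon> {ya i, y} < e"
  obtains g where "g ` Y \<subseteq> X" "\<And>F. F \<in> Fpow Y \<Longrightarrow> \<delta> (g ` F) = \<epsilon> F" "\<And>i. g (ya i) = xa i"
    "complete_div Y \<epsilon> \<Longrightarrow> (\<And>x e. x \<in> X \<Longrightarrow> 0 < e \<Longrightarrow> \<exists>i. \<delta> {xa i, x} < e) \<Longrightarrow> g ` Y = X"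
proof -
  define R where "R = (\<lambda>y x. \<forall>e>0. \<exists>i. \<epsilon> {ya i, y} < e \<and> \<delta> {xa i, x} < e)"
  have match2: "\<epsilon> {ya i, ya j} = \<delta> {xa i, xa j}" for i j
    using match[of "{i, j}"] by simp
  have "\<exists>x\<in>X. R y x" if "y \<in> Y" for y
    using matching_limit[OF Y X ya xa match2 that dense[OF that]] unfolding R_def by metis
  then obtain g where g: "\<And>y. y \<in> Y \<Longrightarrow> g y \<in> X \<and> R y (g y)" by metis
  have R_unique: "x = x'" if pts: "x \<in> X" "x' \<in> X" "y \<in> Y" "R y x" "R y x'" for y x x'
  proof (rule eq_if_arbitrarily_close[OF X(1) that(1,2)])
    fix e :: real assume "0 < e"
    then obtain i j where i: "\<epsilon> {ya i, y} < e/4" "\<delta> {xa i, x} < e/4"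
      and j: "\<epsilon> {ya j, y} < e/4" "\<delta> {xa j, x'} < e/4"
      using pts(4,5) unfolding R_def by (meson zero_less_divide_iff zero_less_numeral)
    have "\<delta> {xa i, xa j} \<le> \<epsilon> {ya i, y} + \<epsilon> {y, ya j}"
      unfolding match2[symmetric] using ya that by (intro diversity_triangle[OF Y]) auto
    moreover have "\<delta> {x, x'} \<le> \<delta> {x, xa i} + \<delta> {xa i, x'}"
      using xa that by (intro diversity_triangle[OF X(1)]) auto
    moreover have "\<delta> {xa i, x'} \<le> \<delta> {xa i, xa j} + \<delta> {xa j, x'}"
      using xa that by (intro diversity_triangle[OF X(1)]) auto
    moreover have "\<epsilon> {y, ya j} = \<epsilon> {ya j, y}" "\<delta> {x, xa i} = \<delta> {xa i, x}" by (simp_all add: insert_commute)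
    ultimately show "\<delta> {x, x'} < e" using i j by linarith
  qed
  show ?thesis
  proof (rule that)
    show gX: "g ` Y \<subseteq> X" using g by blast
    show "\<delta> (g ` F) = \<epsilon> F" if F: "F \<in> Fpow Y" for F
    proof -
      have fin: "finite F" "F \<subseteq> Y" using F by (auto simp: Fpow_def)
      have "\<bar>\<delta> (g ` F) - \<epsilon> F\<bar> \<le> e" if "0 < e" for e
      proof -
        define e' where "e' = e / (2 * (card F + 1))"
        have e': "0 < e'" using \<open>0 < e\<close> by (simp add: e'_def)
        then have "\<forall>y\<in>F. \<exists>i. \<epsilon> {ya i, y} < e' \<and> \<delta> {xa i, g y} < e'"
          using g fin(2) unfolding R_def by blast
        then obtain r where r: "\<And>y. y \<in> F \<Longrightarrow> \<epsilon> {ya (r y), y} < e' \<and> \<delta> {xa (r y), g y} < e'" by metis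
        have "\<bar>\<epsilon> ((\<lambda>y. ya (r y)) ` F) - \<epsilon> ((\<lambda>y. y) ` F)\<bar> \<le> (\<Sum>y\<in>F. \<epsilon> {ya (r y), y})"
          using fin ya by (intro diversity_move_points[OF Y]) auto
        also have "\<dots> \<le> (\<Sum>y\<in>F. e')" using r by (intro sum_mono) (auto intro: less_imp_le)
        finally have 1: "\<bar>\<epsilon> ((\<lambda>y. ya (r y)) ` F) - \<epsilon> F\<bar> \<le> card F * e'" by simp
        have "\<bar>\<delta> ((\<lambda>y. xa (r y)) ` F) - \<delta> (g ` F)\<bar> \<le> (\<Sum>y\<in>F. \<delta> {xa (r y), g y})"
          using fin xa gX by (intro diversity_move_points[OF X(1)]) blast+
        also have "\<dots> \<le> (\<Sum>y\<in>F. e')" using r by (intro sum_mono) (auto intro: less_imp_le)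
        finally have 2: "\<bar>\<delta> ((\<lambda>y. xa (r y)) ` F) - \<delta> (g ` F)\<bar> \<le> card F * e'" by simp
        have "\<epsilon> ((\<lambda>y. ya (r y)) ` F) = \<delta> ((\<lambda>y. xa (r y)) ` F)"
          using match[of "r ` F"] fin by (simp add: image_image)
        then have "\<bar>\<delta> (g ` F) - \<epsilon> F\<bar> \<le> 2 * (card F * e')" using 1 2 by linarith
        also have "\<dots> \<le> e" using \<open>0 < e\<close> by (simp add: e'_def field_simps)
        finally show ?thesis .
      qed
      then have "\<bar>\<delta> (g ` F) - \<epsilon> F\<bar> \<le> 0" by (rule field_le_epsilon) simp
      then show ?thesis by simp
    qed
    show "g (ya i) = xa i" for i
    proof (rule R_unique)
      show "ya i \<in> Y" "xa i \<in> X" "g (ya i) \<in> X" "R (ya i) (g (ya i))" using ya xa g by auto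
      have "\<epsilon> {ya i, ya i} = 0" "\<delta> {xa i, xa i} = 0"
        using diversity_singleton[OF Y] diversity_singleton[OF X(1)] ya xa by (simp_all add: range_subsetD)
      then show "R (ya i) (xa i)" unfolding R_def by (intro allI impI exI[of _ i]) simp
    qed
    assume comp: "complete_div Y \<epsilon>" and dX: "\<And>x e. x \<in> X \<Longrightarrow> 0 < e \<Longrightarrow> \<exists>i. \<delta> {xa i, x} < e"
    have "x \<in> g ` Y" if x: "x \<in> X" for x
    proof -
      obtain y where y: "y \<in> Y" "\<And>e. 0 < e \<Longrightarrow> \<exists>i. \<delta> {xa i, x} < e \<and> \<epsilon> {ya i, y} < e"
        using matching_limit[OF X(1) Y comp xa ya match2[symmetric] x dX[OF x]] by metis
      then have "R y x" unfolding R_def by blast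
      then have "x = g y" using R_unique[of x "g y" y] x y(1) g by blast
      then show ?thesis using y(1) by blast
    qed
    then show "g ` Y = X" using g by blast
  qed
qed

proposition embed_separable:
  fixes X :: "'a set" and Y :: "'b set"
  assumes Y: "cut_diversity Y \<epsilon>" "separable_div Y \<epsilon>"
    and X: "diversity X \<delta>" "extension_property X \<delta>" "complete_div X \<delta>"
  obtains g where "g ` Y \<subseteq> X" "\<And>F. F \<in> Fpow Y \<Longrightarrow> \<delta> (g ` F) = \<epsilon> F"
proof (cases "Y = {}")
  case True
  then show ?thesis using that[of "\<lambda>_. undefined"] X(1) cut_diversityD[OF Y(1)]
    by (auto simp: Fpow_def diversity_empty)
next
  case False
  obtain D :: "nat \<Rightarrow> 'b" where D: "range D \<subseteq> Y" "\<And>x e. x \<in> Y \<Longrightarrow> 0 < e \<Longrightarrow> \<exists>i. \<epsilon> {D i, x} < e"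
    using separable_div_sequence[OF Y(2) False] by blast
  obtain s :: "nat \<Rightarrow> 'b \<times> 'a" where s: "\<And>n. s n \<in> Y \<times> X" "\<And>n. fst (s n) = D n"
    "\<And>F. finite F \<Longrightarrow> \<epsilon> (fst ` s ` F) = \<delta> (snd ` s ` F)"
  proof (rule matching_sequence[OF cut_diversityD[OF Y(1)] X(1), of "\<lambda>n r. fst r = D n"])
    fix n and s :: "nat \<Rightarrow> 'b \<times> 'a"
    assume s: "\<And>i. i < n \<Longrightarrow> s i \<in> Y \<times> X"
      "\<And>F. F \<subseteq> {..<n} \<Longrightarrow> \<epsilon> (fst ` s ` F) = \<delta> (snd ` s ` F)"
    obtain q where q: "q \<in> X" "\<And>F. F \<subseteq> {..<n} \<Longrightarrow> \<delta> (insert q ((\<lambda>i. snd (s i)) ` F)) = \<epsilon> (insert (D n) ((\<lambda>i. fst (s i)) ` F))"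
    proof (rule extend_matching_tuple[OF Y(1) X(2)])
      show "(\<lambda>i. fst (s i)) ` {..<n} \<subseteq> Y" "(\<lambda>i. snd (s i)) ` {..<n} \<subseteq> X"
        using s(1) by (auto simp: mem_Times_iff)
      show "\<epsilon> ((\<lambda>i. fst (s i)) ` F) = \<delta> ((\<lambda>i. snd (s i)) ` F)" if "F \<subseteq> {..<n}" for F
        using s(2)[OF that] by (simp add: image_image)
      show "D n \<in> Y" using D(1) by blast
    qed blast
    then show "\<exists>r\<in>Y \<times> X. fst r = D n \<and> (\<forall>F\<subseteq>{..<n}. \<epsilon> (insert (fst r) (fst ` s ` F)) = \<delta> (insert (snd r) (snd ` s ` F)))"
      using D(1) by (intro bexI[of _ "(D n, q)"]) (auto simp: image_image)
  qed blast
  obtain g where "g ` Y \<subseteq> X" "\<And>F. F \<in> Fpow Y \<Longrightarrow> \<delta> (g ` F) = \<epsilon> F"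
  proof (rule extend_to_completion[OF cut_diversityD[OF Y(1)] X(1,3)])
    show "range (\<lambda>i. fst (s i)) \<subseteq> Y" "range (\<lambda>i. snd (s i)) \<subseteq> X" using s(1) by (auto simp: mem_Times_iff)
    show "\<epsilon> ((\<lambda>i. fst (s i)) ` F) = \<delta> ((\<lambda>i. snd (s i)) ` F)" if "finite F" for F
      using s(3)[OF that] by (simp add: image_image)
    show "\<exists>i. \<epsilon> {fst (s i), y} < e" if "y \<in> Y" "0 < e" for y e
      using D(2)[OF that] s(2) by simp
  qed blast
  then show ?thesis using that by blast
qed

text \<open>
  The first steps list the given finite partial map. From then on, even steps add the next term of
  a dense sequence of \<open>Y\<close> to the domain, and odd steps the next term of one of \<open>X\<close> to the range.
\<close>

theorem back_and_forth:
  fixes X :: "'a set" and Y :: "'b set"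
  assumes Y: "cut_diversity Y \<epsilon>" "separable_div Y \<epsilon>" "complete_div Y \<epsilon>" "extension_property Y \<epsilon>"
    and X: "cut_diversity X \<delta>" "separable_div X \<delta>" "complete_div X \<delta>" "extension_property X \<delta>"
    and S: "finite S" "S \<subseteq> Y" and f: "f ` S \<subseteq> X" "\<And>G. G \<subseteq> S \<Longrightarrow> \<delta> (f ` G) = \<epsilon> G"
  obtains g where "g ` Y = X" "\<And>F. F \<in> Fpow Y \<Longrightarrow> \<delta> (g ` F) = \<epsilon> F" "\<And>p. p \<in> S \<Longrightarrow> g p = f p"
proof -
  note divY = cut_diversityD[OF Y(1)] and divX = cut_diversityD[OF X(1)]
  obtain DY :: "nat \<Rightarrow> 'b" where DY: "range DY \<subseteq> Y" "\<And>x e. x \<in> Y \<Longrightarrow> 0 < e \<Longrightarrow> \<exists>i. \<epsilon> {DY i, x} < e"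
    using separable_div_sequence[OF Y(2) extension_property_nonempty[OF Y(4) divY]] by blast
  obtain DX :: "nat \<Rightarrow> 'a" where DX: "range DX \<subseteq> X" "\<And>x e. x \<in> X \<Longrightarrow> 0 < e \<Longrightarrow> \<exists>i. \<delta> {DX i, x} < e"
    using separable_div_sequence[OF X(2) extension_property_nonempty[OF X(4) divX]] by blast
  obtain k and t :: "nat \<Rightarrow> 'b" where t: "S = t ` {..<k}"
    using finite_imp_nat_seg_image_inj_on[OF S(1)] by (auto simp: lessThan_def)
  define req where "req = (\<lambda>n (r :: 'b \<times> 'a). if n < k then r = (t n, f (t n))
    else if even (n - k) then fst r = DY ((n - k) div 2) else snd r = DX ((n - k) div 2))"
  obtain s :: "nat \<Rightarrow> 'b \<times> 'a" where s: "\<And>n. s n \<in> Y \<times> X" "\<And>n. req n (s n)"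
    "\<And>F. finite F \<Longrightarrow> \<epsilon> (fst ` s ` F) = \<delta> (snd ` s ` F)"
  proof (rule matching_sequence[OF divY divX, of req])
    fix n and s :: "nat \<Rightarrow> 'b \<times> 'a"
    assume s0: "\<And>i. i < n \<Longrightarrow> s i \<in> Y \<times> X" and req: "\<And>i. i < n \<Longrightarrow> req i (s i)"
      and m0: "\<And>F. F \<subseteq> {..<n} \<Longrightarrow> \<epsilon> (fst ` s ` F) = \<delta> (snd ` s ` F)"
    have sY: "(\<lambda>i. fst (s i)) ` {..<n} \<subseteq> Y" and sX: "(\<lambda>i. snd (s i)) ` {..<n} \<subseteq> X"
      using s0 by (auto simp: mem_Times_iff)
    have m: "\<epsilon> ((\<lambda>i. fst (s i)) ` F) = \<delta> ((\<lambda>i. snd (s i)) ` F)" if "F \<subseteq> {..<n}" for F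
      using m0[OF that] by (simp add: image_image)
    show "\<exists>r\<in>Y \<times> X. req n r \<and> (\<forall>F\<subseteq>{..<n}. \<epsilon> (insert (fst r) (fst ` s ` F)) = \<delta> (insert (snd r) (snd ` s ` F)))"
    proof -
      consider "n < k" | "k \<le> n" "even (n - k)" | "k \<le> n" "odd (n - k)" by linarith
      then show ?thesis
      proof cases
        case 1
        have eq: "s i = (t i, f (t i))" if "i < n" for i using req[OF that] that 1 by (simp add: req_def)
        have "\<epsilon> (insert (t n) (fst ` s ` F)) = \<delta> (insert (f (t n)) (snd ` s ` F))" if F: "F \<subseteq> {..<n}" for F
        proof -
          have "fst ` s ` F = t ` F" unfolding image_image using eq F by (intro image_cong) auto
          moreover have "snd ` s ` F = f ` t ` F" unfolding image_image using eq F by (intro image_cong) auto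
          moreover have "insert (t n) (t ` F) \<subseteq> S" unfolding t using 1 F by force
          ultimately show ?thesis using f(2)[of "insert (t n) (t ` F)"] by simp
        qed
        moreover have "t n \<in> S" unfolding t using 1 by simp
        ultimately show ?thesis using 1 S(2) f(1)
          by (intro bexI[of _ "(t n, f (t n))"]) (auto simp: req_def)
      next
        case 2
        have "DY ((n - k) div 2) \<in> Y" using DY(1) by blast
        from extend_matching_tuple[OF Y(1) X(4) sY sX m this]
        obtain q where q: "q \<in> X" "\<And>F. F \<subseteq> {..<n} \<Longrightarrow>
          \<delta> (insert q ((\<lambda>i. snd (s i)) ` F)) = \<epsilon> (insert (DY ((n - k) div 2)) ((\<lambda>i. fst (s i)) ` F))" by blast
        then show ?thesis using 2 DY(1)
          by (intro bexI[of _ "(DY ((n - k) div 2), q)"]) (auto simp: req_def image_image)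
      next
        case 3
        have "DX ((n - k) div 2) \<in> X" using DX(1) by blast
        from extend_matching_tuple[OF X(1) Y(4) sX sY m[symmetric] this]
        obtain q where q: "q \<in> Y" "\<And>F. F \<subseteq> {..<n} \<Longrightarrow>
          \<epsilon> (insert q ((\<lambda>i. fst (s i)) ` F)) = \<delta> (insert (DX ((n - k) div 2)) ((\<lambda>i. snd (s i)) ` F))" by blast
        then show ?thesis using 3 DX(1)
          by (intro bexI[of _ "(q, DX ((n - k) div 2))"]) (auto simp: req_def image_image)
      qed
    qed
  qed blast
  have sY: "fst (s (k + 2 * i)) = DY i" for i using s(2)[of "k + 2 * i"] by (simp add: req_def)
  have sX: "snd (s (k + Suc (2 * i))) = DX i" for i using s(2)[of "k + Suc (2 * i)"] by (simp add: req_def)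
  obtain g where g: "g ` Y \<subseteq> X" "\<And>F. F \<in> Fpow Y \<Longrightarrow> \<delta> (g ` F) = \<epsilon> F" "\<And>i. g (fst (s i)) = snd (s i)"
    "complete_div Y \<epsilon> \<Longrightarrow> (\<And>x e. x \<in> X \<Longrightarrow> 0 < e \<Longrightarrow> \<exists>i. \<delta> {snd (s i), x} < e) \<Longrightarrow> g ` Y = X"
  proof (rule extend_to_completion[OF divY divX X(3)])
    show "range (\<lambda>i. fst (s i)) \<subseteq> Y" "range (\<lambda>i. snd (s i)) \<subseteq> X" using s(1) by (auto simp: mem_Times_iff)
    show "\<epsilon> ((\<lambda>i. fst (s i)) ` F) = \<delta> ((\<lambda>i. snd (s i)) ` F)" if "finite F" for F
      using s(3)[OF that] by (simp add: image_image)
    show "\<exists>i. \<epsilon> {fst (s i), y} < e" if "y \<in> Y" "0 < e" for y e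
      using DY(2)[OF that] sY by metis
  qed blast
  have "g ` Y = X" using g(4)[OF Y(3)] DX(2) sX by metis
  moreover have "g p = f p" if p: "p \<in> S" for p
  proof -
    obtain i where "i < k" "p = t i" using p t by auto
    then show ?thesis using s(2)[of i] g(3)[of i] by (simp add: req_def)
  qed
  ultimately show ?thesis using g(2) that by blast
qed

section \<open>The measure algebra as a diversity\<close>

text \<open>
  The one-point extension property with control: if \<open>w\<close> has the prescribed values up to \<open>e\<close>, some exact
  solution is at distance at most \<open>c * e\<close> from \<open>w\<close>.
\<close>

definition extends_within :: "'a set \<Rightarrow> ('a set \<Rightarrow> real) \<Rightarrow> nat \<Rightarrow> real \<Rightarrow> bool" where
  "extends_within X \<delta> n c \<longleftrightarrow>
     (\<forall>a \<gamma> w e. a ` {..<n} \<subseteq> X \<and> w \<in> X \<and> cut_rep {..n} \<gamma> \<and> (\<forall>F\<subseteq>{..<n}. \<gamma> F = \<delta> (a ` F)) \<and>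
        (\<forall>F\<subseteq>{..<n}. \<bar>\<gamma> (insert n F) - \<delta> (insert w (a ` F))\<bar> \<le> e) \<longrightarrow>
        (\<exists>z\<in>X. (\<forall>F\<subseteq>{..<n}. \<delta> (insert z (a ` F)) = \<gamma> (insert n F)) \<and> \<delta> {w, z} \<le> c * e))"

lemma extends_withinD:
  assumes "extends_within X \<delta> n c" "a ` {..<n} \<subseteq> X" "w \<in> X" "cut_rep {..n} \<gamma>"
    "\<And>F. F \<subseteq> {..<n} \<Longrightarrow> \<gamma> F = \<delta> (a ` F)"
    "\<And>F. F \<subseteq> {..<n} \<Longrightarrow> \<bar>\<gamma> (insert n F) - \<delta> (insert w (a ` F))\<bar> \<le> e"
  shows "\<exists>z\<in>X. (\<forall>F\<subseteq>{..<n}. \<delta> (insert z (a ` F)) = \<gamma> (insert n F)) \<and> \<delta> {w, z} \<le> c * e"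
  by (rule assms(1)[unfolded extends_within_def, THEN spec, THEN spec, THEN spec, THEN spec, THEN mp])
    (simp add: assms(2-6))

lemma spread_set_fmeasurable:
  assumes "finite F" "F \<subseteq> \<M>"
  shows "{\<omega>. (\<exists>A\<in>F. \<omega> \<in> A) \<and> (\<exists>B\<in>F. \<omega> \<notin> B)} \<in> \<M>"
proof -
  have "{\<omega>. (\<exists>A\<in>F. \<omega> \<in> A) \<and> (\<exists>B\<in>F. \<omega> \<notin> B)} = (\<Union>A\<in>F. \<Union>B\<in>F. A - B)" by auto
  then show ?thesis using assms
    by (simp only:) (intro fmeasurable.finite_UN fmeasurable.Diff, auto)
qed

lemma spread_mono:
  assumes "finite F" "F \<subseteq> \<M>" "G \<subseteq> F"
  shows "spread G \<le> spread F"
  unfolding spread_def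
proof (rule measure_mono_fmeasurable)
  show "{\<omega>. (\<exists>A\<in>F. \<omega> \<in> A) \<and> (\<exists>B\<in>F. \<omega> \<notin> B)} \<in> \<M>"
    using assms by (intro spread_set_fmeasurable)
  show "{\<omega>. (\<exists>A\<in>G. \<omega> \<in> A) \<and> (\<exists>B\<in>G. \<omega> \<notin> B)} \<in> sets lborel"
    using assms by (intro fmeasurableD spread_set_fmeasurable) (auto intro: finite_subset)
qed (use assms(3) in auto)

lemma spread_through:
  assumes "finite A" "A \<subseteq> \<M>" "finite B" "B \<subseteq> \<M>"
    "finite C" "C \<subseteq> \<M>" "B \<noteq> {}"
  shows "spread (A \<union> C) \<le> spread (A \<union> B) + spread (B \<union> C)"
proof -
  let ?S = "\<lambda>F. {\<omega>. (\<exists>A\<in>F. \<omega> \<in> A) \<and> (\<exists>B\<in>F. \<omega> \<notin> (B :: real set))}"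
  have fm: "?S (A \<union> C) \<in> \<M>" "?S (A \<union> B) \<in> \<M>" "?S (B \<union> C) \<in> \<M>"
    using assms by (auto intro!: spread_set_fmeasurable simp del: Un_iff)
  obtain b where "b \<in> B" using assms(7) by blast
  then have "?S (A \<union> C) \<subseteq> ?S (A \<union> B) \<union> ?S (B \<union> C)" by auto
  then have "\<mu> (?S (A \<union> C)) \<le> \<mu> (?S (A \<union> B) \<union> ?S (B \<union> C))"
    using fm by (intro measure_mono_fmeasurable fmeasurable.Un fmeasurableD)
  also have "\<dots> \<le> \<mu> (?S (A \<union> B)) + \<mu> (?S (B \<union> C))"
    using fm by (intro measure_Un_le fmeasurableD)
  finally show ?thesis by (simp add: spread_def)
qed

lemma spread_triangle:
  "A \<in> \<M> \<Longrightarrow> B \<in> \<M> \<Longrightarrow> C \<in> \<M> \<Longrightarrow>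
    spread {A, C} \<le> spread {A, B} + spread {B, C}"
  using spread_through[of "{A}" "{B}" "{C}"] by (simp add: insert_commute)

lemma spread_nonneg: "0 \<le> spread F"
  by (simp add: spread_def)

text \<open>
  Modulo null sets, a set of finite measure is determined by its distances to a dense sequence, that is,
  by a set of pairs of natural numbers. In this way the measure algebra is injected into the reals.
\<close>

lemma measure_algebra_code:
  obtains code :: "real set \<Rightarrow> real" where
    "\<And>A B. A \<in> \<M> \<Longrightarrow> B \<in> \<M> \<Longrightarrow> code A = code B \<longleftrightarrow> spread {A, B} = 0"
proof -
  obtain D :: "nat \<Rightarrow> real set" where D: "\<And>n. D n \<in> \<M>"
    "\<And>E \<epsilon>. E \<in> \<M> \<Longrightarrow> 0 < \<epsilon> \<Longrightarrow> \<exists>n. spread {E, D n} < \<epsilon>"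
    using spread_dense_sequence by blast
  obtain \<iota> :: "nat set \<Rightarrow> real" where \<iota>: "inj \<iota>"
    using nat_sets_eqpoll_reals unfolding eqpoll_def bij_betw_def by blast
  define h where "h = (\<lambda>E. prod_encode ` {(n, m). spread {E, D n} < 1 / (real m + 1)})"
  have "h A = h B \<longleftrightarrow> spread {A, B} = 0" if fm: "A \<in> \<M>" "B \<in> \<M>" for A B
  proof
    assume "h A = h B"
    then have same: "spread {A, D n} < 1 / (real m + 1) \<longleftrightarrow> spread {B, D n} < 1 / (real m + 1)" for n m
      unfolding h_def by (subst (asm) inj_image_eq_iff[OF inj_prod_encode]) (auto simp: set_eq_iff)
    have "spread {A, B} \<le> 0"
    proof (rule field_le_epsilon)
      fix e :: real assume "0 < e"
      then obtain m where m: "1 / (real m + 1) < e / 2"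
        using nat_approx_posE[of "e / 2"] by (auto simp: add.commute)
      obtain n where n: "spread {A, D n} < 1 / (real m + 1)" using D(2)[OF fm(1), of "1 / (real m + 1)"] by auto
      then have "spread {B, D n} < 1 / (real m + 1)" using same by simp
      moreover have "spread {A, B} \<le> spread {A, D n} + spread {D n, B}" using fm D(1) by (intro spread_triangle)
      ultimately show "spread {A, B} \<le> 0 + e" using n m by (simp add: insert_commute)
    qed
    then show "spread {A, B} = 0" using spread_nonneg[of "{A, B}"] by simp
  next
    assume 0: "spread {A, B} = 0"
    have "spread {A, D n} = spread {B, D n}" for n
      using spread_triangle[of A B "D n"] spread_triangle[of B A "D n"] fm D(1)[of n] 0
      by (simp add: insert_commute)
    then show "h A = h B" by (simp add: h_def)
  qed
  then show ?thesis using that[of "\<iota> \<circ> h"] \<iota> by (simp add: inj_eq)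
qed

lemma L1_div_indicators:
  assumes "finite F" "\<And>x. x \<in> F \<Longrightarrow> a x \<in> \<M>"
  shows "L1_div lborel ((\<lambda>x. indicator (a x)) ` F) = spread (a ` F)"
proof (cases "F = {}")
  case False
  let ?S = "{\<omega>. (\<exists>A\<in>a ` F. \<omega> \<in> A) \<and> (\<exists>B\<in>a ` F. \<omega> \<notin> B)}"
  have "Max ((\<lambda>x. indicator (a x) \<omega>) ` F) - Min ((\<lambda>x. indicator (a x) \<omega>) ` F) = (indicator ?S \<omega> :: real)" for \<omega>
  proof -
    have "Max ((\<lambda>x. indicator (a x) \<omega>) ` F) = (if \<exists>x\<in>F. \<omega> \<in> a x then 1 else 0 :: real)"
      using assms(1) False by (intro Max_eqI) (auto simp: indicator_def image_iff)
    moreover have "Min ((\<lambda>x. indicator (a x) \<omega>) ` F) = (if \<exists>x\<in>F. \<omega> \<notin> a x then 0 else 1 :: real)"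
      using assms(1) False by (intro Min_eqI) (auto simp: indicator_def image_iff)
    ultimately show ?thesis using False by (auto simp: indicator_def)
  qed
  then have "L1_div lborel ((\<lambda>x. indicator (a x)) ` F) = (\<integral>\<omega>. indicator ?S \<omega> \<partial>lborel)"
    using False by (simp add: L1_div_def image_image)
  also have "\<dots> = spread (a ` F)" by (simp add: spread_def)
  finally show ?thesis .
qed (simp add: L1_div_def spread_def)

text \<open>
  The points are the codes of the sets of finite measure, and \<open>dec\<close> chooses one set for each code. Passing
  from a set to the representative of its code changes only null sets. The indicator functions
  of the representatives are an embedding into \<open>L\<^sub>1\<close> of the line.
\<close>

theorem universal_L1_space:
  obtains X :: "real set" and \<delta> where "L1_diversity X \<delta>" "separable_div X \<delta>" "complete_div X \<delta>"
    "\<And>n. \<exists>c. extends_within X \<delta> n c" "X \<noteq> {}"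
proof -
  let ?fm = "\<M> :: real set set"
  obtain code :: "real set \<Rightarrow> real" where code:
    "\<And>A B. A \<in> ?fm \<Longrightarrow> B \<in> ?fm \<Longrightarrow> code A = code B \<longleftrightarrow> spread {A, B} = 0"
    using measure_algebra_code by blast
  define X where "X = code ` ?fm"
  define dec where "dec = inv_into ?fm code"
  define \<delta> where "\<delta> = (\<lambda>F. spread (dec ` F))"
  have dec: "dec x \<in> ?fm" "code (dec x) = x" if "x \<in> X" for x
    using that unfolding X_def dec_def by (auto intro: inv_into_into f_inv_into_f)
  have decfm: "dec ` F \<subseteq> ?fm" if "F \<subseteq> X" for F using that dec by blast
  have codeX: "code E \<in> X" if "E \<in> ?fm" for E using that by (simp add: X_def)
  have dec_code: "spread {dec (code E), E} = 0" if "E \<in> ?fm" for E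
    using code[of "dec (code E)" E] dec[OF codeX[OF that]] that by simp
  have replace: "spread (insert (dec (code E)) \<A>) = spread (insert E \<A>)"
    if E: "E \<in> ?fm" "finite \<A>" "\<A> \<subseteq> ?fm" for E \<A>
  proof -
    have f1: "dec (code E) \<in> ?fm" using dec codeX E(1) by blast
    have "spread (\<A> \<union> {E}) \<le> spread (\<A> \<union> {dec (code E)}) + spread ({dec (code E)} \<union> {E})"
      using E f1 by (intro spread_through) auto
    moreover have "spread (\<A> \<union> {dec (code E)}) \<le> spread (\<A> \<union> {E}) + spread ({E} \<union> {dec (code E)})"
      using E f1 by (intro spread_through) auto
    moreover have "spread ({dec (code E)} \<union> {E}) = 0" "spread ({E} \<union> {dec (code E)}) = 0"
      using dec_code[OF E(1)] by (simp_all add: insert_commute)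
    ultimately show ?thesis by simp
  qed
  have div: "diversity X \<delta>"
    unfolding diversity_def
  proof (intro conjI ballI impI)
    fix A assume A: "A \<in> Fpow X"
    then have fin: "finite A" "A \<subseteq> X" by (auto simp: Fpow_def)
    show "0 \<le> \<delta> A" by (simp add: \<delta>_def spread_nonneg)
    show "\<delta> A = 0 \<longleftrightarrow> card A \<le> 1"
    proof
      assume 0: "\<delta> A = 0"
      have "x = y" if "x \<in> A" "y \<in> A" for x y
      proof -
        have "spread {dec x, dec y} \<le> spread (dec ` A)"
          using that fin decfm[OF fin(2)] by (intro spread_mono) auto
        then have "spread {dec x, dec y} = 0"
          using 0 spread_nonneg[of "{dec x, dec y}"] by (simp add: \<delta>_def)
        then have "code (dec x) = code (dec y)" using code[of "dec x" "dec y"] dec that fin by blast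
        then show ?thesis using dec that fin by (metis subsetD)
      qed
      then show "card A \<le> 1" using card_le_Suc0_iff_eq[OF fin(1)] by auto
    next
      assume "card A \<le> 1"
      then have "dec x = dec y" if "x \<in> A" "y \<in> A" for x y
        using card_le_Suc0_iff_eq[OF fin(1)] that by auto
      then have empty: "{\<omega>. (\<exists>B\<in>dec ` A. \<omega> \<in> B) \<and> (\<exists>B\<in>dec ` A. \<omega> \<notin> B)} = {}" by blast
      show "\<delta> A = 0" unfolding \<delta>_def spread_def empty by simp
    qed
  next
    fix A B C assume "A \<in> Fpow X" "B \<in> Fpow X" "C \<in> Fpow X" "B \<noteq> {}"
    then show "\<delta> (A \<union> C) \<le> \<delta> (A \<union> B) + \<delta> (B \<union> C)"
      unfolding \<delta>_def image_Un using decfm by (intro spread_through) (auto simp: Fpow_def)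
  qed
  have "L1_embedding (\<lambda>x. indicator (dec x)) X \<delta> lborel"
    unfolding L1_embedding_def
  proof (intro conjI ballI)
    show "integrable lborel (indicator (dec x) :: real \<Rightarrow> real)" if "x \<in> X" for x
      using dec(1)[OF that] by (intro integrable_real_indicator) (auto simp: fmeasurable_def)
    show "L1_div lborel ((\<lambda>x. indicator (dec x)) ` F) = \<delta> F" if "F \<in> Fpow X" for F
      unfolding \<delta>_def using that dec by (intro L1_div_indicators) (auto simp: Fpow_def)
  qed
  with div have L1: "L1_diversity X \<delta>" by (rule L1_diversityI)
  have sep: "separable_div X \<delta>"
  proof -
    obtain D :: "nat \<Rightarrow> real set" where D: "\<And>n. D n \<in> ?fm"
      "\<And>E \<epsilon>. E \<in> ?fm \<Longrightarrow> 0 < \<epsilon> \<Longrightarrow> \<exists>n. spread {E, D n} < \<epsilon>"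
      using spread_dense_sequence by blast
    have "\<exists>y\<in>range (\<lambda>n. code (D n)). \<delta> {y, x} < e" if "x \<in> X" "0 < e" for x e
    proof -
      obtain n where n: "spread {dec x, D n} < e" using D(2)[OF dec(1)] \<open>x \<in> X\<close> \<open>0 < e\<close> by blast
      have "\<delta> {code (D n), x} = spread {dec (code (D n)), dec x}" by (simp add: \<delta>_def)
      also have "\<dots> = spread {D n, dec x}" using replace[OF D(1), of "{dec x}"] dec \<open>x \<in> X\<close> by simp
      also have "\<dots> < e" using n by (simp add: insert_commute)
      finally show ?thesis by blast
    qed
    then show ?thesis unfolding separable_div_def using codeX[OF D(1)]
      by (intro exI[of _ "range (\<lambda>n. code (D n))"]) auto
  qed
  have comp: "complete_div X \<delta>"
    unfolding complete_div_def
  proof (intro allI impI)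
    fix \<sigma> :: "nat \<Rightarrow> real"
    assume "range \<sigma> \<subseteq> X \<and> (\<forall>e>0. \<exists>N. \<forall>m\<ge>N. \<forall>n\<ge>N. \<delta> {\<sigma> m, \<sigma> n} < e)"
    then have \<sigma>: "\<And>n. \<sigma> n \<in> X" and cau: "\<And>e. 0 < e \<Longrightarrow> \<exists>N. \<forall>m\<ge>N. \<forall>n\<ge>N. \<delta> {\<sigma> m, \<sigma> n} < e" by auto
    have "\<forall>k. \<exists>N. \<forall>m\<ge>N. \<forall>n\<ge>N. \<delta> {\<sigma> m, \<sigma> n} < (1/2) ^ k" using cau by simp
    then obtain N where N: "\<And>k m n. N k \<le> m \<Longrightarrow> N k \<le> n \<Longrightarrow> \<delta> {\<sigma> m, \<sigma> n} < (1/2) ^ k" by metis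
    \<comment> \<open>The partial sums form an increasing sequence above \<open>N\<close>.\<close>
    define r where "r = (\<lambda>k. \<Sum>j\<le>k. N j)"
    have r: "N k \<le> r k" for k unfolding r_def by (rule member_le_sum) auto
    have fm: "dec (\<sigma> n) \<in> ?fm" for n using dec \<sigma> by blast
    have "spread {dec (\<sigma> (r k)), dec (\<sigma> (r (Suc k)))} \<le> (1/2) ^ k" for k
    proof -
      have "N k \<le> r (Suc k)" using r[of k] by (simp add: r_def)
      then show ?thesis using N[of k "r k" "r (Suc k)"] r[of k] by (simp add: \<delta>_def)
    qed
    then obtain E where E: "E \<in> ?fm" "\<And>n. spread {dec (\<sigma> (r n)), E} \<le> 2 * (1/2) ^ n"
      using spread_fast_limit[of "\<lambda>k. dec (\<sigma> (r k))"] fm by blast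
    have "\<exists>M. \<forall>n\<ge>M. \<delta> {\<sigma> n, code E} < e" if "0 < e" for e
    proof -
      obtain k where k: "(1/2) ^ k < e / 3" using real_arch_pow_inv[of "e / 3" "1/2"] \<open>0 < e\<close> by auto
      have "\<delta> {\<sigma> n, code E} < e" if n: "N k \<le> n" for n
      proof -
        have "\<delta> {\<sigma> n, code E} = spread {E, dec (\<sigma> n)}"
          using replace[OF E(1), of "{dec (\<sigma> n)}"] fm by (simp add: \<delta>_def insert_commute)
        also have "\<dots> \<le> spread {E, dec (\<sigma> (r k))} + spread {dec (\<sigma> (r k)), dec (\<sigma> n)}"
          using E(1) fm by (intro spread_triangle) auto
        also have "spread {E, dec (\<sigma> (r k))} \<le> 2 * (1/2) ^ k" using E(2)[of k] by (simp add: insert_commute)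
        also have "spread {dec (\<sigma> (r k)), dec (\<sigma> n)} < (1/2) ^ k"
          using N[OF r n] by (simp add: \<delta>_def)
        finally show ?thesis using k by simp
      qed
      then show ?thesis by blast
    qed
    then show "\<exists>x\<in>X. \<forall>e>0. \<exists>N. \<forall>n\<ge>N. \<delta> {\<sigma> n, x} < e" using codeX[OF E(1)] by blast
  qed
  have ext: "extends_within X \<delta> n (2 ^ n * (2 ^ Suc n * 2))" for n
    unfolding extends_within_def
  proof (intro allI impI)
    fix a :: "nat \<Rightarrow> real" and \<gamma> :: "nat set \<Rightarrow> real" and w e :: real
    assume asm: "a ` {..<n} \<subseteq> X \<and> w \<in> X \<and> cut_rep {..n} \<gamma> \<and> (\<forall>F\<subseteq>{..<n}. \<gamma> F = \<delta> (a ` F)) \<and>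
      (\<forall>F\<subseteq>{..<n}. \<bar>\<gamma> (insert n F) - \<delta> (insert w (a ` F))\<bar> \<le> e)"
    have fm: "dec (a i) \<in> ?fm" if "i < n" for i using asm that dec by auto
    obtain z where z: "z \<in> ?fm" "\<And>F. F \<subseteq> {..<n} \<Longrightarrow> spread (insert z ((\<lambda>i. dec (a i)) ` F)) = \<gamma> (insert n F)"
      "spread {dec w, z} \<le> 2 ^ n * (2 ^ Suc n * (2 * e))"
    proof (rule extend_sets[of n "\<lambda>i. dec (a i)" "dec w" \<gamma> e])
      show "\<gamma> F = spread ((\<lambda>i. dec (a i)) ` F)" if "F \<subseteq> {..<n}" for F
        using asm that by (simp add: \<delta>_def image_image)
      show "\<bar>\<gamma> (insert n F) - spread (insert (dec w) ((\<lambda>i. dec (a i)) ` F))\<bar> \<le> e" if "F \<subseteq> {..<n}" for F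
      proof -
        have "\<bar>\<gamma> (insert n F) - \<delta> (insert w (a ` F))\<bar> \<le> e" using asm that by blast
        then show ?thesis by (simp add: \<delta>_def image_image)
      qed
    qed (use asm fm dec in auto)
    have "\<delta> (insert (code z) (a ` F)) = \<gamma> (insert n F)" if F: "F \<subseteq> {..<n}" for F
    proof -
      have "finite ((\<lambda>i. dec (a i)) ` F)" using F finite_subset by blast
      moreover have "(\<lambda>i. dec (a i)) ` F \<subseteq> ?fm" using fm F by auto
      ultimately show ?thesis using replace[OF z(1)] z(2)[OF F] by (simp add: \<delta>_def image_image)
    qed
    moreover have "\<delta> {w, code z} \<le> 2 ^ n * (2 ^ Suc n * 2) * e"
    proof -
      have "\<delta> {w, code z} = spread {dec w, z}"
        using replace[OF z(1), of "{dec w}"] asm dec by (simp add: \<delta>_def insert_commute)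
      then show ?thesis using z(3) by (simp add: mult.assoc)
    qed
    ultimately show "\<exists>z\<in>X. (\<forall>F\<subseteq>{..<n}. \<delta> (insert z (a ` F)) = \<gamma> (insert n F)) \<and> \<delta> {w, z} \<le> 2 ^ n * (2 ^ Suc n * 2) * e"
      by (intro bexI[OF _ codeX[OF z(1)]] conjI allI impI) simp_all
  qed
  have "X \<noteq> {}" using codeX[of "{}"] by auto
  then show ?thesis using that L1 sep comp ext by blast
qed

text \<open>
  Any point \<open>w\<close> has the prescribed values up to some finite error.
\<close>

lemma extension_property_if_quantitative:
  assumes "\<And>n. \<exists>c. extends_within X \<delta> n c" "X \<noteq> {}"
  shows "extension_property X \<delta>"
  unfolding extension_property_def
proof (intro allI impI)
  fix n and a :: "nat \<Rightarrow> 'a" and \<gamma> :: "nat set \<Rightarrow> real"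
  assume asm: "a ` {..<n} \<subseteq> X \<and> cut_rep {..n} \<gamma> \<and> (\<forall>F\<subseteq>{..<n}. \<gamma> F = \<delta> (a ` F))"
  obtain w where w: "w \<in> X" using assms(2) by blast
  define e where "e = (\<Sum>F\<in>Pow {..<n}. \<bar>\<gamma> (insert n F) - \<delta> (insert w (a ` F))\<bar>)"
  have e: "\<bar>\<gamma> (insert n F) - \<delta> (insert w (a ` F))\<bar> \<le> e" if "F \<subseteq> {..<n}" for F
    unfolding e_def using that by (intro member_le_sum[of F "Pow {..<n}" "\<lambda>F. \<bar>\<gamma> (insert n F) - \<delta> (insert w (a ` F))\<bar>"]) auto
  obtain c where c: "extends_within X \<delta> n c" using assms(1) by blast
  show "\<exists>z\<in>X. \<forall>F\<subseteq>{..<n}. \<delta> (insert z (a ` F)) = \<gamma> (insert n F)"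
    using extends_withinD[OF c, of a w \<gamma> e] asm w e by blast
qed

lemma realize_cut_rep:
  fixes n :: nat
  assumes "extension_property X \<delta>" "diversity X \<delta>" "cut_rep {..<n} \<gamma>"
  obtains a where "a ` {..<n} \<subseteq> X" "\<And>F. F \<subseteq> {..<n} \<Longrightarrow> \<delta> (a ` F) = \<gamma> F"
proof -
  have "\<exists>a. a ` {..<m} \<subseteq> X \<and> (\<forall>F\<subseteq>{..<m}. \<delta> (a ` F) = \<gamma> F)" if "m \<le> n" for m
    using that
  proof (induction m)
    case 0
    have "\<gamma> {} = 0" by (rule cut_rep_trivial[OF assms(3)]) auto
    then show ?case using assms(2) by (simp add: diversity_empty)
  next
    case (Suc m)
    then obtain a where a: "a ` {..<m} \<subseteq> X" "\<And>F. F \<subseteq> {..<m} \<Longrightarrow> \<delta> (a ` F) = \<gamma> F" by auto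
    have "cut_rep {..m} \<gamma>" using Suc.prems by (intro cut_rep_subset[OF assms(3)]) auto
    then obtain z where z: "z \<in> X" "\<forall>F\<subseteq>{..<m}. \<delta> (insert z (a ` F)) = \<gamma> (insert m F)"
      using extension_propertyE[OF assms(1) a(1), of \<gamma>] a(2) by metis
    have "\<delta> ((a(m := z)) ` F) = \<gamma> F" if F: "F \<subseteq> {..<Suc m}" for F
    proof -
      have sub: "F - {m} \<subseteq> {..<m}" using F by (auto simp: less_Suc_eq)
      have same: "(a(m := z)) ` (F - {m}) = a ` (F - {m})" by (intro image_cong) auto
      show ?thesis
      proof (cases "m \<in> F")
        case True
        have "(a(m := z)) ` F = (a(m := z)) ` insert m (F - {m})" using True by (simp add: insert_absorb)
        also have "\<dots> = insert z (a ` (F - {m}))" by (simp only: image_insert same fun_upd_same)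
        finally have "\<delta> ((a(m := z)) ` F) = \<gamma> (insert m (F - {m}))" using z(2) sub by simp
        then show ?thesis using True by (simp add: insert_absorb)
      next
        case False
        then show ?thesis using a(2)[OF sub] same by simp
      qed
    qed
    moreover have "(a(m := z)) ` {..<Suc m} \<subseteq> X" using a(1) z(1) by (auto simp: less_Suc_eq)
    ultimately show ?case by blast
  qed
  then show ?thesis using that by blast
qed

section \<open>Diversities as relational structures\<close>

text \<open>
  On the meaningful values, \<open>A\<close> agrees with the structure of \<open>\<delta>\<close>.
\<close>

definition represents :: "('a, div_symbol) rel_struct \<Rightarrow> ('a set \<Rightarrow> real) \<Rightarrow> bool" where
  "represents A \<delta> \<longleftrightarrow> \<delta> {} = 0 \<and>
     (\<forall>x\<in>univ A. \<forall>y\<in>univ A. interp A Dist [x, y] = \<delta> {x, y}) \<and>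
     (\<forall>xs. xs \<noteq> [] \<and> set xs \<subseteq> univ A \<longrightarrow> interp A (Delta (length xs)) xs = \<delta> (set xs))"

lemma represents_Dist:
  "represents A \<delta> \<Longrightarrow> x \<in> univ A \<Longrightarrow> y \<in> univ A \<Longrightarrow> interp A Dist [x, y] = \<delta> {x, y}"
  by (simp add: represents_def)

lemma represents_Delta:
  "represents A \<delta> \<Longrightarrow> xs \<noteq> [] \<Longrightarrow> set xs \<subseteq> univ A \<Longrightarrow> length xs = k \<Longrightarrow> interp A (Delta k) xs = \<delta> (set xs)"
  by (auto simp: represents_def)

lemma embedding_iff:
  assumes A: "represents A \<delta>" and B: "represents B \<epsilon>"
  shows "embedding \<L> f A B \<longleftrightarrow> f ` univ A \<subseteq> univ B \<and> (\<forall>F\<in>Fpow (univ A). \<epsilon> (f ` F) = \<delta> F)"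
proof
  assume emb: "embedding \<L> f A B"
  then have sub: "f ` univ A \<subseteq> univ B" by (simp add: embedding_def)
  have "\<epsilon> (f ` F) = \<delta> F" if F: "F \<in> Fpow (univ A)" for F
  proof (cases "F = {}")
    case True
    then show ?thesis using A B by (simp add: represents_def)
  next
    case False
    obtain xs where xs: "set xs = F" using F finite_list by (auto simp: Fpow_def)
    then have ne: "xs \<noteq> []" "set xs \<subseteq> univ A" using False F by (auto simp: Fpow_def)
    have "Delta (length xs) \<in> symbols \<L>"
      using ne(1) by (cases xs) (auto simp: div_language_def)
    moreover have "xs \<in> tuples A (arity \<L> (Delta (length xs)))"
      using ne by (simp add: tuples_def div_language_def)
    ultimately have "interp B (Delta (length xs)) (map f xs) = interp A (Delta (length xs)) xs"
      using emb by (simp add: embedding_def)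
    moreover have "interp A (Delta (length xs)) xs = \<delta> F" using A ne xs by (simp add: represents_def)
    moreover have "interp B (Delta (length (map f xs))) (map f xs) = \<epsilon> (set (map f xs))"
      using B ne sub unfolding represents_def by (metis image_mono list.map_disc_iff list.set_map order_trans)
    ultimately show ?thesis using xs by simp
  qed
  then show "f ` univ A \<subseteq> univ B \<and> (\<forall>F\<in>Fpow (univ A). \<epsilon> (f ` F) = \<delta> F)" using sub by blast
next
  assume emb: "f ` univ A \<subseteq> univ B \<and> (\<forall>F\<in>Fpow (univ A). \<epsilon> (f ` F) = \<delta> F)"
  have "interp B R (map f xs) = interp A R xs"
    if R: "R \<in> symbols \<L>" and xs: "xs \<in> tuples A (arity \<L> R)" for R xs
  proof (cases R)
    case Dist
    then obtain x y where xy: "xs = [x, y]" "x \<in> univ A" "y \<in> univ A"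
      using xs by (auto simp: tuples_def div_language_def length_Suc_conv numeral_2_eq_2)
    have "{x, y} \<in> Fpow (univ A)" using xy(2,3) by (simp add: Fpow_def)
    then have "\<epsilon> (f ` {x, y}) = \<delta> {x, y}" using emb by blast
    moreover have "f x \<in> univ B" "f y \<in> univ B" using emb xy by auto
    ultimately show ?thesis using A B xy Dist by (simp add: represents_def)
  next
    case (Delta k)
    then have ne: "xs \<noteq> []" "set xs \<subseteq> univ A" "length xs = k"
      using R xs by (auto simp: tuples_def div_language_def)
    have "f ` set xs \<subseteq> univ B" using emb ne by blast
    then have "interp B (Delta (length (map f xs))) (map f xs) = \<epsilon> (set (map f xs))"
      using B ne(1) unfolding represents_def by (metis list.map_disc_iff list.set_map)
    moreover have "interp A (Delta (length xs)) xs = \<delta> (set xs)" using represents_Delta[OF A ne(1,2) refl] .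
    moreover have "\<epsilon> (f ` set xs) = \<delta> (set xs)" using emb ne(2) by (simp add: Fpow_def)
    ultimately show ?thesis using ne(3) Delta by simp
  qed
  then show "embedding \<L> f A B" using emb by (simp add: embedding_def)
qed

lemma univ_div_structure [simp]: "univ (div_structure X \<delta>) = X"
  by (simp add: div_structure_def)

lemma univ_induced [simp]: "univ (induced A S) = S"
  by (simp add: induced_def)

lemma represents_div_structure: "\<delta> {} = 0 \<Longrightarrow> represents (div_structure X \<delta>) \<delta>"
  by (auto simp: represents_def div_structure_def)

lemma represents_induced: "represents A \<delta> \<Longrightarrow> S \<subseteq> univ A \<Longrightarrow> represents (induced A S) \<delta>"
  by (auto simp: represents_def induced_def)

lemma L1_structure_iff: "L1_structure A \<longleftrightarrow> (\<exists>\<delta>. L1_diversity (univ A) \<delta> \<and> represents A \<delta>)"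
proof -
  have "isomorphism \<L> (\<lambda>x. x) A (div_structure (univ A) \<delta>) \<longleftrightarrow> represents A \<delta>"
    if "L1_diversity (univ A) \<delta>" for \<delta>
  proof -
    have 0: "\<delta> {} = 0" using that diversity_empty by (auto simp: L1_diversity_def)
    show ?thesis
    proof
      assume "isomorphism \<L> (\<lambda>x. x) A (div_structure (univ A) \<delta>)"
      then have *: "\<delta> (set xs) = interp A R xs"
        if "R \<in> symbols \<L>" "xs \<in> tuples A (arity \<L> R)" for R xs
        using that by (simp add: isomorphism_def embedding_def div_structure_def)
      show "represents A \<delta>"
        unfolding represents_def
      proof (intro conjI ballI allI impI 0)
        show "interp A Dist [x, y] = \<delta> {x, y}" if "x \<in> univ A" "y \<in> univ A" for x y
          using *[of Dist "[x, y]"] that by (simp add: div_language_def tuples_def)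
        show "interp A (Delta (length xs)) xs = \<delta> (set xs)" if "xs \<noteq> [] \<and> set xs \<subseteq> univ A" for xs
          using *[of "Delta (length xs)" xs] that by (cases xs) (auto simp: div_language_def tuples_def)
      qed
    next
      assume "represents A \<delta>"
      then show "isomorphism \<L> (\<lambda>x. x) A (div_structure (univ A) \<delta>)"
        unfolding isomorphism_def using embedding_iff[OF _ represents_div_structure[of \<delta> "univ A", OF 0], of A \<delta>] by simp
    qed
  qed
  then show ?thesis unfolding L1_structure_def by blast
qed

text \<open>
  A canonical set function represented by a structure. The symbol \<open>Delta k\<close> applies to tuples of length
  \<open>k\<close>, so the set has to be enumerated without repetition.
\<close>

definition div_of :: "('a, div_symbol) rel_struct \<Rightarrow> 'a set \<Rightarrow> real" where
  "div_of A F = (if F = {} then 0 else interp A (Delta (card F)) (SOME xs. distinct xs \<and> set xs = F))"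

lemma div_of_unique:
  assumes "represents A \<delta>" "F \<in> Fpow (univ A)"
  shows "div_of A F = \<delta> F"
proof (cases "F = {}")
  case False
  have "\<exists>xs. distinct xs \<and> set xs = F" using assms(2) finite_distinct_list by (auto simp: Fpow_def)
  from someI_ex[OF this] obtain xs where xs: "(SOME xs. distinct xs \<and> set xs = F) = xs" "distinct xs" "set xs = F"
    by blast
  then have "card F = length xs" using distinct_card by fastforce
  moreover have "xs \<noteq> []" "set xs \<subseteq> univ A" using False xs(3) assms(2) by (auto simp: Fpow_def)
  ultimately show ?thesis using False assms(1) xs by (simp add: div_of_def represents_def)
qed (use assms in \<open>simp add: div_of_def represents_def\<close>)

lemma represents_cong:
  assumes "\<And>F. F \<in> Fpow (univ A) \<Longrightarrow> \<delta> F = \<delta>' F"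
  shows "represents A \<delta> \<longleftrightarrow> represents A \<delta>'"
  using assms unfolding represents_def by (auto simp: Fpow_def)

lemma L1_diversity_cong:
  assumes "\<And>F. F \<in> Fpow X \<Longrightarrow> \<delta> F = \<delta>' F"
  shows "L1_diversity X \<delta> \<longleftrightarrow> L1_diversity X \<delta>'"
proof -
  have "A \<union> B \<in> Fpow X" if "A \<in> Fpow X" "B \<in> Fpow X" for A B using that by (auto simp: Fpow_def)
  then have "diversity X \<delta> \<longleftrightarrow> diversity X \<delta>'" using assms unfolding diversity_def by simp
  moreover have "L1_embedding \<phi> X \<delta> M \<longleftrightarrow> L1_embedding \<phi> X \<delta>' M" for \<phi> and M :: "('a \<Rightarrow> real) measure"
    using assms unfolding L1_embedding_def by auto
  ultimately show ?thesis unfolding L1_diversity_def by simp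
qed

lemma L1_structureD:
  assumes "L1_structure A"
  shows "L1_diversity (univ A) (div_of A)" "represents A (div_of A)"
proof -
  obtain \<delta> where \<delta>: "L1_diversity (univ A) \<delta>" "represents A \<delta>" using assms L1_structure_iff by blast
  have eq: "\<And>F. F \<in> Fpow (univ A) \<Longrightarrow> \<delta> F = div_of A F" using div_of_unique[OF \<delta>(2)] by simp
  show "L1_diversity (univ A) (div_of A)" using L1_diversity_cong[of "univ A" \<delta> "div_of A"] eq \<delta>(1) by blast
  show "represents A (div_of A)" using represents_cong[of A \<delta> "div_of A"] eq \<delta>(2) by blast
qed

lemma L1_diversity_image:
  assumes "L1_diversity X \<delta>" "inj_on f Y" "f ` Y \<subseteq> X"
  shows "L1_diversity Y (\<lambda>F. \<delta> (f ` F))"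
proof -
  obtain M :: "('a \<Rightarrow> real) measure" and \<phi> where "diversity X \<delta>" and \<phi>: "L1_embedding \<phi> X \<delta> M"
    using assms(1) unfolding L1_diversity_def by blast
  have "L1_embedding (\<phi> \<circ> f) Y (\<lambda>F. \<delta> (f ` F)) M"
    unfolding L1_embedding_def
  proof (intro conjI ballI)
    show "integrable M ((\<phi> \<circ> f) y)" if "y \<in> Y" for y
      using \<phi> that assms(3) by (auto simp: L1_embedding_def)
    show "L1_div M ((\<phi> \<circ> f) ` F) = \<delta> (f ` F)" if "F \<in> Fpow Y" for F
    proof -
      have "f ` F \<in> Fpow X" using that assms(3) by (auto simp: Fpow_def)
      then have "L1_div M (\<phi> ` f ` F) = \<delta> (f ` F)" using \<phi> by (simp add: L1_embedding_def)
      then show ?thesis by (simp add: image_comp)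
    qed
  qed
  with diversity_image[OF \<open>diversity X \<delta>\<close> assms(2,3)] show ?thesis by (rule L1_diversityI)
qed

text \<open>
  The representing functions are composed with the embedding.
\<close>

lemma L1_structure_pullback:
  assumes B: "L1_structure B" and f: "embedding \<L> f A B" "inj_on f (univ A)"
  shows "L1_structure A"
proof -
  let ?\<delta> = "\<lambda>F. div_of B (f ` F)"
  have sub: "f ` univ A \<subseteq> univ B" using f(1) by (simp add: embedding_def)
  have eq: "interp B R (map f xs) = interp A R xs"
    if "R \<in> symbols \<L>" "xs \<in> tuples A (arity \<L> R)" for R xs
    using f(1) that by (simp add: embedding_def)
  note repB = L1_structureD(2)[OF B]
  have "represents A ?\<delta>"
    unfolding represents_def
  proof (intro conjI ballI allI impI)
    show "div_of B (f ` {}) = 0" by (simp add: div_of_def)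
    show "interp A Dist [x, y] = div_of B (f ` {x, y})" if "x \<in> univ A" "y \<in> univ A" for x y
    proof -
      have "interp B Dist [f x, f y] = interp A Dist [x, y]"
        using eq[of Dist "[x, y]"] that by (simp add: div_language_def tuples_def)
      then show ?thesis using repB sub that by (simp add: represents_def image_subset_iff)
    qed
    show "interp A (Delta (length xs)) xs = div_of B (f ` set xs)" if "xs \<noteq> [] \<and> set xs \<subseteq> univ A" for xs
    proof -
      have "interp B (Delta (length xs)) (map f xs) = interp A (Delta (length xs)) xs"
        using eq[of "Delta (length xs)" xs] that by (cases xs) (auto simp: div_language_def tuples_def)
      moreover have "map f xs \<noteq> []" "set (map f xs) \<subseteq> univ B" using that sub by auto
      then have "interp B (Delta (length (map f xs))) (map f xs) = div_of B (set (map f xs))"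
        using repB unfolding represents_def by blast
      ultimately show ?thesis by simp
    qed
  qed
  then show ?thesis
    unfolding L1_structure_iff using L1_diversity_image[OF L1_structureD(1)[OF B] f(2) sub] by blast
qed

lemma sdist_eq:
  "represents A \<delta> \<Longrightarrow> x \<in> univ A \<Longrightarrow> y \<in> univ A \<Longrightarrow> sdist \<L> A x y = \<delta> {x, y}"
  by (simp add: represents_def sdist_def div_language_def)

lemma sdist_Metric_space:
  assumes rep: "represents A \<delta>" and div: "diversity (univ A) \<delta>"
  shows "Metric_space (univ A) (sdist \<L> A)"
proof
  have eq: "sdist \<L> A x y = (if x \<in> univ A \<and> y \<in> univ A then \<delta> {x, y} else 0)" for x y
    using rep by (auto simp: represents_def sdist_def div_language_def)
  show "0 \<le> sdist \<L> A x y" for x y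
    using diversity_nonneg[OF div, of "{x, y}"] by (simp add: eq)
  show "sdist \<L> A x y = sdist \<L> A y x" for x y
    by (simp add: eq insert_commute)
  show "sdist \<L> A x y = 0 \<longleftrightarrow> x = y" if "x \<in> univ A" "y \<in> univ A" for x y
    using diversity_pair_eq_0[OF div that] that by (simp add: eq)
  show "sdist \<L> A x z \<le> sdist \<L> A x y + sdist \<L> A y z"
    if "x \<in> univ A" "y \<in> univ A" "z \<in> univ A" for x y z
    using diversity_triangle[OF div that] that by (simp add: eq)
qed

lemma complete_structure_iff:
  assumes rep: "represents A \<delta>" and div: "diversity (univ A) \<delta>"
  shows "complete_structure \<L> A \<longleftrightarrow> complete_div (univ A) \<delta>"
proof -
  interpret Metric_space "univ A" "sdist \<L> A" by (rule sdist_Metric_space[OF rep div])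
  have eq: "sdist \<L> A x y = \<delta> {x, y}" if "x \<in> univ A" "y \<in> univ A" for x y
    using sdist_eq[OF rep] that .
  have "MCauchy \<sigma> \<longleftrightarrow> range \<sigma> \<subseteq> univ A \<and> (\<forall>\<epsilon>>0. \<exists>N. \<forall>m\<ge>N. \<forall>n\<ge>N. \<delta> {\<sigma> m, \<sigma> n} < \<epsilon>)" for \<sigma>
    unfolding MCauchy_def by (auto simp: eq range_subsetD)
  moreover have "limitin mtopology \<sigma> x sequentially \<longleftrightarrow> x \<in> univ A \<and> (\<forall>\<epsilon>>0. \<exists>N. \<forall>n\<ge>N. \<delta> {\<sigma> n, x} < \<epsilon>)"
    if "range \<sigma> \<subseteq> univ A" for \<sigma> x
    unfolding limit_metric_sequentially using that by (auto simp: eq range_subsetD)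
  ultimately show ?thesis
    unfolding complete_structure_def mcomplete_def complete_div_def by (smt (verit, best))
qed

lemma separable_structure_iff:
  assumes rep: "represents A \<delta>" and div: "diversity (univ A) \<delta>"
  shows "separable_structure \<L> A \<longleftrightarrow> separable_div (univ A) \<delta>"
proof -
  interpret Metric_space "univ A" "sdist \<L> A" by (rule sdist_Metric_space[OF rep div])
  have "mtopology closure_of D = univ A \<longleftrightarrow> (\<forall>x\<in>univ A. \<forall>\<epsilon>>0. \<exists>y\<in>D. \<delta> {y, x} < \<epsilon>)"
    if D: "D \<subseteq> univ A" for D
  proof -
    have "(\<exists>y\<in>D. y \<in> mball x r) \<longleftrightarrow> (\<exists>y\<in>D. \<delta> {y, x} < r)" if "x \<in> univ A" for x r
    proof -
      have "sdist \<L> A x y = \<delta> {y, x}" if "y \<in> D" for y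
        using sdist_eq[OF rep \<open>x \<in> univ A\<close>, of y] D that by (auto simp: insert_commute)
      then show ?thesis using D \<open>x \<in> univ A\<close> by (auto simp: in_mball subset_iff)
    qed
    then show ?thesis unfolding metric_closure_of by blast
  qed
  then show ?thesis
    unfolding separable_structure_def separable_space_def separable_div_def by auto
qed

text \<open>
  The minimum also runs over \<open>1\<close>, so that it exists if there is at most one point.
\<close>

lemma finite_metric_gap:
  assumes "Metric_space X d" "finite X"
  obtains \<eta> where "0 < \<eta>" "\<And>x y. x \<in> X \<Longrightarrow> y \<in> X \<Longrightarrow> d x y < \<eta> \<Longrightarrow> x = y"
proof -
  interpret Metric_space X d by fact
  define P where "P = insert 1 ((\<lambda>(x, y). d x y) ` {(x, y) \<in> X \<times> X. x \<noteq> y})"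
  have fin: "finite P" unfolding P_def using assms(2)
    by (intro finite.insertI finite_imageI) (rule finite_subset[of _ "X \<times> X"], auto)
  have "0 < Min P" using fin by (subst Min_gr_iff) (auto simp: P_def mdist_pos_eq)
  moreover have "x = y" if "x \<in> X" "y \<in> X" "d x y < Min P" for x y
  proof (rule ccontr)
    assume "x \<noteq> y"
    then have "d x y \<in> P" using that by (auto simp: P_def)
    then have "Min P \<le> d x y" using fin by (rule Min_le[rotated])
    then show False using that(3) by simp
  qed
  ultimately show ?thesis using that by blast
qed

lemma finite_L_structure:
  assumes fin: "finite (univ A)" and met: "Metric_space (univ A) (sdist L A)"
  shows "L_structure L A"
proof -
  interpret Metric_space "univ A" "sdist L A" by fact
  obtain \<eta> where \<eta>: "0 < \<eta>" "\<And>x y. x \<in> univ A \<Longrightarrow> y \<in> univ A \<Longrightarrow> sdist L A x y < \<eta> \<Longrightarrow> x = y"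
    using finite_metric_gap[OF met fin] by blast
  have "mcomplete"
    unfolding mcomplete_def
  proof (intro allI impI)
    fix \<sigma> assume c: "MCauchy \<sigma>"
    then obtain N where N: "\<And>n n'. N \<le> n \<Longrightarrow> N \<le> n' \<Longrightarrow> sdist L A (\<sigma> n) (\<sigma> n') < \<eta>"
      unfolding MCauchy_def using \<eta>(1) by blast
    have in_univ: "\<sigma> n \<in> univ A" for n using c by (auto simp: MCauchy_def)
    have const: "sdist L A (\<sigma> n) (\<sigma> N) = 0" if "N \<le> n" for n
    proof -
      have "\<sigma> n = \<sigma> N" using N[OF that order_refl] \<eta>(2) in_univ by blast
      then show ?thesis using zero[OF in_univ in_univ] by blast
    qed
    have "limitin mtopology \<sigma> (\<sigma> N) sequentially"
      unfolding limit_metric_sequentially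
      by (intro conjI allI impI exI[of _ N] in_univ) (simp add: const)
    then show "\<exists>x. limitin mtopology \<sigma> x sequentially" ..
  qed
  moreover have "xs = ys" if "xs \<in> tuples A k" "ys \<in> tuples A k" "\<forall>i<k. sdist L A (xs ! i) (ys ! i) < \<eta>" for xs ys k
    using that \<eta>(2) by (intro nth_equalityI) (auto simp: tuples_def subset_iff)
  ultimately have "\<bar>interp A R xs - interp A R ys\<bar> < e"
    if "0 < e" "xs \<in> tuples A (arity L R)" "ys \<in> tuples A (arity L R)"
      "\<forall>i<arity L R. sdist L A (xs ! i) (ys ! i) < \<eta>" for e R xs ys
    using that by (metis abs_zero diff_self)
  with \<open>mcomplete\<close> show ?thesis
    unfolding L_structure_def complete_structure_def using met \<eta>(1) by blast
qed

text \<open>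
  Each predicate is Lipschitz continuous: moving the \<open>k\<close> points of a set changes its diversity by at most
  the sum of the distances.
\<close>

lemma represents_L_structure:
  assumes rep: "represents A \<delta>" and div: "diversity (univ A) \<delta>" and comp: "complete_div (univ A) \<delta>"
  shows "L_structure \<L> A"
proof -
  have "\<exists>\<eta>>0. \<forall>xs\<in>tuples A (arity \<L> R). \<forall>ys\<in>tuples A (arity \<L> R).
    (\<forall>i<arity \<L> R. sdist \<L> A (xs ! i) (ys ! i) < \<eta>) \<longrightarrow>
    \<bar>interp A R xs - interp A R ys\<bar> < e" if R: "R \<in> symbols \<L>" and "0 < e" for R e
  proof -
    define k where "k = arity \<L> R"
    have int: "interp A R xs = \<delta> ((!) xs ` {..<k})" if "xs \<in> tuples A k" for xs
    proof -
      have xs: "set xs \<subseteq> univ A" "length xs = k" using that by (auto simp: tuples_def)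
      have img: "(!) xs ` {..<k} = set xs" using xs by (auto simp: set_conv_nth)
      show ?thesis
      proof (cases R)
        case Dist
        then obtain x y where "xs = [x, y]"
          using xs by (auto simp: k_def div_language_def length_Suc_conv numeral_2_eq_2)
        then show ?thesis using rep xs img Dist by (simp add: represents_def)
      next
        case (Delta j)
        then have "xs \<noteq> []" "length xs = j" using R xs by (auto simp: k_def div_language_def)
        then show ?thesis using represents_Delta[OF rep] xs img Delta by simp
      qed
    qed
    define \<eta> where "\<eta> = e / (real k + 1)"
    have \<eta>: "0 < \<eta>" using \<open>0 < e\<close> by (simp add: \<eta>_def)
    have "\<bar>interp A R xs - interp A R ys\<bar> < e"
      if xs: "xs \<in> tuples A k" and ys: "ys \<in> tuples A k" and near: "\<forall>i<k. sdist \<L> A (xs ! i) (ys ! i) < \<eta>" for xs ys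
    proof -
      have in_univ: "xs ! i \<in> univ A" "ys ! i \<in> univ A" if "i < k" for i
        using xs ys that by (auto simp: tuples_def subset_iff)
      have "\<bar>\<delta> ((!) xs ` {..<k}) - \<delta> ((!) ys ` {..<k})\<bar> \<le> (\<Sum>i<k. \<delta> {xs ! i, ys ! i})"
        using in_univ by (intro diversity_move_points[OF div]) auto
      also have "\<dots> \<le> (\<Sum>i<k. \<eta>)"
        using near sdist_eq[OF rep] in_univ by (intro sum_mono) (auto intro: less_imp_le)
      also have "\<dots> < e" using \<open>0 < e\<close> by (simp add: \<eta>_def field_simps)
      finally show ?thesis using int xs ys by simp
    qed
    then show ?thesis using \<eta> unfolding k_def by blast
  qed
  then show ?thesis
    unfolding L_structure_def
    using sdist_Metric_space[OF rep div] complete_structure_iff[OF rep div] comp by blast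
qed

lemma finite_L1_diversities_iff: "A \<in> \<K> \<longleftrightarrow> finite (univ A) \<and> L1_structure A"
  by (simp add: finite_L1_diversities_def)

lemma finite_L1_L_structure: "finite (univ A) \<Longrightarrow> L1_structure A \<Longrightarrow> L_structure \<L> A"
  using L1_structureD[of A]
  by (intro finite_L_structure sdist_Metric_space[of A "div_of A"]) (auto simp: L1_diversity_def)

lemma embedding_inj_on:
  assumes met: "Metric_space (univ B) (sdist \<L> B)" and A: "L1_structure A"
    and f: "embedding \<L> f B A"
  shows "inj_on f (univ B)"
proof (rule inj_onI)
  fix x y assume xy: "x \<in> univ B" "y \<in> univ B" "f x = f y"
  have "interp A Dist (map f [x, y]) = interp B Dist [x, y]"
    by (rule f[unfolded embedding_def, THEN conjunct2, rule_format]) (use xy in \<open>auto simp: div_language_def tuples_def\<close>)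
  then have "sdist \<L> B x y = interp A Dist [f x, f y]"
    using xy by (simp add: sdist_def div_language_def)
  also have "f x \<in> univ A" using f xy by (auto simp: embedding_def)
  then have "interp A Dist [f x, f y] = 0"
    using represents_Dist[OF L1_structureD(2)[OF A], of "f x" "f y"] L1_structureD(1)[OF A] xy(3)
      diversity_singleton[of "univ A" "div_of A" "f x"] by (simp add: L1_diversity_def)
  finally show "x = y" using Metric_space.zero[OF met xy(1,2)] by simp
qed

lemma L1_K_structure:
  assumes "L_structure \<L> A" "L1_structure A"
  shows "K_structure \<L> \<K> A"
proof -
  have "B \<in> \<K>"
    if "L_structure \<L> B" "finite (univ B)" "substructure \<L> B A" for B :: "(nat, div_symbol) rel_struct"
    using that assms(2) embedding_inj_on[of B A] L1_structure_pullback[of A _ B]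
    unfolding finite_L1_diversities_iff substructure_def L_structure_def by blast
  then show ?thesis using assms(1) by (simp add: K_structure_def)
qed

text \<open>
  The class consists of structures on natural numbers, so a finite part of \<open>A\<close> is copied there, and the
  properties of the copy are pulled back.
\<close>

lemma K_structure_finite_induced:
  assumes K: "K_structure \<L> \<K> A" and S: "finite S" "S \<subseteq> univ A"
  shows "L1_structure (induced A S)"
proof -
  obtain e :: "'a \<Rightarrow> nat" where e: "inj_on e S" using S(1) finite_imp_inj_to_nat_seg by blast
  define d where "d = inv_into S e"
  have de: "d (e x) = x" if "x \<in> S" for x using e that by (simp add: d_def)
  have ed: "e (d k) = k" "d k \<in> S" if "k \<in> e ` S" for k
    using that by (auto simp: d_def f_inv_into_f inv_into_into)
  define B :: "(nat, div_symbol) rel_struct" where "B = \<lparr>univ = e ` S, interp = \<lambda>R xs. interp A R (map d xs)\<rparr>"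
  have metA: "Metric_space (univ A) (sdist \<L> A)" using K by (simp add: K_structure_def L_structure_def)
  interpret Metric_space "univ A" "sdist \<L> A" by (rule metA)
  have sd: "sdist \<L> B j k = (if j \<in> e ` S \<and> k \<in> e ` S then sdist \<L> A (d j) (d k) else 0)" for j k
    using ed S(2) by (auto simp: sdist_def B_def)
  have metB: "Metric_space (univ B) (sdist \<L> B)"
  proof
    show "sdist \<L> B j k = 0 \<longleftrightarrow> j = k" if "j \<in> univ B" "k \<in> univ B" for j k
    proof -
      have jk: "j \<in> e ` S" "k \<in> e ` S" using that by (auto simp: B_def)
      then have "d j \<in> univ A" "d k \<in> univ A" using ed S(2) by blast+
      then have "sdist \<L> B j k = 0 \<longleftrightarrow> d j = d k" using jk zero by (simp add: sd)
      also have "\<dots> \<longleftrightarrow> j = k" using jk ed by metis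
      finally show ?thesis .
    qed
    show "sdist \<L> B i k \<le> sdist \<L> B i j + sdist \<L> B j k"
      if "i \<in> univ B" "j \<in> univ B" "k \<in> univ B" for i j k
    proof -
      have "i \<in> e ` S" "j \<in> e ` S" "k \<in> e ` S" using that by (auto simp: B_def)
      moreover then have "d i \<in> univ A" "d j \<in> univ A" "d k \<in> univ A" using ed S(2) by blast+
      ultimately show ?thesis using triangle by (simp add: sd)
    qed
  qed (auto simp: sd commute)
  have "embedding \<L> d B A"
    using ed S(2) unfolding embedding_def by (auto simp: B_def)
  then have "B \<in> \<K>"
    using K finite_L_structure[OF _ metB] S(1) unfolding K_structure_def substructure_def by (auto simp: B_def)
  moreover have "embedding \<L> e (induced A S) B"
    unfolding embedding_def
  proof (intro conjI ballI)
    fix R xs assume "xs \<in> tuples (induced A S) (arity \<L> R)"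
    then have "map d (map e xs) = xs" using de by (auto simp: tuples_def intro!: map_idI)
    then show "interp B R (map e xs) = interp (induced A S) R xs" by (simp add: B_def induced_def)
  qed (simp add: B_def)
  ultimately show ?thesis
    using L1_structure_pullback[of B e "induced A S"] e by (simp add: finite_L1_diversities_iff)
qed

lemma div_of_induced: "div_of (induced A S) = div_of A"
  by (intro ext) (simp add: div_of_def induced_def)

text \<open>
  All defining conditions of \<open>represents\<close> and of \<open>cut_diversity\<close> concern finitely many points at a time.
\<close>

lemma K_structureD:
  assumes K: "K_structure \<L> \<K> A"
  shows "represents A (div_of A)" "cut_diversity (univ A) (div_of A)"
proof -
  have loc: "L1_diversity S (div_of A)" "represents (induced A S) (div_of A)" if "S \<in> Fpow (univ A)" for S
    using L1_structureD[OF K_structure_finite_induced[OF K, of S]] that by (auto simp: Fpow_def div_of_induced)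
  show "represents A (div_of A)"
    unfolding represents_def
  proof (intro conjI ballI allI impI)
    show "div_of A {} = 0" by (simp add: div_of_def)
    show "interp A Dist [x, y] = div_of A {x, y}" if "x \<in> univ A" "y \<in> univ A" for x y
      using loc(2)[of "{x, y}"] that by (simp add: represents_def Fpow_def induced_def)
    show "interp A (Delta (length xs)) xs = div_of A (set xs)" if "xs \<noteq> [] \<and> set xs \<subseteq> univ A" for xs
      using loc(2)[of "set xs"] that by (simp add: represents_def Fpow_def induced_def)
  qed
  have div: "diversity S (div_of A)" if "S \<in> Fpow (univ A)" for S
    using loc(1)[OF that] by (simp add: L1_diversity_def)
  have "diversity (univ A) (div_of A)"
    unfolding diversity_def
  proof (intro conjI ballI impI)
    fix F assume F: "F \<in> Fpow (univ A)"
    show "0 \<le> div_of A F" using diversity_nonneg[OF div[OF F], of F] F by (simp add: Fpow_def)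
    show "div_of A F = 0 \<longleftrightarrow> card F \<le> 1" using diversity_eq_0[OF div[OF F], of F] F by (simp add: Fpow_def)
  next
    fix F G H assume *: "F \<in> Fpow (univ A)" "G \<in> Fpow (univ A)" "H \<in> Fpow (univ A)" "G \<noteq> {}"
    then have "F \<union> G \<union> H \<in> Fpow (univ A)" by (auto simp: Fpow_def)
    from diversity_through[OF div[OF this]] show "div_of A (F \<union> H) \<le> div_of A (F \<union> G) + div_of A (G \<union> H)"
      using * by (auto simp: Fpow_def)
  qed
  moreover have "cut_rep S (div_of A)" if "S \<in> Fpow (univ A)" for S
  proof -
    have "S \<in> Fpow S" using that by (simp add: Fpow_def)
    then show ?thesis
      using L1_diversity_imp_cut_diversity[OF loc(1)[OF that]] by (auto simp: cut_diversity_def)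
  qed
  ultimately show "cut_diversity (univ A) (div_of A)" by (simp add: cut_diversity_def)
qed

lemma L1_structure_cut_diversity: "L1_structure A \<Longrightarrow> cut_diversity (univ A) (div_of A)"
  using L1_structureD(1) L1_diversity_imp_cut_diversity by blast

lemma L1_structure_diversity: "L1_structure A \<Longrightarrow> diversity (univ A) (div_of A)"
  using L1_structure_cut_diversity cut_diversityD by blast

section \<open>Amalgamation\<close>

lemma finite_copy:
  fixes S :: "'a set"
  assumes L1: "L1_diversity X \<delta>" and S: "finite S" "S \<subseteq> X"
  obtains B :: "(nat, div_symbol) rel_struct" and e where "B \<in> \<K>" "inj_on e S" "univ B = e ` S"
    "\<And>F. F \<subseteq> S \<Longrightarrow> div_of B (e ` F) = \<delta> F"
proof -
  obtain e :: "'a \<Rightarrow> nat" where e: "inj_on e S" using S(1) finite_imp_inj_to_nat_seg by blast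
  define d where "d = inv_into S e"
  define B :: "(nat, div_symbol) rel_struct" where "B = div_structure (e ` S) (\<lambda>F. \<delta> (d ` F))"
  have de: "d ` e ` F = F" if "F \<subseteq> S" for F
    using that e unfolding d_def by (rule inv_into_image_cancel[rotated])
  have "inj_on d (e ` S)" unfolding d_def by (rule inj_on_inv_into) simp
  then have L1B: "L1_diversity (e ` S) (\<lambda>F. \<delta> (d ` F))"
    using de[of S] S(2) by (intro L1_diversity_image[OF L1]) auto
  have "represents B (\<lambda>F. \<delta> (d ` F))"
    unfolding B_def using L1 diversity_empty by (intro represents_div_structure) (auto simp: L1_diversity_def)
  note rep = this
  have "B \<in> \<K>"
    unfolding finite_L1_diversities_iff L1_structure_iff using L1B rep S(1) by (auto simp: B_def)
  moreover have "div_of B (e ` F) = \<delta> F" if "F \<subseteq> S" for F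
    using div_of_unique[OF rep, of "e ` F"] de[OF that] that S(1) by (auto simp: B_def Fpow_def intro: finite_subset)
  ultimately show ?thesis using that e by (simp add: B_def)
qed

lemma L1_embedding_iff:
  assumes "L1_structure A" "L1_structure B" "S \<subseteq> univ A"
  shows "embedding \<L> f (induced A S) B \<longleftrightarrow>
    f ` S \<subseteq> univ B \<and> (\<forall>F\<in>Fpow S. div_of B (f ` F) = div_of A F)"
  using embedding_iff[OF represents_induced[OF L1_structureD(2)[OF assms(1)] assms(3)] L1_structureD(2)[OF assms(2)], of f]
  by simp

lemma induced_univ: "induced A (univ A) = A"
  by (simp add: induced_def)

lemma embeddingI:
  assumes "L1_structure A" "L1_structure B" "f ` univ A \<subseteq> univ B"
    "\<And>F. F \<subseteq> univ A \<Longrightarrow> finite F \<Longrightarrow> div_of B (f ` F) = div_of A F"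
  shows "embedding \<L> f A B"
  using L1_embedding_iff[OF assms(1,2) order_refl, of f] assms(3,4) by (auto simp: induced_univ Fpow_def)

lemma embeddingD:
  assumes "L1_structure A" "L1_structure B" "embedding \<L> f A B"
  shows "f ` univ A \<subseteq> univ B" "\<And>F. F \<subseteq> univ A \<Longrightarrow> finite F \<Longrightarrow> div_of B (f ` F) = div_of A F"
  using L1_embedding_iff[OF assms(1,2) order_refl, of f] assms(3) by (auto simp: induced_univ Fpow_def)

text \<open>
  The predicates on all tuples of entries amount to the set function on all sets of indices.
\<close>

lemma same_values_iff:
  assumes A: "L1_structure A" "set as \<subseteq> univ A" and B: "L1_structure B" "set bs \<subseteq> univ B"
  shows "same_values \<L> (A, as) (B, bs) \<longleftrightarrow> length as = length bs \<and>
    (\<forall>F\<subseteq>{..<length as}. div_of A ((!) as ` F) = div_of B ((!) bs ` F))"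
proof (cases "length as = length bs")
  case len: True
  have sub: "(!) as ` F \<subseteq> univ A" "(!) bs ` F \<subseteq> univ B" if "F \<subseteq> {..<length as}" for F
    using that A(2) B(2) len by (auto simp: subset_iff)
  show ?thesis
  proof
    assume same: "same_values \<L> (A, as) (B, bs)"
    have "div_of A ((!) as ` F) = div_of B ((!) bs ` F)" if F: "F \<subseteq> {..<length as}" for F
    proof (cases "F = {}")
      case False
      obtain js where js: "set js = F" using F finite_list finite_subset by (metis finite_lessThan)
      then have ne: "js \<noteq> []" using False by auto
      have "Delta (length js) \<in> symbols \<L>"
        using ne by (cases js) (auto simp: div_language_def)
      then have "interp A (Delta (length js)) (map ((!) as) js) = interp B (Delta (length js)) (map ((!) bs) js)"
        using same js F by (auto simp: same_values_def div_language_def)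
      moreover have "interp A (Delta (length js)) (map ((!) as) js) = div_of A (set (map ((!) as) js))"
        using sub(1)[OF F] js ne by (intro represents_Delta[OF L1_structureD(2)[OF A(1)]]) auto
      moreover have "interp B (Delta (length js)) (map ((!) bs) js) = div_of B (set (map ((!) bs) js))"
        using sub(2)[OF F] js ne by (intro represents_Delta[OF L1_structureD(2)[OF B(1)]]) auto
      ultimately show ?thesis using js by simp
    qed (simp add: div_of_def)
    then show "length as = length bs \<and> (\<forall>F\<subseteq>{..<length as}. div_of A ((!) as ` F) = div_of B ((!) bs ` F))"
      using len by blast
  next
    assume "length as = length bs \<and> (\<forall>F\<subseteq>{..<length as}. div_of A ((!) as ` F) = div_of B ((!) bs ` F))"
    then have same: "div_of A ((!) as ` F) = div_of B ((!) bs ` F)" if "F \<subseteq> {..<length as}" for F using that by blast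
    have "interp A R (map ((!) as) js) = interp B R (map ((!) bs) js)"
      if R: "R \<in> symbols \<L>" and js: "length js = arity \<L> R" "set js \<subseteq> {..<length as}" for R js
    proof (cases R)
      case Dist
      then obtain i j where ij: "js = [i, j]"
        using js by (auto simp: div_language_def length_Suc_conv numeral_2_eq_2)
      then show ?thesis
        using Dist js len A B same[of "{i, j}"] represents_Dist[OF L1_structureD(2)[OF A(1)]]
          represents_Dist[OF L1_structureD(2)[OF B(1)]] by (simp add: subset_iff)
    next
      case (Delta k)
      then have ne: "js \<noteq> []" "length js = k" using R js by (auto simp: div_language_def)
      have "interp A (Delta k) (map ((!) as) js) = div_of A (set (map ((!) as) js))"
        using sub(1)[OF js(2)] ne by (intro represents_Delta[OF L1_structureD(2)[OF A(1)]]) auto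
      moreover have "interp B (Delta k) (map ((!) bs) js) = div_of B (set (map ((!) bs) js))"
        using sub(2)[OF js(2)] ne by (intro represents_Delta[OF L1_structureD(2)[OF B(1)]]) auto
      ultimately show ?thesis using same[OF js(2)] Delta by simp
    qed
    then show "same_values \<L> (A, as) (B, bs)" using len by (simp add: same_values_def)
  qed
qed (simp add: same_values_def)

text \<open>
  The values on a set \<open>F\<close> of indices are those of the predicate of arity \<open>card F\<close> on the subtuple
  indexed by \<open>F\<close>.
\<close>

lemma d_inf_bound:
  assumes A: "L1_structure A" "set as \<subseteq> univ A" "length as = n" and B: "L1_structure B" "set bs \<subseteq> univ B" "length bs = n"
    and F: "F \<subseteq> {..<n}"
  shows "\<bar>div_of A ((!) as ` F) - div_of B ((!) bs ` F)\<bar> \<le> d_inf \<L> (A, as) (B, bs)"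
proof -
  define V where "V = {\<bar>interp A R (nths as X) - interp B R (nths bs X)\<bar> | X R.
       X \<subseteq> {..<length as} \<and> R \<in> symbols \<L> \<and> arity \<L> R = card X}"
  have dinf: "d_inf \<L> (A, as) (B, bs) = Max (insert 0 V)" by (simp add: d_inf_def V_def)
  have "V \<subseteq> (\<lambda>(X, R). \<bar>interp A R (nths as X) - interp B R (nths bs X)\<bar>) ` (Pow {..<n} \<times> insert Dist (Delta ` {..n}))"
  proof
    fix u assume "u \<in> V"
    then obtain X R where u: "u = \<bar>interp A R (nths as X) - interp B R (nths bs X)\<bar>" "X \<subseteq> {..<n}"
      "R \<in> symbols \<L>" "arity \<L> R = card X" unfolding V_def A(3) by blast
    have "card X \<le> n" using card_mono[OF _ u(2)] by simp
    then have "R \<in> insert Dist (Delta ` {..n})" using u(3,4) by (auto simp: div_language_def)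
    then show "u \<in> (\<lambda>(X, R). \<bar>interp A R (nths as X) - interp B R (nths bs X)\<bar>) ` (Pow {..<n} \<times> insert Dist (Delta ` {..n}))"
      using u(1,2) by (intro image_eqI[of _ _ "(X, R)"]) auto
  qed
  then have fin: "finite (insert 0 V)" by (auto intro: finite_subset)
  show ?thesis
  proof (cases "F = {}")
    case True
    then show ?thesis unfolding dinf using fin by (simp add: div_of_def)
  next
    case False
    have nths: "set (nths cs F) = (!) cs ` F" "length (nths cs F) = card F" if "length cs = n" for cs :: "'x list"
    proof -
      have "{i. i < n \<and> i \<in> F} = F" using F by auto
      then show "length (nths cs F) = card F" using that by (simp add: length_nths)
      show "set (nths cs F) = (!) cs ` F" using F that by (auto simp: set_nths)
    qed
    have pos: "0 < card F" using False finite_subset[OF F] by (simp add: card_gt_0_iff)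
    have "nths as F \<noteq> []" "nths bs F \<noteq> []" using nths(2)[OF A(3)] nths(2)[OF B(3)] pos by auto
    moreover have "set (nths as F) \<subseteq> univ A" "set (nths bs F) \<subseteq> univ B"
      using A(2) B(2) set_nths_subset by (metis order_trans)+
    ultimately have "interp A (Delta (card F)) (nths as F) = div_of A ((!) as ` F)"
      "interp B (Delta (card F)) (nths bs F) = div_of B ((!) bs ` F)"
      using represents_Delta[OF L1_structureD(2)[OF A(1)] _ _ nths(2)[OF A(3)]]
        represents_Delta[OF L1_structureD(2)[OF B(1)] _ _ nths(2)[OF B(3)]] nths(1)[OF A(3)] nths(1)[OF B(3)] by simp_all
    moreover have "\<bar>interp A (Delta (card F)) (nths as F) - interp B (Delta (card F)) (nths bs F)\<bar> \<in> V"
      unfolding V_def using F A(3) pos by (auto simp: div_language_def intro!: exI[of _ F] exI[of _ "Delta (card F)"])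
    ultimately show ?thesis unfolding dinf using fin by (intro Max_ge) auto
  qed
qed

lemma nth_image_eq_set: "length cs = n \<Longrightarrow> (!) cs ` {..<n} = set cs"
  by (auto simp: set_conv_nth)

lemma enumeratedD:
  assumes "(A, as) \<in> enumerated \<K> n"
  shows "A \<in> \<K>" "L1_structure A" "finite (univ A)" "set as \<subseteq> univ A" "length as = n"
  using assms by (auto simp: enumerated_def tuples_def finite_L1_diversities_iff)

text \<open>
  The properties of the measure algebra from which everything else is deduced.
\<close>

locale universal_space =
  fixes X :: "real set" and \<delta>
  assumes L1: "L1_diversity X \<delta>" and separable: "separable_div X \<delta>" and complete: "complete_div X \<delta>"
    and quantitative: "\<And>n. \<exists>c. extends_within X \<delta> n c" and nonempty: "X \<noteq> {}"
begin

lemma cut_div: "cut_diversity X \<delta>"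
  using L1 by (rule L1_diversity_imp_cut_diversity)

lemma div: "diversity X \<delta>"
  using cut_div by (rule cut_diversityD)

lemma extension: "extension_property X \<delta>"
  using quantitative nonempty by (rule extension_property_if_quantitative)

lemma embed_finite:
  assumes "cut_diversity Y \<epsilon>" "finite T" "T \<subseteq> Y"
  obtains g where "g ` T \<subseteq> X" "\<And>G. G \<subseteq> T \<Longrightarrow> \<delta> (g ` G) = \<epsilon> G"
  using extend_finite_map[OF assms(1) extension div assms(2) _ assms(3), of "{}" "\<lambda>_. undefined"]
    diversity_empty[OF div] diversity_empty[OF cut_diversityD[OF assms(1)]] by auto

text \<open>
  Embed \<open>B\<close> into the space. This embeds the image of \<open>A\<close> in \<open>C\<close> as well, and that embedding is extended to
  \<open>C\<close>. The amalgam consists of the points of both images.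
\<close>

lemma AP: "AP \<L> \<K>"
  unfolding AP_def
proof (intro ballI allI impI)
  fix A B C :: "(nat, div_symbol) rel_struct" and fB fC
  assume "A \<in> \<K>" "B \<in> \<K>" "C \<in> \<K>"
    and emb: "embedding \<L> fB A B \<and> embedding \<L> fC A C"
  then have A: "L1_structure A" "finite (univ A)" and B: "L1_structure B" "finite (univ B)"
    and C: "L1_structure C" "finite (univ C)" by (auto simp: finite_L1_diversities_iff)
  have fB: "fB ` univ A \<subseteq> univ B" "\<And>F. F \<subseteq> univ A \<Longrightarrow> finite F \<Longrightarrow> div_of B (fB ` F) = div_of A F"
    using embeddingD[OF A(1) B(1)] emb by auto
  have fC: "fC ` univ A \<subseteq> univ C" "\<And>F. F \<subseteq> univ A \<Longrightarrow> finite F \<Longrightarrow> div_of C (fC ` F) = div_of A F"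
    using embeddingD[OF A(1) C(1)] emb by auto
  have inj: "inj_on fC (univ A)"
    using emb embedding_inj_on[OF sdist_Metric_space[OF L1_structureD(2)[OF A(1)] L1_structure_diversity[OF A(1)]] C(1)] by blast
  obtain g where g: "g ` univ B \<subseteq> X" "\<And>G. G \<subseteq> univ B \<Longrightarrow> \<delta> (g ` G) = div_of B G"
    using embed_finite[OF L1_structure_cut_diversity[OF B(1)] B(2) order_refl] by blast
  define h where "h = g \<circ> fB \<circ> inv_into (univ A) fC"
  have hfC: "h (fC x) = g (fB x)" if "x \<in> univ A" for x using that inj by (simp add: h_def)
  have h: "\<delta> (h ` G) = div_of C G" if G: "G \<subseteq> fC ` univ A" for G
  proof -
    obtain F where F: "F \<subseteq> univ A" "G = fC ` F" using G by (auto simp: subset_image_iff)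
    have finF: "finite F" using F(1) A(2) finite_subset by blast
    have "h ` G = g ` fB ` F" unfolding F(2) image_image using hfC F(1) by (intro image_cong) auto
    then have "\<delta> (h ` G) = div_of B (fB ` F)" using g(2)[of "fB ` F"] F(1) fB(1) by auto
    then show ?thesis using fB(2)[OF F(1) finF] fC(2)[OF F(1) finF] F(2) by simp
  qed
  obtain k where k: "k ` univ C \<subseteq> X" "\<And>G. G \<subseteq> univ C \<Longrightarrow> \<delta> (k ` G) = div_of C G"
    "\<And>t. t \<in> fC ` univ A \<Longrightarrow> k t = h t"
  proof (rule extend_finite_map[OF L1_structure_cut_diversity[OF C(1)] extension div C(2) fC(1) order_refl])
    show "h ` fC ` univ A \<subseteq> X" using hfC fB(1) g(1) by auto
  qed (use h in blast)+
  have "finite (g ` univ B \<union> k ` univ C)" "g ` univ B \<union> k ` univ C \<subseteq> X" using B(2) C(2) g(1) k(1) by auto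
  from finite_copy[OF L1 this] obtain D :: "(nat, div_symbol) rel_struct" and e where D: "D \<in> \<K>"
    "univ D = e ` (g ` univ B \<union> k ` univ C)" "\<And>F. F \<subseteq> g ` univ B \<union> k ` univ C \<Longrightarrow> div_of D (e ` F) = \<delta> F"
    by metis
  have LD: "L1_structure D" using D(1) by (simp add: finite_L1_diversities_iff)
  have "embedding \<L> (e \<circ> g) B D"
  proof (rule embeddingI[OF B(1) LD])
    show "div_of D ((e \<circ> g) ` F) = div_of B F" if "F \<subseteq> univ B" for F
      using D(3)[of "g ` F"] g(2)[OF that] that by (auto simp: image_comp)
  qed (use D(2) in auto)
  moreover have "embedding \<L> (e \<circ> k) C D"
  proof (rule embeddingI[OF C(1) LD])
    show "div_of D ((e \<circ> k) ` F) = div_of C F" if "F \<subseteq> univ C" for F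
      using D(3)[of "k ` F"] k(2)[OF that] that by (auto simp: image_comp)
  qed (use D(2) in auto)
  moreover have "\<forall>x\<in>univ A. (e \<circ> g) (fB x) = (e \<circ> k) (fC x)" using k(3) hfC by simp
  ultimately show "\<exists>D\<in>\<K>. \<exists>gB gC. embedding \<L> gB B D \<and> embedding \<L> gC C D \<and>
    (\<forall>x\<in>univ A. gB (fB x) = gC (fC x))" using D(1) by blast
qed

text \<open>
  Amalgamation over the empty structure.
\<close>

lemma JEP: "JEP \<L> \<K>"
  unfolding JEP_def
proof (intro ballI)
  fix A B :: "(nat, div_symbol) rel_struct" assume AB: "A \<in> \<K>" "B \<in> \<K>"
  obtain E :: "(nat, div_symbol) rel_struct" and e :: "real \<Rightarrow> nat" where E: "E \<in> \<K>" "univ E = e ` {}"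
    using finite_copy[OF L1 finite.emptyI empty_subsetI] by metis
  have "embedding \<L> f E C" if "C \<in> \<K>" for f :: "nat \<Rightarrow> nat" and C
    using E that by (intro embeddingI) (auto simp: finite_L1_diversities_iff div_of_def)
  then show "\<exists>C\<in>\<K>. substructure \<L> A C \<and> substructure \<L> B C"
    using AP E(1) AB unfolding AP_def substructure_def by meson
qed

lemma enumerate_tuple:
  assumes "x ` {..<n::nat} \<subseteq> X"
  obtains A :: "(nat, div_symbol) rel_struct" and as where "(A, as) \<in> enumerated \<K> n"
    "\<And>F. F \<subseteq> {..<n} \<Longrightarrow> \<delta> (x ` F) = div_of A ((!) as ` F)"
proof -
  obtain A :: "(nat, div_symbol) rel_struct" and e where A: "A \<in> \<K>"
    "univ A = e ` x ` {..<n}" "\<And>F. F \<subseteq> x ` {..<n} \<Longrightarrow> div_of A (e ` F) = \<delta> F"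
    using finite_copy[OF L1 _ assms] by (metis finite_imageI finite_lessThan)
  define as where "as = map (\<lambda>i. e (x i)) [0..<n]"
  have "(A, as) \<in> enumerated \<K> n"
    using A(1,2) by (auto simp: enumerated_def tuples_def as_def)
  moreover have "\<delta> (x ` F) = div_of A ((!) as ` F)" if F: "F \<subseteq> {..<n}" for F
  proof -
    have "(!) as ` F = e ` x ` F" unfolding image_image using F by (intro image_cong) (auto simp: as_def)
    moreover have "x ` F \<subseteq> x ` {..<n}" using F by (rule image_mono)
    ultimately show ?thesis using A(3) by simp
  qed
  ultimately show ?thesis using that by blast
qed

lemma realize_tuple:
  fixes n :: nat
  assumes "cut_diversity Y \<epsilon>" "y ` {..<n} \<subseteq> Y"
  obtains x where "x ` {..<n} \<subseteq> X" "\<And>F. F \<subseteq> {..<n} \<Longrightarrow> \<delta> (x ` F) = \<epsilon> (y ` F)"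
  using realize_cut_rep[OF extension div cut_diversity_tuple[OF assms(1) _ assms(2)]] by blast

text \<open>
  The first structure is realized in the space, and the last entry of the second one is added near
  that of the first, by the quantitative extension property for the common part of length \<open>n - 1\<close>.
  The error is the distance \<open>d_inf\<close>.
\<close>

lemma bAP: "bAP \<L> \<K>"
  unfolding bAP_def
proof
  fix n :: nat
  obtain c where c: "extends_within X \<delta> (n - 1) c" using quantitative by blast
  show "\<exists>c. \<forall>A as w B bs z. (A, as @ [w]) \<in> enumerated \<K> n \<and>
      (B, bs @ [z]) \<in> enumerated \<K> n \<and> same_values \<L> (A, as) (B, bs) \<longrightarrow>
      (\<exists>D ds w' z'. (D, ds @ [w', z']) \<in> enumerated \<K> (n + 1) \<and>
        same_values \<L> (D, ds @ [w']) (A, as @ [w]) \<and>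
        same_values \<L> (D, ds @ [z']) (B, bs @ [z]) \<and>
        sdist \<L> D w' z' \<le> c * d_inf \<L> (A, as @ [w]) (B, bs @ [z]))"
  proof (intro exI[of _ c] allI impI, elim conjE)
    fix A B :: "(nat, div_symbol) rel_struct" and as bs w z
    assume enA: "(A, as @ [w]) \<in> enumerated \<K> n"
      and enB: "(B, bs @ [z]) \<in> enumerated \<K> n"
      and same: "same_values \<L> (A, as) (B, bs)"
    note A = enumeratedD[OF enA] and B = enumeratedD[OF enB]
    define m where "m = length as"
    have n: "n = Suc m" "n - 1 = m" "length bs = m" using A(5) B(5) by (auto simp: m_def)
    have common: "div_of A ((!) as ` F) = div_of B ((!) bs ` F)" if "F \<subseteq> {..<m}" for F
    proof -
      have "set as \<subseteq> univ A" "set bs \<subseteq> univ B" using A(4) B(4) by auto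
      then show ?thesis using same same_values_iff[OF A(2) _ B(2), of as bs] that unfolding m_def by blast
    qed
    have app: "(!) (cs @ [u]) ` F = (!) cs ` F" if "length cs = m" "F \<subseteq> {..<m}" for F u and cs :: "nat list"
      using that by (intro image_cong) (auto simp: nth_append)
    obtain a where a: "a ` {..<n} \<subseteq> X" "\<And>F. F \<subseteq> {..<n} \<Longrightarrow> \<delta> (a ` F) = div_of A ((!) (as @ [w]) ` F)"
    proof (rule realize_tuple[OF L1_structure_cut_diversity[OF A(2)], of "(!) (as @ [w])" n])
      show "(!) (as @ [w]) ` {..<n} \<subseteq> univ A" unfolding nth_image_eq_set[OF A(5)] by (rule A(4))
    qed blast
    define \<gamma> where "\<gamma> = (\<lambda>F. div_of B ((!) (bs @ [z]) ` F))"
    obtain q where q: "q \<in> X" "\<And>F. F \<subseteq> {..<m} \<Longrightarrow> \<delta> (insert q (a ` F)) = \<gamma> (insert m F)"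
      "\<delta> {a m, q} \<le> c * d_inf \<L> (A, as @ [w]) (B, bs @ [z])"
    proof -
      have "\<exists>q\<in>X. (\<forall>F\<subseteq>{..<n - 1}. \<delta> (insert q (a ` F)) = \<gamma> (insert (n - 1) F)) \<and>
        \<delta> {a m, q} \<le> c * d_inf \<L> (A, as @ [w]) (B, bs @ [z])"
      proof (rule extends_withinD[OF c])
        show "a ` {..<n - 1} \<subseteq> X" "a m \<in> X" using a(1) n by (auto simp: less_Suc_eq)
        have "{..n - 1} = {..<n}" using n by auto
        then have "(!) (bs @ [z]) ` {..n - 1} \<subseteq> univ B" using B(4) nth_image_eq_set[OF B(5)] by simp
        then show "cut_rep {..n - 1} \<gamma>"
          unfolding \<gamma>_def by (intro cut_diversity_tuple[OF L1_structure_cut_diversity[OF B(2)]]) auto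
        fix F assume F: "F \<subseteq> {..<n - 1}"
        then have F': "F \<subseteq> {..<m}" "F \<subseteq> {..<n}" "insert m F \<subseteq> {..<n}" using n by auto
        show "\<gamma> F = \<delta> (a ` F)"
          using a(2)[OF F'(2)] common[OF F'(1)] app[OF _ F'(1)] n(3) by (simp add: \<gamma>_def m_def)
        have "\<delta> (insert (a m) (a ` F)) = div_of A ((!) (as @ [w]) ` insert m F)"
          using a(2)[OF F'(3)] by simp
        then show "\<bar>\<gamma> (insert (n - 1) F) - \<delta> (insert (a m) (a ` F))\<bar> \<le> d_inf \<L> (A, as @ [w]) (B, bs @ [z])"
          using d_inf_bound[OF A(2,4,5) B(2,4,5) F'(3)] unfolding \<gamma>_def n(2) by (simp only: abs_minus_commute)
      qed
      then show ?thesis using that n(2) by auto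
    qed
    define b where "b = a(n := q)"
    have bX: "b ` {..<n + 1} \<subseteq> X" using a(1) q(1) by (auto simp: b_def less_Suc_eq)
    obtain D :: "(nat, div_symbol) rel_struct" and cs where D: "(D, cs) \<in> enumerated \<K> (n + 1)"
      "\<And>F. F \<subseteq> {..<n + 1} \<Longrightarrow> \<delta> (b ` F) = div_of D ((!) cs ` F)"
      using enumerate_tuple[OF bX] by blast
    note D' = enumeratedD[OF D(1)]
    define ds where "ds = take m cs"
    have cs: "cs = ds @ [cs ! m, cs ! n]" "length ds = m"
    proof -
      show "length ds = m" using D'(5) n by (simp add: ds_def)
      have "drop m cs = [cs ! m, cs ! n]"
        using D'(5) n by (auto simp: Cons_nth_drop_Suc[symmetric])
      then show "cs = ds @ [cs ! m, cs ! n]" unfolding ds_def by (metis append_take_drop_id)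
    qed
    have inD: "set ds \<subseteq> univ D" "cs ! m \<in> univ D" "cs ! n \<in> univ D"
      using D'(4,5) n by (auto simp: ds_def dest: in_set_takeD)
    have img1: "(!) (ds @ [cs ! m]) ` F = (!) cs ` F" if "F \<subseteq> {..<n}" for F
      using that n cs(2) D'(5) by (intro image_cong refl) (auto simp: nth_append ds_def less_Suc_eq)
    have val1: "div_of D ((!) (ds @ [cs ! m]) ` F) = div_of A ((!) (as @ [w]) ` F)" if F: "F \<subseteq> {..<n}" for F
    proof -
      have "F \<subseteq> {..<n + 1}" using F by auto
      then have "div_of D ((!) cs ` F) = \<delta> (b ` F)" using D(2) by simp
      also have "b ` F = a ` F" using F by (intro image_cong) (auto simp: b_def)
      finally show ?thesis using a(2)[OF F] img1[OF F] by simp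
    qed
    have val2: "div_of D ((!) (ds @ [cs ! n]) ` F) = div_of B ((!) (bs @ [z]) ` F)" if F: "F \<subseteq> {..<n}" for F
    proof (cases "m \<in> F")
      case False
      then have F': "F \<subseteq> {..<m}" using F n by (auto simp: less_Suc_eq)
      have "(!) (ds @ [cs ! n]) ` F = (!) (ds @ [cs ! m]) ` F" using app[OF cs(2) F'] by simp
      then show ?thesis using val1[OF F] common[OF F'] app[OF _ F'] n(3) by (simp add: m_def)
    next
      case True
      define G where "G = F - {m}"
      have G: "F = insert m G" "G \<subseteq> {..<m}" using True F n by (auto simp: G_def less_Suc_eq)
      have "(!) (ds @ [cs ! n]) ` F = (!) cs ` insert n G"
      proof -
        have "(!) (ds @ [cs ! n]) ` G = (!) cs ` G"
          using G(2) cs(2) D'(5) by (intro image_cong refl) (auto simp: nth_append ds_def)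
        then show ?thesis using G(1) cs(2) by (simp add: nth_append)
      qed
      moreover have "insert n G \<subseteq> {..<n + 1}" using G(2) n(1) by auto
      ultimately have "div_of D ((!) (ds @ [cs ! n]) ` F) = \<delta> (b ` insert n G)"
        using D(2)[of "insert n G"] by simp
      also have "b ` insert n G = insert q (a ` G)"
      proof -
        have "b ` G = a ` G" using G(2) n by (intro image_cong) (auto simp: b_def)
        moreover have "b n = q" by (simp add: b_def)
        ultimately show ?thesis by (simp only: image_insert)
      qed
      also have "\<delta> (insert q (a ` G)) = \<gamma> (insert m G)" using q(2)[OF G(2)] .
      finally show ?thesis using G(1) by (simp add: \<gamma>_def)
    qed
    have "sdist \<L> D (cs ! m) (cs ! n) = div_of D {cs ! m, cs ! n}"
      using sdist_eq[OF L1_structureD(2)[OF D'(2)] inD(2,3)] .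
    also have "\<dots> = \<delta> {a m, q}"
      using D(2)[of "{m, n}"] n by (simp add: b_def)
    finally have "sdist \<L> D (cs ! m) (cs ! n) \<le> c * d_inf \<L> (A, as @ [w]) (B, bs @ [z])"
      using q(3) by simp
    moreover have "same_values \<L> (D, ds @ [cs ! m]) (A, as @ [w])"
      using same_values_iff[of D "ds @ [cs ! m]" A "as @ [w]"] val1 D'(2) A inD cs(2) n by (auto simp: m_def)
    moreover have "same_values \<L> (D, ds @ [cs ! n]) (B, bs @ [z])"
      using same_values_iff[of D "ds @ [cs ! n]" B "bs @ [z]"] val2 D'(2) B inD cs(2) n by auto
    moreover have "(D, ds @ [cs ! m, cs ! n]) \<in> enumerated \<K> (n + 1)" using D(1) cs(1) by simp
    ultimately show "\<exists>D ds w' z'. (D, ds @ [w', z']) \<in> enumerated \<K> (n + 1) \<and>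
        same_values \<L> (D, ds @ [w']) (A, as @ [w]) \<and>
        same_values \<L> (D, ds @ [z']) (B, bs @ [z]) \<and>
        sdist \<L> D w' z' \<le> c * d_inf \<L> (A, as @ [w]) (B, bs @ [z])" by blast
  qed
qed

section \<open>The metric on enumerated structures\<close>

text \<open>
  Copies in the space are tuples of points with the values of a given enumerated structure. Distances of
  enumerated structures will be computed with them.
\<close>

definition is_copy :: "nat \<Rightarrow> (nat, div_symbol) enum_struct \<Rightarrow> (nat \<Rightarrow> real) \<Rightarrow> bool" where
  "is_copy n p x \<longleftrightarrow> x ` {..<n} \<subseteq> X \<and> (\<forall>F\<subseteq>{..<n}. \<delta> (x ` F) = div_of (fst p) ((!) (snd p) ` F))"

lemma exists_copy:
  assumes "p \<in> enumerated \<K> n"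
  obtains x where "is_copy n p x"
proof -
  obtain A as where p: "p = (A, as)" by (cases p)
  note A = enumeratedD[OF assms[unfolded p]]
  obtain x where "x ` {..<n} \<subseteq> X" "\<And>F. F \<subseteq> {..<n} \<Longrightarrow> \<delta> (x ` F) = div_of A ((!) as ` F)"
    using realize_tuple[OF L1_structure_cut_diversity[OF A(2)], of "(!) as" n] A(4) nth_image_eq_set[OF A(5)] by auto
  then have "is_copy n p x" unfolding is_copy_def p by simp
  then show ?thesis by (rule that)
qed

lemma exists_enumerated:
  assumes "x ` {..<n} \<subseteq> X"
  obtains p where "p \<in> enumerated \<K> n" "is_copy n p x"
  using enumerate_tuple[OF assms] assms unfolding is_copy_def by (metis fst_conv snd_conv)

lemma copy_in: "is_copy n p x \<Longrightarrow> i < n \<Longrightarrow> x i \<in> X"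
  by (auto simp: is_copy_def)

text \<open>
  The space is homogeneous enough: the points of \<open>y'\<close> are mapped to those of \<open>y\<close>, and this map extends
  to the points of \<open>z'\<close>.
\<close>

lemma move_copy:
  fixes n :: nat
  assumes y: "is_copy n p y" and y': "is_copy n p y'" and z': "is_copy n q z'"
  obtains z where "is_copy n q z" "\<And>i. i < n \<Longrightarrow> \<delta> {y i, z i} = \<delta> {y' i, z' i}"
proof -
  obtain f where f: "\<And>i. i < n \<Longrightarrow> f (y' i) = y i" "\<And>G. G \<subseteq> y' ` {..<n} \<Longrightarrow> \<delta> (f ` G) = \<delta> G"
    using matching_tuples_map[OF div div, of y' n y] y y' by (auto simp: is_copy_def)
  have "f ` y' ` {..<n} \<subseteq> X" using f(1) copy_in[OF y] by auto
  moreover have "y' ` {..<n} \<union> z' ` {..<n} \<subseteq> X" using y' z' by (auto simp: is_copy_def)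
  ultimately obtain g where g: "g ` (y' ` {..<n} \<union> z' ` {..<n}) \<subseteq> X"
    "\<And>G. G \<subseteq> y' ` {..<n} \<union> z' ` {..<n} \<Longrightarrow> \<delta> (g ` G) = \<delta> G" "\<And>t. t \<in> y' ` {..<n} \<Longrightarrow> g t = f t"
    using extend_finite_map[OF cut_div extension div, of "y' ` {..<n} \<union> z' ` {..<n}" "y' ` {..<n}" f] f(2)
    by (metis finite_UnI finite_imageI finite_lessThan Un_upper1)
  have "is_copy n q (\<lambda>i. g (z' i))"
    unfolding is_copy_def
  proof (intro conjI allI impI)
    show "(\<lambda>i. g (z' i)) ` {..<n} \<subseteq> X" using g(1) by auto
    show "\<delta> ((\<lambda>i. g (z' i)) ` F) = div_of (fst q) ((!) (snd q) ` F)" if "F \<subseteq> {..<n}" for F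
    proof -
      have "z' ` F \<subseteq> y' ` {..<n} \<union> z' ` {..<n}" using that by auto
      then have "\<delta> (g ` z' ` F) = \<delta> (z' ` F)" by (rule g(2))
      then show ?thesis using z' that by (simp add: is_copy_def image_image)
    qed
  qed
  moreover have "\<delta> {y i, g (z' i)} = \<delta> {y' i, z' i}" if "i < n" for i
    using g(2)[of "{y' i, z' i}"] g(3)[of "y' i"] f(1)[OF that] that by auto
  ultimately show ?thesis using that by blast
qed

definition common_distances ::
  "(nat, div_symbol) enum_struct \<Rightarrow> (nat, div_symbol) enum_struct \<Rightarrow> real set" where
  "common_distances = (\<lambda>(A, as) (B, bs). {max_dist \<L> C (map f as) (map g bs) | C f g.
     C \<in> \<K> \<and> embedding \<L> f (induced A (set as)) C \<and>
     embedding \<L> g (induced B (set bs)) C})"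

lemma d_K_eq: "d_K \<L> \<K> p q = Inf (common_distances p q)"
  by (cases p, cases q) (simp add: d_K_def common_distances_def)

lemma common_distances_nonneg: "r \<in> common_distances p q \<Longrightarrow> 0 \<le> r"
  by (cases p, cases q) (auto simp: common_distances_def max_dist_def)

text \<open>
  The points of both copies form a finite structure of the class, into which both enumerated structures
  embed.
\<close>

lemma common_distances_below:
  assumes p: "p \<in> enumerated \<K> n" and q: "q \<in> enumerated \<K> n"
    and x: "is_copy n p x" and y: "is_copy n q y" and r: "0 \<le> r" "\<And>i. i < n \<Longrightarrow> \<delta> {x i, y i} \<le> r"
  shows "\<exists>s\<in>common_distances p q. s \<le> r"
proof -
  obtain A as B bs where pq: "p = (A, as)" "q = (B, bs)" by (cases p, cases q)
  note A = enumeratedD[OF p[unfolded pq]] and B = enumeratedD[OF q[unfolded pq]]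
  have sub: "x ` {..<n} \<union> y ` {..<n} \<subseteq> X" using x y by (auto simp: is_copy_def)
  from finite_copy[OF L1 _ sub] obtain C :: "(nat, div_symbol) rel_struct" and e where C: "C \<in> \<K>"
    "univ C = e ` (x ` {..<n} \<union> y ` {..<n})" "\<And>F. F \<subseteq> x ` {..<n} \<union> y ` {..<n} \<Longrightarrow> div_of C (e ` F) = \<delta> F"
    by (metis finite_UnI finite_imageI finite_lessThan)
  have LC: "L1_structure C" using C(1) by (simp add: finite_L1_diversities_iff)
  have emb: "\<exists>f. embedding \<L> f (induced A (set as)) C \<and> (\<forall>i<n. f (as ! i) = e (x i))"
    if A: "L1_structure A" "set as \<subseteq> univ A" "length as = n" and x: "is_copy n (A, as) x"
      and sub: "x ` {..<n} \<subseteq> S" and S: "univ C = e ` S" "\<And>F. F \<subseteq> S \<Longrightarrow> div_of C (e ` F) = \<delta> F"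
    for A :: "(nat, div_symbol) rel_struct" and as x S
  proof -
    have "\<And>F. F \<subseteq> {..<n} \<Longrightarrow> div_of A ((!) as ` F) = div_of C ((\<lambda>i. e (x i)) ` F)"
    proof -
      fix F assume F: "F \<subseteq> {..<n}"
      have "x ` F \<subseteq> S" using F sub by blast
      then have "div_of C (e ` x ` F) = \<delta> (x ` F)" by (rule S(2))
      then show "div_of A ((!) as ` F) = div_of C ((\<lambda>i. e (x i)) ` F)"
        using x F by (simp add: is_copy_def image_image)
    qed
    moreover have "(\<lambda>i. e (x i)) ` {..<n} \<subseteq> univ C" using sub S(1) by auto
    ultimately obtain f where f: "\<And>i. i < n \<Longrightarrow> f (as ! i) = e (x i)"
      "\<And>G. G \<subseteq> (!) as ` {..<n} \<Longrightarrow> div_of C (f ` G) = div_of A G"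
      using matching_tuples_map[OF L1_structure_diversity[OF A(1)] L1_structure_diversity[OF LC], of "(!) as" n "\<lambda>i. e (x i)"]
        A(2) nth_image_eq_set[OF A(3)] by metis
    have "f ` set as \<subseteq> univ C"
      using f(1) sub S(1) unfolding nth_image_eq_set[OF A(3), symmetric] by auto
    then have "embedding \<L> f (induced A (set as)) C"
      unfolding L1_embedding_iff[OF A(1) LC A(2)] using f(2) nth_image_eq_set[OF A(3)] by (auto simp: Fpow_def)
    then show ?thesis using f(1) by blast
  qed
  obtain f where f: "embedding \<L> f (induced A (set as)) C" "\<And>i. i < n \<Longrightarrow> f (as ! i) = e (x i)"
    using emb[OF A(2,4,5) x[unfolded pq] _ C(2,3)] by auto
  obtain g where g: "embedding \<L> g (induced B (set bs)) C" "\<And>i. i < n \<Longrightarrow> g (bs ! i) = e (y i)"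
    using emb[OF B(2,4,5) y[unfolded pq] _ C(2,3)] by auto
  have "max_dist \<L> C (map f as) (map g bs) \<le> r"
  proof -
    have "sdist \<L> C (f (as ! i)) (g (bs ! i)) \<le> r" if "i < n" for i
    proof -
      have "e (x i) \<in> univ C" "e (y i) \<in> univ C" using that C(2) by auto
      then have "sdist \<L> C (e (x i)) (e (y i)) = div_of C (e ` {x i, y i})"
        using sdist_eq[OF L1_structureD(2)[OF LC]] by simp
      also have "\<dots> = \<delta> {x i, y i}" using that by (intro C(3)) auto
      finally show ?thesis using r(2)[OF that] f(2)[OF that] g(2)[OF that] by simp
    qed
    then have "\<forall>s\<in>set (map2 (sdist \<L> C) (map f as) (map g bs)). s \<le> r"
      using A(5) B(5) by (auto simp: in_set_zip)
    then show ?thesis unfolding max_dist_def using r(1) by (subst Max_le_iff) auto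
  qed
  moreover have "max_dist \<L> C (map f as) (map g bs) \<in> common_distances p q"
    unfolding pq common_distances_def prod.case
    by (rule CollectI, intro exI conjI, rule refl) (rule C(1) f(1) g(1))+
  ultimately show ?thesis by blast
qed

lemma common_distances_nonempty:
  assumes p: "p \<in> enumerated \<K> n" and q: "q \<in> enumerated \<K> n"
  shows "common_distances p q \<noteq> {}"
proof -
  obtain x where x: "is_copy n p x" using exists_copy[OF p] .
  obtain y where y: "is_copy n q y" using exists_copy[OF q] .
  have nn: "0 \<le> \<delta> {x i, y i}" if "i < n" for i
    using copy_in[OF x that] copy_in[OF y that] by (intro diversity_nonneg[OF div]) auto
  have "\<delta> {x i, y i} \<le> (\<Sum>i<n. \<delta> {x i, y i})" if "i < n" for i
    using that nn by (intro member_le_sum) auto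
  then show ?thesis
    using common_distances_below[OF p q x y, of "\<Sum>i<n. \<delta> {x i, y i}"] nn by (auto intro: sum_nonneg)
qed

lemma d_K_le:
  assumes "p \<in> enumerated \<K> n" "q \<in> enumerated \<K> n"
    "is_copy n p x" "is_copy n q y" "0 \<le> r" "\<And>i. i < n \<Longrightarrow> \<delta> {x i, y i} \<le> r"
  shows "d_K \<L> \<K> p q \<le> r"
proof -
  obtain s where s: "s \<in> common_distances p q" "s \<le> r" using common_distances_below[OF assms] by blast
  have "Inf (common_distances p q) \<le> s"
    using s(1) common_distances_nonneg by (intro cInf_lower bdd_belowI[of _ 0])
  then show ?thesis using s(2) d_K_eq by simp
qed

text \<open>
  A common extension embeds into the space, and the images of the two tuples are the copies.
\<close>

lemma d_K_less:
  assumes p: "p \<in> enumerated \<K> n" and q: "q \<in> enumerated \<K> n"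
    and less: "d_K \<L> \<K> p q < r"
  obtains x y where "is_copy n p x" "is_copy n q y" "\<And>i. i < n \<Longrightarrow> \<delta> {x i, y i} < r"
proof -
  obtain A as B bs where pq: "p = (A, as)" "q = (B, bs)" by (cases p, cases q)
  note A = enumeratedD[OF p[unfolded pq]] and B = enumeratedD[OF q[unfolded pq]]
  obtain s where "s \<in> common_distances p q" "s < r"
    using cInf_lessD[OF common_distances_nonempty[OF p q]] less d_K_eq by metis
  then obtain C f g where C: "C \<in> \<K>" and f: "embedding \<L> f (induced A (set as)) C"
    and g: "embedding \<L> g (induced B (set bs)) C" and s: "max_dist \<L> C (map f as) (map g bs) < r"
    unfolding pq common_distances_def by auto
  have LC: "L1_structure C" "finite (univ C)" using C by (auto simp: finite_L1_diversities_iff)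
  obtain k where k: "k ` univ C \<subseteq> X" "\<And>G. G \<subseteq> univ C \<Longrightarrow> \<delta> (k ` G) = div_of C G"
    using embed_finite[OF L1_structure_cut_diversity[OF LC(1)] LC(2) order_refl] by blast
  have copy: "is_copy n (A, as) (\<lambda>i. k (f (as ! i)))"
    if A: "L1_structure A" "set as \<subseteq> univ A" "length as = n" and f: "embedding \<L> f (induced A (set as)) C"
    for A :: "(nat, div_symbol) rel_struct" and as f
  proof -
    have fA: "f ` set as \<subseteq> univ C" "\<And>F. F \<in> Fpow (set as) \<Longrightarrow> div_of C (f ` F) = div_of A F"
      using f unfolding L1_embedding_iff[OF A(1) LC(1) A(2)] by auto
    have "\<delta> ((\<lambda>i. k (f (as ! i))) ` F) = div_of A ((!) as ` F)" if F: "F \<subseteq> {..<n}" for F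
    proof -
      have sub: "(!) as ` F \<subseteq> set as" using F A(3) by auto
      then have "f ` (!) as ` F \<subseteq> univ C" using fA(1) by blast
      then have "\<delta> (k ` f ` (!) as ` F) = div_of C (f ` (!) as ` F)" by (rule k(2))
      also have "\<dots> = div_of A ((!) as ` F)"
        using sub F by (intro fA(2)) (auto simp: Fpow_def intro: finite_subset)
      finally show ?thesis by (simp add: image_image)
    qed
    moreover have "(\<lambda>i. k (f (as ! i))) ` {..<n} = k ` f ` set as"
      by (simp add: image_image flip: nth_image_eq_set[OF A(3)])
    then have "(\<lambda>i. k (f (as ! i))) ` {..<n} \<subseteq> X" using fA(1) k(1) by blast
    ultimately show ?thesis by (simp add: is_copy_def image_image)
  qed
  have "\<delta> {k (f (as ! i)), k (g (bs ! i))} < r" if "i < n" for i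
  proof -
    have "f ` set as \<subseteq> univ C" "g ` set bs \<subseteq> univ C" using f g by (simp_all add: embedding_def)
    then have in_C: "f (as ! i) \<in> univ C" "g (bs ! i) \<in> univ C" using that A(5) B(5) by auto
    have "sdist \<L> C (f (as ! i)) (g (bs ! i)) \<in> set (map2 (sdist \<L> C) (map f as) (map g bs))"
      using that A(5) B(5) by (force simp: in_set_zip)
    then have "sdist \<L> C (f (as ! i)) (g (bs ! i)) \<le> max_dist \<L> C (map f as) (map g bs)"
      unfolding max_dist_def by (intro Max_ge) auto
    then show ?thesis
      using s k(2)[of "{f (as ! i), g (bs ! i)}"] in_C sdist_eq[OF L1_structureD(2)[OF LC(1)] in_C] by simp
  qed
  then show ?thesis using that[of "\<lambda>i. k (f (as ! i))" "\<lambda>i. k (g (bs ! i))"]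
      copy[OF A(2,4,5) f] copy[OF B(2,4,5) g] pq by simp
qed

lemma d_K_nonneg:
  assumes "p \<in> enumerated \<K> n" "q \<in> enumerated \<K> n"
  shows "0 \<le> d_K \<L> \<K> p q"
  unfolding d_K_eq using common_distances_nonempty[OF assms] common_distances_nonneg by (intro cInf_greatest)

text \<open>
  The two copies of the middle structure are brought together by \<open>move_copy\<close>.
\<close>

lemma d_K_triangle:
  assumes p: "p \<in> enumerated \<K> n" and q: "q \<in> enumerated \<K> n"
    and r: "r \<in> enumerated \<K> n"
  shows "d_K \<L> \<K> p r \<le>
    d_K \<L> \<K> p q + d_K \<L> \<K> q r"
    (is "?d p r \<le> ?d p q + ?d q r")
proof (rule field_le_epsilon)
  fix e :: real assume "0 < e"
  obtain x y where xy: "is_copy n p x" "is_copy n q y" "\<And>i. i < n \<Longrightarrow> \<delta> {x i, y i} < ?d p q + e / 2"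
    using d_K_less[OF p q, of "?d p q + e / 2"] \<open>0 < e\<close> by auto
  obtain y' z' where yz: "is_copy n q y'" "is_copy n r z'" "\<And>i. i < n \<Longrightarrow> \<delta> {y' i, z' i} < ?d q r + e / 2"
    using d_K_less[OF q r, of "?d q r + e / 2"] \<open>0 < e\<close> by auto
  obtain z where z: "is_copy n r z" "\<And>i. i < n \<Longrightarrow> \<delta> {y i, z i} = \<delta> {y' i, z' i}"
    using move_copy[OF xy(2) yz(1,2)] by blast
  show "?d p r \<le> ?d p q + ?d q r + e"
  proof (rule d_K_le[OF p r xy(1) z(1)])
    show "0 \<le> ?d p q + ?d q r + e" using d_K_nonneg[OF p q] d_K_nonneg[OF q r] \<open>0 < e\<close> by simp
    show "\<delta> {x i, z i} \<le> ?d p q + ?d q r + e" if "i < n" for i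
    proof -
      have "\<delta> {x i, z i} \<le> \<delta> {x i, y i} + \<delta> {y i, z i}"
        using copy_in[OF xy(1) that] copy_in[OF xy(2) that] copy_in[OF z(1) that] by (rule diversity_triangle[OF div])
      then show ?thesis using xy(3)[OF that] yz(3)[OF that] z(2)[OF that] by simp
    qed
  qed
qed

lemma d_K_pseudometric: "pseudometric_on (enumerated \<K> n) (d_K \<L> \<K>)"
proof -
  let ?d = "d_K \<L> \<K>"
  have refl: "?d p p = 0" if p: "p \<in> enumerated \<K> n" for p
  proof -
    obtain x where x: "is_copy n p x" using exists_copy[OF p] .
    have "?d p p \<le> 0" using copy_in[OF x] diversity_singleton[OF div] by (intro d_K_le[OF p p x x]) auto
    then show ?thesis using d_K_nonneg[OF p p] by simp
  qed
  have sym: "?d q p \<le> ?d p q" if p: "p \<in> enumerated \<K> n" and q: "q \<in> enumerated \<K> n" for p q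
  proof (rule field_le_epsilon)
    fix e :: real assume "0 < e"
    obtain x y where xy: "is_copy n p x" "is_copy n q y" "\<And>i. i < n \<Longrightarrow> \<delta> {x i, y i} < ?d p q + e"
      using d_K_less[OF p q, of "?d p q + e"] \<open>0 < e\<close> by auto
    show "?d q p \<le> ?d p q + e"
      using xy(3) d_K_nonneg[OF p q] \<open>0 < e\<close> by (intro d_K_le[OF q p xy(2,1)]) (auto simp: insert_commute intro: less_imp_le)
  qed
  show ?thesis
    unfolding pseudometric_on_def using refl d_K_nonneg d_K_triangle sym by (meson order_antisym)
qed

text \<open>
  The countable set consists of the structures of tuples from a dense sequence of the space.
\<close>

lemma d_K_separable: "separable_pm (enumerated \<K> n) (d_K \<L> \<K>)"
proof -
  obtain D :: "nat \<Rightarrow> real" where D: "range D \<subseteq> X" "\<And>x e. x \<in> X \<Longrightarrow> 0 < e \<Longrightarrow> \<exists>i. \<delta> {D i, x} < e"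
    using separable_div_sequence[OF separable nonempty] by blast
  have "\<exists>p. p \<in> enumerated \<K> n \<and> is_copy n p (\<lambda>i. D (ks ! i))" for ks :: "nat list"
    using exists_enumerated[of "\<lambda>i. D (ks ! i)" n] D(1) by blast
  then obtain \<psi> where \<psi>: "\<And>ks. \<psi> ks \<in> enumerated \<K> n" "\<And>ks. is_copy n (\<psi> ks) (\<lambda>i. D (ks ! i))"
    by metis
  have "\<exists>q\<in>range \<psi>. d_K \<L> \<K> p q < e"
    if p: "p \<in> enumerated \<K> n" and "0 < e" for p e
  proof -
    obtain x where x: "is_copy n p x" using exists_copy[OF p] .
    have "\<forall>i<n. \<exists>k. \<delta> {D k, x i} < e / 2"
      by (intro allI impI D(2) copy_in[OF x]) (use \<open>0 < e\<close> in auto)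
    then obtain k where k: "\<And>i. i < n \<Longrightarrow> \<delta> {D (k i), x i} < e / 2" by metis
    define ks where "ks = map k [0..<n]"
    have "d_K \<L> \<K> p (\<psi> ks) \<le> e / 2"
    proof (rule d_K_le[OF p \<psi>(1) x \<psi>(2)])
      show "\<delta> {x i, D (ks ! i)} \<le> e / 2" if "i < n" for i
        using k[OF that] that by (simp add: ks_def insert_commute)
    qed (use \<open>0 < e\<close> in simp)
    then show ?thesis using \<open>0 < e\<close> by (intro bexI[of _ "\<psi> ks"]) auto
  qed
  then show ?thesis
    unfolding separable_pm_def using \<psi>(1) by (intro exI[of _ "range \<psi>"]) auto
qed

text \<open>
  For a subsequence with fast decreasing distances, copies are chosen one after the other so that
  consecutive ones are close. They converge entrywise in the space, and the limit is the structure of the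
  limit tuple.
\<close>

lemma d_K_complete: "complete_pm (enumerated \<K> n) (d_K \<L> \<K>)"
  unfolding complete_pm_def
proof (intro allI impI, elim conjE)
  let ?d = "d_K \<L> \<K>" and ?E = "enumerated \<K> n"
  fix \<sigma> :: "nat \<Rightarrow> (nat, div_symbol) enum_struct"
  assume "range \<sigma> \<subseteq> ?E" and cauchy: "\<forall>\<epsilon>>0. \<exists>N. \<forall>m\<ge>N. \<forall>n\<ge>N. ?d (\<sigma> m) (\<sigma> n) < \<epsilon>"
  then have \<sigma>: "\<sigma> m \<in> ?E" for m by blast
  have "\<forall>k. \<exists>N. \<forall>m\<ge>N. \<forall>n\<ge>N. ?d (\<sigma> m) (\<sigma> n) < (1/2) ^ k" using cauchy by simp
  then obtain N where N: "\<And>k m m'. N k \<le> m \<Longrightarrow> N k \<le> m' \<Longrightarrow> ?d (\<sigma> m) (\<sigma> m') < (1/2) ^ k" by metis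
  define r where "r = (\<lambda>k. \<Sum>j\<le>k. N j)"
  have r: "N k \<le> r j" if "k \<le> j" for k j unfolding r_def using that by (intro member_le_sum) auto
  define \<tau> where "\<tau> = (\<lambda>k. \<sigma> (r k))"
  have \<tau>: "\<tau> k \<in> ?E" for k using \<sigma> by (simp add: \<tau>_def)
  have fast: "?d (\<tau> k) (\<tau> (Suc k)) < (1/2) ^ k" for k
    unfolding \<tau>_def by (intro N r) auto
  have "\<exists>x. \<forall>k. is_copy n (\<tau> k) (x k) \<and> (\<forall>i<n. \<delta> {x k i, x (Suc k) i} < (1/2) ^ k)"
  proof (rule dependent_nat_choice)
    show "\<exists>x. is_copy n (\<tau> 0) x" using exists_copy[OF \<tau>] by blast
    fix y k assume y: "is_copy n (\<tau> k) y"
    obtain y' z' where yz: "is_copy n (\<tau> k) y'" "is_copy n (\<tau> (Suc k)) z'" "\<And>i. i < n \<Longrightarrow> \<delta> {y' i, z' i} < (1/2) ^ k"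
      using d_K_less[OF \<tau> \<tau> fast] by blast
    obtain z where "is_copy n (\<tau> (Suc k)) z" "\<And>i. i < n \<Longrightarrow> \<delta> {y i, z i} = \<delta> {y' i, z' i}"
      using move_copy[OF y yz(1,2)] by blast
    then show "\<exists>z. is_copy n (\<tau> (Suc k)) z \<and> (\<forall>i<n. \<delta> {y i, z i} < (1/2) ^ k)" using yz(3) by auto
  qed
  then obtain x where x: "\<And>k. is_copy n (\<tau> k) (x k)" "\<And>k i. i < n \<Longrightarrow> \<delta> {x k i, x (Suc k) i} < (1/2) ^ k" by blast
  have "\<exists>\<xi>. \<xi> \<in> X \<and> (\<forall>e>0. \<exists>M. \<forall>k\<ge>M. \<delta> {x k i, \<xi>} < e)" if i: "i < n" for i
  proof -
    have "\<delta> {x k i, x (Suc k) i} \<le> 1 * (1/2) ^ k" for k using x(2)[OF i, of k] by simp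
    from complete_div_fast[OF div complete copy_in[OF x(1) i] this]
    obtain z where "z \<in> X" "\<And>e. 0 < e \<Longrightarrow> \<exists>N. \<forall>k\<ge>N. \<delta> {x k i, z} < e" by metis
    then show ?thesis by metis
  qed
  then obtain \<xi> where \<xi>: "\<And>i. i < n \<Longrightarrow> \<xi> i \<in> X" "\<And>i e. i < n \<Longrightarrow> 0 < e \<Longrightarrow> \<exists>M. \<forall>k\<ge>M. \<delta> {x k i, \<xi> i} < e"
    by metis
  obtain p where p: "p \<in> ?E" "is_copy n p \<xi>" using exists_enumerated[of \<xi> n] \<xi>(1) by auto
  have "\<exists>M. \<forall>m\<ge>M. ?d (\<sigma> m) p < e" if "0 < e" for e
  proof -
    obtain k where k: "(1/2) ^ k < e / 2" using real_arch_pow_inv[of "e / 2" "1/2"] \<open>0 < e\<close> by auto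
    have "\<forall>i<n. \<exists>M. \<forall>k\<ge>M. \<delta> {x k i, \<xi> i} < e / 2"
      by (intro allI impI \<xi>(2)) (use \<open>0 < e\<close> in auto)
    then obtain M where M: "\<And>i k. i < n \<Longrightarrow> M i \<le> k \<Longrightarrow> \<delta> {x k i, \<xi> i} < e / 2" by metis
    define j where "j = k + (\<Sum>i<n. M i)"
    have Mj: "M i \<le> j" if "i < n" for i
      using member_le_sum[of i "{..<n}" M] that by (simp add: j_def)
    have near: "?d (\<tau> j) p \<le> e / 2"
      using M Mj \<open>0 < e\<close> by (intro d_K_le[OF \<tau> p(1) x(1) p(2)]) (auto intro: less_imp_le)
    have "?d (\<sigma> m) p < e" if "N k \<le> m" for m
    proof -
      have "?d (\<sigma> m) p \<le> ?d (\<sigma> m) (\<tau> j) + ?d (\<tau> j) p" by (rule d_K_triangle[OF \<sigma> \<tau> p(1)])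
      moreover have "?d (\<sigma> m) (\<tau> j) < (1/2) ^ k"
        unfolding \<tau>_def using that by (intro N r) (auto simp: j_def)
      ultimately show ?thesis using near k by simp
    qed
    then show ?thesis by blast
  qed
  then have "(\<lambda>m. ?d (\<sigma> m) p) \<longlonglongrightarrow> 0"
    using d_K_nonneg[OF \<sigma> p(1)] by (intro LIMSEQ_I) auto
  then show "\<exists>x\<in>?E. (\<lambda>n. ?d (\<sigma> n) x) \<longlonglongrightarrow> 0" using p(1) by blast
qed

lemma PP: "PP \<L> \<K>"
  unfolding PP_def using d_K_pseudometric d_K_separable d_K_complete by blast

lemma interp_eq_div_of:
  assumes "R \<in> symbols \<L>" "(A, as) \<in> enumerated \<K> (arity \<L> R)"
  shows "interp A R as = div_of A ((!) as ` {..<arity \<L> R})"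
proof (cases R)
  case Dist
  note A = enumeratedD[OF assms(2)]
  obtain x y where xy: "as = [x, y]" using A(5) Dist by (auto simp: div_language_def length_Suc_conv numeral_2_eq_2)
  then show ?thesis
    using represents_Dist[OF L1_structureD(2)[OF A(2)], of x y] A(4) nth_image_eq_set[OF A(5)] Dist by simp
next
  case (Delta k)
  note A = enumeratedD[OF assms(2)]
  have "as \<noteq> []" "length as = k" using A(5) Delta assms(1) by (auto simp: div_language_def)
  then show ?thesis
    using represents_Delta[OF L1_structureD(2)[OF A(2)] _ A(4)] nth_image_eq_set[OF A(5)] Delta by simp
qed

text \<open>
  Predicates on copies with distances below \<open>\<eta>\<close> differ by at most \<open>n\<close> times \<open>\<eta>\<close>.
\<close>

lemma CP: "CP \<L> \<K>"
  unfolding CP_def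
proof (intro ballI)
  fix R and p :: "(nat, div_symbol) enum_struct"
  assume R: "R \<in> symbols \<L>" and p: "p \<in> enumerated \<K> (arity \<L> R)"
  obtain A as where A: "p = (A, as)" by (cases p)
  define n where "n = arity \<L> R"
  have "\<bar>interp A R as - interp B R bs\<bar> < e"
    if "0 < e" and B: "(B, bs) \<in> enumerated \<K> n"
      and close: "d_K \<L> \<K> (A, as) (B, bs) < e / (real n + 1)" for e B bs
  proof -
    note pn = p[unfolded A n_def[symmetric]]
    obtain x y where xy: "is_copy n (A, as) x" "is_copy n (B, bs) y" "\<And>i. i < n \<Longrightarrow> \<delta> {x i, y i} < e / (real n + 1)"
      using d_K_less[OF pn B close] by blast
    have "interp A R as = \<delta> (x ` {..<n})" "interp B R bs = \<delta> (y ` {..<n})"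
      using interp_eq_div_of[OF R, of A as] interp_eq_div_of[OF R, of B bs] pn B xy(1,2)
      unfolding n_def[symmetric] by (simp_all add: is_copy_def)
    moreover have "\<bar>\<delta> (x ` {..<n}) - \<delta> (y ` {..<n})\<bar> \<le> (\<Sum>i<n. \<delta> {x i, y i})"
      using xy(1,2) by (intro diversity_move_points[OF div]) (auto simp: is_copy_def)
    moreover have "\<dots> \<le> (\<Sum>i<n. e / (real n + 1))" using xy(3) by (intro sum_mono) (auto intro: less_imp_le)
    moreover have "\<dots> < e" using \<open>0 < e\<close> by (simp add: field_simps)
    ultimately show ?thesis by simp
  qed
  note main = this
  have "\<exists>\<eta>>0. \<forall>(B, bs)\<in>enumerated \<K> n.
    d_K \<L> \<K> (A, as) (B, bs) < \<eta> \<longrightarrow> \<bar>interp A R as - interp B R bs\<bar> < e" if "0 < e" for e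
    using main[OF that] that by (intro exI[of _ "e / (real n + 1)"]) auto
  then show "case p of (A, as) \<Rightarrow> \<forall>e>0. \<exists>\<eta>>0. \<forall>(B, bs)\<in>enumerated \<K> (arity \<L> R).
    d_K \<L> \<K> (A, as) (B, bs) < \<eta> \<longrightarrow> \<bar>interp A R as - interp B R bs\<bar> < e"
    by (simp add: A n_def)
qed

end

lemma HP: "HP \<L> \<K>"
  unfolding HP_def by (intro ballI L1_K_structure finite_L1_L_structure) (auto simp: finite_L1_diversities_iff)

section \<open>Saturated structures and Fraisse limits\<close>

lemma in_FpowI: "finite S \<Longrightarrow> G \<subseteq> S \<Longrightarrow> G \<in> Fpow S"
  by (simp add: Fpow_def finite_subset)

lemma empty_embedding:
  assumes "represents A \<delta>" "represents B \<epsilon>"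
  shows "embedding \<L> f (induced A {}) B"
  unfolding embedding_iff[OF represents_induced[OF assms(1) empty_subsetI] assms(2)]
  using assms by (auto simp: Fpow_def represents_def)

definition saturated :: "('a, div_symbol) rel_struct \<Rightarrow> bool" where
  "saturated M \<longleftrightarrow> represents M (div_of M) \<and> cut_diversity (univ M) (div_of M) \<and> separable_div (univ M) (div_of M) \<and>
     complete_div (univ M) (div_of M) \<and> extension_property (univ M) (div_of M)"

lemma saturatedD:
  assumes "saturated M"
  shows "represents M (div_of M)" "cut_diversity (univ M) (div_of M)" "separable_div (univ M) (div_of M)"
    "complete_div (univ M) (div_of M)" "extension_property (univ M) (div_of M)"
  using assms by (auto simp: saturated_def)

lemma saturated_isomorphism:
  assumes M: "saturated M" and N: "saturated N"
    and S: "finite S" "S \<subseteq> univ M" "embedding \<L> f (induced M S) N"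
  obtains g where "isomorphism \<L> g M N" "\<And>x. x \<in> S \<Longrightarrow> g x = f x"
proof -
  note M' = saturatedD[OF M] and N' = saturatedD[OF N]
  have "f ` S \<subseteq> univ N" "\<forall>F\<in>Fpow S. div_of N (f ` F) = div_of M F"
    using embedding_iff[OF represents_induced[OF M'(1) S(2)] N'(1), of f] S(3) by auto
  then have f: "f ` S \<subseteq> univ N" "\<And>G. G \<subseteq> S \<Longrightarrow> div_of N (f ` G) = div_of M G"
    using in_FpowI[OF S(1)] by blast+
  obtain g where g: "g ` univ M = univ N" "\<And>F. F \<in> Fpow (univ M) \<Longrightarrow> div_of N (g ` F) = div_of M F"
    "\<And>p. p \<in> S \<Longrightarrow> g p = f p"
    using back_and_forth[OF M'(2-5) N'(2-5) S(1,2) f] by blast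
  then have "isomorphism \<L> g M N"
    unfolding isomorphism_def embedding_iff[OF M'(1) N'(1)] by simp
  then show ?thesis using that g(3) by blast
qed

lemma saturated_ultrahomogeneous:
  assumes "saturated M"
  shows "ultrahomogeneous \<L> M"
  unfolding ultrahomogeneous_def
proof (intro conjI allI impI)
  show "separable_structure \<L> M"
    using saturatedD[OF assms] separable_structure_iff cut_diversityD by blast
  fix S f assume "finite S \<and> S \<subseteq> univ M \<and> embedding \<L> f (induced M S) M"
  then show "\<exists>g. isomorphism \<L> g M M \<and> (\<forall>x\<in>S. g x = f x)"
    using saturated_isomorphism[OF assms assms] by metis
qed

text \<open>
  The forth half of the back-and-forth construction embeds \<open>Y\<close>, which may be incomplete.
\<close>

lemma saturated_universal:
  assumes "saturated M"
  shows "universal_L1 TYPE('x) M"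
  unfolding universal_L1_def
proof (intro allI impI, elim conjE)
  fix Y :: "'x set" and \<epsilon>
  assume L1: "L1_diversity Y \<epsilon>" and sep: "separable_structure \<L> (div_structure Y \<epsilon>)"
  note M = saturatedD[OF assms]
  have Y: "cut_diversity Y \<epsilon>" using L1 by (rule L1_diversity_imp_cut_diversity)
  have rep: "represents (div_structure Y \<epsilon>) \<epsilon>"
    using diversity_empty[OF cut_diversityD[OF Y]] by (rule represents_div_structure)
  have "separable_div Y \<epsilon>" using separable_structure_iff[OF rep] cut_diversityD[OF Y] sep by simp
  then obtain g where "g ` Y \<subseteq> univ M" "\<And>F. F \<in> Fpow Y \<Longrightarrow> div_of M (g ` F) = \<epsilon> F"
    using embed_separable[OF Y _ cut_diversityD[OF M(2)] M(5,4)] by blast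
  then show "\<exists>f. embedding \<L> f (div_structure Y \<epsilon>) M"
    using embedding_iff[OF rep M(1)] by auto
qed

lemma L1_structureI:
  assumes "L1_diversity (univ M) \<delta>" "represents M \<delta>"
  shows "L1_structure M"
  using assms L1_structure_iff by blast

lemma L1_structure_isomorphic:
  assumes N: "L1_structure N" and M: "Metric_space (univ M) (sdist \<L> M)" and g: "embedding \<L> g M N"
  shows "L1_structure M"
  using L1_structure_pullback[OF N g embedding_inj_on[OF M N g]] .

context universal_space
begin

definition limit :: "(real, div_symbol) rel_struct" where
  "limit = div_structure X \<delta>"

lemma univ_limit [simp]: "univ limit = X"
  by (simp add: limit_def)

lemma limit_represents: "represents limit \<delta>"
  unfolding limit_def by (rule represents_div_structure) (rule diversity_empty[OF div])

lemma limit_L1: "L1_structure limit"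
  using L1 limit_represents by (intro L1_structureI[of _ \<delta>]) simp_all

lemma limit_L_structure: "L_structure \<L> limit"
  using represents_L_structure[OF limit_represents] div complete by simp

lemma Fraisse_limit_limit: "Fraisse_limit \<L> \<K> limit"
  unfolding Fraisse_limit_def
proof (intro conjI allI impI, goal_cases)
  case 1
  show ?case using limit_L_structure limit_L1 by (rule L1_K_structure)
next
  case 2
  show ?case using separable_structure_iff[OF limit_represents] div separable by simp
next
  case (3 B as h e)
  then have B: "finite (univ B)" "represents B (div_of B)" "cut_diversity (univ B) (div_of B)"
    and as: "set as \<subseteq> univ B" and h: "embedding \<L> h (induced B (set as)) limit" and "0 < e"
    using K_structureD[of B] by auto
  have "h ` set as \<subseteq> X" "\<forall>F\<in>Fpow (set as). \<delta> (h ` F) = div_of B F"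
    using h embedding_iff[OF represents_induced[OF B(2) as] limit_represents, of h] by auto
  then have h': "h ` set as \<subseteq> X" "\<And>G. G \<subseteq> set as \<Longrightarrow> \<delta> (h ` G) = div_of B G"
    using in_FpowI[OF List.finite_set] by blast+
  obtain g where g: "g ` univ B \<subseteq> X" "\<And>G. G \<subseteq> univ B \<Longrightarrow> \<delta> (g ` G) = div_of B G" "\<And>t. t \<in> set as \<Longrightarrow> g t = h t"
    using extend_finite_map[OF B(3) extension div B(1) as order_refl h'] by blast
  have "embedding \<L> g B limit"
    unfolding embedding_iff[OF B(2) limit_represents] using g(1,2) by (auto simp: Fpow_def)
  moreover have "sdist \<L> limit (g a) (h a) < e" if "a \<in> set as" for a
  proof -
    have "h a \<in> X" using h'(1) that by blast
    then show ?thesis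
      using sdist_eq[OF limit_represents, of "h a" "h a"] g(3)[OF that] diversity_singleton[OF div] \<open>0 < e\<close> by simp
  qed
  ultimately show ?case by blast
qed

text \<open>
  One step of improvement. The tuple \<open>(a, z)\<close> is copied into the space; there an exact solution \<open>p\<close> near
  the copy of \<open>z\<close> exists. The approximate extension property carries the copied tuple with \<open>p\<close> back to
  \<open>M\<close>, moving its entries by less than \<open>\<eta>\<close>. The image of \<open>p\<close> is the improved point: its values are wrong
  only because the \<open>n\<close> entries of \<open>a\<close> have moved.
\<close>

lemma limit_extension_step:
  fixes M :: "('m, div_symbol) rel_struct" and a :: "nat \<Rightarrow> 'm"
  assumes M: "Fraisse_limit \<L> \<K> M" and c: "extends_within X \<delta> n c"
    and a: "a ` {..<n} \<subseteq> univ M" and z: "z \<in> univ M" and rep: "cut_rep {..n} \<gamma>"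
    and match: "\<And>F. F \<subseteq> {..<n} \<Longrightarrow> \<gamma> F = div_of M (a ` F)"
    and near: "\<And>F. F \<subseteq> {..<n} \<Longrightarrow> \<bar>\<gamma> (insert n F) - div_of M (insert z (a ` F))\<bar> \<le> e" and \<eta>: "0 < \<eta>"
  shows "\<exists>z'\<in>univ M. div_of M {z, z'} \<le> c * e + \<eta> \<and>
    (\<forall>F\<subseteq>{..<n}. \<bar>\<gamma> (insert n F) - div_of M (insert z' (a ` F))\<bar> \<le> n * \<eta>)"
proof -
  have K: "K_structure \<L> \<K> M" using M by (simp add: Fraisse_limit_def)
  note repM = K_structureD(1)[OF K] and cutM = K_structureD(2)[OF K]
  note divM = cut_diversityD[OF cutM]
  define b where "b = a(n := z)"
  have b: "b ` {..<Suc n} \<subseteq> univ M" using a z by (auto simp: b_def less_Suc_eq)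
  have bF: "b ` F = a ` F" if "F \<subseteq> {..<n}" for F using that by (intro image_cong) (auto simp: b_def)
  have bn: "b n = z" by (simp add: b_def)
  obtain x where x: "x ` {..<Suc n} \<subseteq> X" "\<And>F. F \<subseteq> {..<Suc n} \<Longrightarrow> \<delta> (x ` F) = div_of M (b ` F)"
    using realize_tuple[OF cutM b] by blast
  have xX: "x i \<in> X" if "i \<le> n" for i using x(1) that by auto
  have "\<exists>p\<in>X. (\<forall>F\<subseteq>{..<n}. \<delta> (insert p (x ` F)) = \<gamma> (insert n F)) \<and> \<delta> {x n, p} \<le> c * e"
  proof (rule extends_withinD[OF c _ _ rep])
    show "x ` {..<n} \<subseteq> X" "x n \<in> X" using xX by auto
    fix F assume F: "F \<subseteq> {..<n}"
    then have F': "F \<subseteq> {..<Suc n}" "insert n F \<subseteq> {..<Suc n}" by auto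
    show "\<gamma> F = \<delta> (x ` F)" using x(2)[OF F'(1)] bF[OF F] match[OF F] by simp
    show "\<bar>\<gamma> (insert n F) - \<delta> (insert (x n) (x ` F))\<bar> \<le> e"
      using x(2)[OF F'(2)] bF[OF F] bn near[OF F] by simp
  qed
  then obtain p where p: "p \<in> X" "\<And>F. F \<subseteq> {..<n} \<Longrightarrow> \<delta> (insert p (x ` F)) = \<gamma> (insert n F)" "\<delta> {x n, p} \<le> c * e"
    by blast
  define S where "S = insert p (x ` {..<Suc n})"
  have S: "finite S" "S \<subseteq> X" using p(1) x(1) by (auto simp: S_def)
  from finite_copy[OF L1 S] obtain B :: "(nat, div_symbol) rel_struct" and k where B: "B \<in> \<K>"
    "univ B = k ` S" "\<And>F. F \<subseteq> S \<Longrightarrow> div_of B (k ` F) = \<delta> F" by metis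
  have LB: "L1_structure B" "finite (univ B)" using B(1) by (auto simp: finite_L1_diversities_iff)
  have KB: "K_structure \<L> \<K> B" using HP B(1) by (simp add: HP_def)
  define as where "as = map (\<lambda>i. k (x i)) [0..<Suc n]"
  have as: "set as = (\<lambda>i. k (x i)) ` {..<Suc n}" unfolding as_def set_map set_upt atLeast0LessThan ..
  have asB: "set as \<subseteq> univ B" unfolding as B(2) S_def by auto
  have valB: "div_of B ((\<lambda>i. k (x i)) ` F) = div_of M (b ` F)" if "F \<subseteq> {..<Suc n}" for F
  proof -
    have "x ` F \<subseteq> S" using that by (auto simp: S_def)
    then have "div_of B (k ` x ` F) = \<delta> (x ` F)" by (rule B(3))
    then show ?thesis using x(2)[OF that] by (simp add: image_image)
  qed
  obtain h where h: "\<And>i. i < Suc n \<Longrightarrow> h (k (x i)) = b i" "\<And>G. G \<subseteq> (\<lambda>i. k (x i)) ` {..<Suc n} \<Longrightarrow> div_of M (h ` G) = div_of B G"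
    using matching_tuples_map[OF L1_structure_diversity[OF LB(1)] divM, of "\<lambda>i. k (x i)" "Suc n" b] asB b valB
    unfolding as by metis
  have "embedding \<L> h (induced B (set as)) M"
  proof -
    have "h ` set as \<subseteq> univ M" using h(1) b unfolding as by auto
    then show ?thesis
      unfolding embedding_iff[OF represents_induced[OF L1_structureD(2)[OF LB(1)] asB] repM]
      using h(2) unfolding as by (auto simp: Fpow_def)
  qed
  then obtain f where f: "embedding \<L> f B M" "\<And>q. q \<in> set as \<Longrightarrow> sdist \<L> M (f q) (h q) < \<eta>"
    using M asB KB LB(2) \<eta> unfolding Fraisse_limit_def by meson
  have f': "f ` univ B \<subseteq> univ M" "\<And>F. F \<in> Fpow (univ B) \<Longrightarrow> div_of M (f ` F) = div_of B F"
    using f(1) embedding_iff[OF L1_structureD(2)[OF LB(1)] repM] by auto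
  have fS: "f (k s) \<in> univ M" if "s \<in> S" for s using that f'(1) B(2) by auto
  have fval: "div_of M (f ` k ` F) = \<delta> F" if "F \<subseteq> S" for F
  proof -
    have "k ` F \<in> Fpow (univ B)" using that S(1) B(2) by (auto simp: Fpow_def intro: finite_subset)
    then show ?thesis using f'(2) B(3)[OF that] by simp
  qed
  have fb: "div_of M {f (k (x i)), b i} < \<eta>" if "i \<le> n" for i
  proof -
    have "k (x i) \<in> set as" unfolding as using that by auto
    moreover have "f (k (x i)) \<in> univ M" "b i \<in> univ M" using fS b that by (auto simp: S_def)
    ultimately show ?thesis using f(2)[of "k (x i)"] h(1)[of i] that sdist_eq[OF repM] by simp
  qed
  define z' where "z' = f (k p)"
  have z': "z' \<in> univ M" unfolding z'_def by (rule fS) (simp add: S_def)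
  have "div_of M {z, z'} \<le> div_of M {z, f (k (x n))} + div_of M {f (k (x n)), z'}"
    using z z' fS[of "x n"] by (intro diversity_triangle[OF divM]) (auto simp: S_def)
  moreover have "div_of M {f (k (x n)), z'} = \<delta> {x n, p}"
    using fval[of "{x n, p}"] by (simp add: z'_def S_def)
  moreover have "div_of M {z, f (k (x n))} < \<eta>" using fb[of n] bn by (simp add: insert_commute)
  ultimately have "div_of M {z, z'} \<le> c * e + \<eta>" using p(3) by simp
  moreover have "\<bar>\<gamma> (insert n F) - div_of M (insert z' (a ` F))\<bar> \<le> n * \<eta>" if F: "F \<subseteq> {..<n}" for F
  proof -
    have finF: "finite F" using F finite_subset by blast
    define u where "u = (\<lambda>i. if i = n then z' else f (k (x i)))"
    define v where "v = (\<lambda>i. if i = n then z' else a i)"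
    have nF: "n \<notin> F" using F by auto
    have u: "u ` insert n F = f ` k ` insert p (x ` F)"
      using nF by (auto simp: u_def z'_def image_iff)
    have v: "v ` insert n F = insert z' (a ` F)"
      using nF by (auto simp: v_def image_iff)
    have "insert p (x ` F) \<subseteq> S" using F by (auto simp: S_def)
    then have "div_of M (u ` insert n F) = \<gamma> (insert n F)" unfolding u p(2)[OF F, symmetric] by (rule fval)
    moreover have "\<bar>div_of M (u ` insert n F) - div_of M (v ` insert n F)\<bar> \<le> (\<Sum>i\<in>insert n F. div_of M {u i, v i})"
      using finF F a z' fS by (intro diversity_move_points[OF divM]) (auto simp: u_def v_def S_def)
    moreover have "(\<Sum>i\<in>insert n F. div_of M {u i, v i}) = (\<Sum>i\<in>F. div_of M {u i, v i})"
      using finF nF diversity_singleton[OF divM z'] by (simp add: u_def v_def)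
    moreover have "\<dots> \<le> (\<Sum>i\<in>F. \<eta>)"
    proof (rule sum_mono)
      fix i assume "i \<in> F"
      then have "i < n" using F by auto
      then show "div_of M {u i, v i} \<le> \<eta>" using fb[of i] by (simp add: u_def v_def b_def)
    qed
    moreover have "\<dots> \<le> n * \<eta>" using card_mono[OF _ F] \<eta> by simp
    ultimately show ?thesis unfolding v by simp
  qed
  ultimately show ?thesis using z' by blast
qed

lemma Fraisse_limit_nonempty:
  assumes M: "Fraisse_limit \<L> \<K> M"
  shows "univ M \<noteq> {}"
proof -
  have K: "K_structure \<L> \<K> M" using M by (simp add: Fraisse_limit_def)
  obtain x where x: "x \<in> X" using nonempty by blast
  from finite_copy[OF L1, of "{x}"] obtain B :: "(nat, div_symbol) rel_struct" and k where B: "B \<in> \<K>"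
    "univ B = k ` {x}" using x by (metis empty_subsetI finite.emptyI finite.insertI insert_subset)
  have KB: "K_structure \<L> \<K> B" "finite (univ B)"
    using HP B(1) by (auto simp: HP_def finite_L1_diversities_iff)
  have "embedding \<L> h (induced B (set [])) M" for h :: "nat \<Rightarrow> 'a"
    using empty_embedding[OF K_structureD(1)[OF KB(1)] K_structureD(1)[OF K]] by simp
  then have "\<exists>f. embedding \<L> f B M"
    using M KB unfolding Fraisse_limit_def by (metis empty_subsetI empty_set zero_less_one)
  then show ?thesis using B(2) by (auto simp: embedding_def)
qed

text \<open>
  Each step halves the bound on the error \<open>err\<close> and moves the point by a multiple of that bound, so the
  points converge in \<open>M\<close> to an exact solution.
\<close>

lemma Fraisse_limit_extension_property:
  fixes M :: "('m, div_symbol) rel_struct"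
  assumes M: "Fraisse_limit \<L> \<K> M" and comp: "complete_div (univ M) (div_of M)"
  shows "extension_property (univ M) (div_of M)"
  unfolding extension_property_def
proof (intro allI impI, elim conjE)
  fix n and a :: "nat \<Rightarrow> 'm" and \<gamma> :: "nat set \<Rightarrow> real"
  assume a: "a ` {..<n} \<subseteq> univ M" and rep: "cut_rep {..n} \<gamma>" and match: "\<forall>F\<subseteq>{..<n}. \<gamma> F = div_of M (a ` F)"
  have K: "K_structure \<L> \<K> M" using M by (simp add: Fraisse_limit_def)
  note divM = cut_diversityD[OF K_structureD(2)[OF K]]
  obtain c where c: "extends_within X \<delta> n c" using quantitative by blast
  obtain z0 where z0: "z0 \<in> univ M" using Fraisse_limit_nonempty[OF M] by blast
  define err where "err = (\<lambda>z F. \<bar>\<gamma> (insert n F) - div_of M (insert z (a ` F))\<bar>)"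
  \<comment> \<open>The summand \<open>1\<close> makes \<open>E\<close> positive.\<close>
  define E where "E = 1 + (\<Sum>F\<in>Pow {..<n}. err z0 F)"
  have E0: "0 < E" unfolding E_def by (intro add_pos_nonneg sum_nonneg) (auto simp: err_def)
  have "\<exists>\<zeta>. \<forall>k. (\<zeta> k \<in> univ M \<and> (\<forall>F\<subseteq>{..<n}. err (\<zeta> k) F \<le> E * (1/2) ^ k)) \<and>
    div_of M {\<zeta> k, \<zeta> (Suc k)} \<le> (c + 1) * E * (1/2) ^ k"
  proof (rule dependent_nat_choice)
    have "err z0 F \<le> E" if "F \<subseteq> {..<n}" for F
      using member_le_sum[of F "Pow {..<n}" "err z0"] that by (simp add: E_def err_def)
    then show "\<exists>z. z \<in> univ M \<and> (\<forall>F\<subseteq>{..<n}. err z F \<le> E * (1/2) ^ 0)" using z0 by auto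
    fix z k assume z: "z \<in> univ M \<and> (\<forall>F\<subseteq>{..<n}. err z F \<le> E * (1/2) ^ k)"
    \<comment> \<open>This makes \<open>n * \<eta>\<close> at most the error allowed at the next step.\<close>
    define \<eta> where "\<eta> = E * (1/2) ^ Suc k / (real n + 1)"
    have \<eta>: "0 < \<eta>" using E0 by (simp add: \<eta>_def)
    have "n * \<eta> = E * (1/2) ^ Suc k * (n / (real n + 1))" by (simp add: \<eta>_def)
    also have "\<dots> \<le> E * (1/2) ^ Suc k" using E0 by (intro mult_left_le) auto
    finally have n\<eta>: "n * \<eta> \<le> E * (1/2) ^ Suc k" .
    have "\<eta> \<le> E * (1/2) ^ Suc k / 1" unfolding \<eta>_def using E0 by (intro divide_left_mono) auto
    also have "\<dots> \<le> E * (1/2) ^ k" using E0 by simp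
    finally have \<eta>1: "\<eta> \<le> E * (1/2) ^ k" .
    have "\<exists>z'\<in>univ M. div_of M {z, z'} \<le> c * (E * (1/2) ^ k) + \<eta> \<and>
      (\<forall>F\<subseteq>{..<n}. \<bar>\<gamma> (insert n F) - div_of M (insert z' (a ` F))\<bar> \<le> n * \<eta>)"
    proof (rule limit_extension_step[OF M c a _ rep _ _ \<eta>])
      show "z \<in> univ M" using z by blast
      show "\<gamma> F = div_of M (a ` F)" if "F \<subseteq> {..<n}" for F using match that by blast
      show "\<bar>\<gamma> (insert n F) - div_of M (insert z (a ` F))\<bar> \<le> E * (1/2) ^ k" if "F \<subseteq> {..<n}" for F
        using z that by (simp add: err_def)
    qed
    then obtain z' where z': "z' \<in> univ M" "div_of M {z, z'} \<le> c * (E * (1/2) ^ k) + \<eta>"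
      "\<And>F. F \<subseteq> {..<n} \<Longrightarrow> err z' F \<le> n * \<eta>" by (auto simp: err_def)
    have "div_of M {z, z'} \<le> (c + 1) * E * (1/2) ^ k" using z'(2) \<eta>1 by (simp add: algebra_simps)
    moreover have "\<forall>F\<subseteq>{..<n}. err z' F \<le> E * (1/2) ^ Suc k" using z'(3) n\<eta> by (meson order_trans)
    ultimately show "\<exists>z'. (z' \<in> univ M \<and> (\<forall>F\<subseteq>{..<n}. err z' F \<le> E * (1/2) ^ Suc k)) \<and>
      div_of M {z, z'} \<le> (c + 1) * E * (1/2) ^ k" using z'(1) by blast
  qed
  then obtain \<zeta> where \<zeta>: "\<And>k. \<zeta> k \<in> univ M" "\<And>k F. F \<subseteq> {..<n} \<Longrightarrow> err (\<zeta> k) F \<le> E * (1/2) ^ k"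
    "\<And>k. div_of M {\<zeta> k, \<zeta> (Suc k)} \<le> (c + 1) * E * (1/2) ^ k" by blast
  obtain z where z: "z \<in> univ M" "\<And>e. 0 < e \<Longrightarrow> \<exists>N. \<forall>k\<ge>N. div_of M {\<zeta> k, z} < e"
    using complete_div_fast[OF divM comp \<zeta>(1,3)] by metis
  have "div_of M (insert z (a ` F)) = \<gamma> (insert n F)" if F: "F \<subseteq> {..<n}" for F
  proof -
    have finF: "finite F" using F finite_subset by blast
    have "err z F \<le> 0"
    proof (rule field_le_epsilon)
      fix e :: real assume "0 < e"
      obtain N where N: "\<forall>k\<ge>N. div_of M {\<zeta> k, z} < e / 2" using z(2)[of "e / 2"] \<open>0 < e\<close> by auto
      obtain j where j: "(1/2) ^ j < e / (2 * E)"
        using real_arch_pow_inv[of "e / (2 * E)" "1/2"] \<open>0 < e\<close> E0 by auto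
      define k where "k = max N j"
      have "(1/2::real) ^ k \<le> (1/2) ^ j" by (intro power_decreasing) (auto simp: k_def)
      then have "(1/2) ^ k < e / (2 * E)" using j by linarith
      then have "E * (1/2) ^ k < e / 2" using E0 by (simp add: field_simps)
      moreover have "div_of M {\<zeta> k, z} < e / 2" using N by (simp add: k_def)
      moreover have "\<bar>div_of M (insert (\<zeta> k) (a ` F)) - div_of M (insert z (a ` F))\<bar> \<le> div_of M {\<zeta> k, z}"
      proof -
        have aF: "a ` F \<subseteq> univ M" using a F by blast
        have 1: "div_of M (a ` F \<union> {\<zeta> k}) \<le> div_of M (a ` F \<union> {z}) + div_of M ({z} \<union> {\<zeta> k})"
          using aF finF z(1) \<zeta>(1) by (intro diversity_through[OF divM]) auto
        have 2: "div_of M (a ` F \<union> {z}) \<le> div_of M (a ` F \<union> {\<zeta> k}) + div_of M ({\<zeta> k} \<union> {z})"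
          using aF finF z(1) \<zeta>(1) by (intro diversity_through[OF divM]) auto
        show ?thesis using 1 2 by (simp add: insert_commute)
      qed
      moreover have "err (\<zeta> k) F \<le> E * (1/2) ^ k" using \<zeta>(2)[OF F] .
      ultimately show "err z F \<le> 0 + e" by (simp add: err_def)
    qed
    then show ?thesis by (simp add: err_def)
  qed
  then show "\<exists>z\<in>univ M. \<forall>F\<subseteq>{..<n}. div_of M (insert z (a ` F)) = \<gamma> (insert n F)" using z(1) by blast
qed

lemma Fraisse_limit_saturated:
  assumes M: "Fraisse_limit \<L> \<K> M"
  shows "saturated M"
proof -
  have K: "K_structure \<L> \<K> M" using M by (simp add: Fraisse_limit_def)
  note M' = K_structureD[OF K]
  have "complete_div (univ M) (div_of M)"
    using K complete_structure_iff[OF M'(1) cut_diversityD[OF M'(2)]] by (simp add: K_structure_def L_structure_def)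
  moreover have "separable_div (univ M) (div_of M)"
    using M separable_structure_iff[OF M'(1) cut_diversityD[OF M'(2)]] by (simp add: Fraisse_limit_def)
  ultimately show ?thesis using M' Fraisse_limit_extension_property[OF M] by (simp add: saturated_def)
qed

text \<open>
  The functions that represent the concrete limit are transported along an isomorphism.
\<close>

lemma Fraisse_limit_L1:
  assumes M: "Fraisse_limit \<L> \<K> M"
  shows "L1_structure M"
proof -
  have saturated: "saturated M" "saturated limit" using Fraisse_limit_saturated M Fraisse_limit_limit by blast+
  have "embedding \<L> f (induced M {}) limit" for f :: "'a \<Rightarrow> real"
    by (rule empty_embedding[OF saturatedD(1)[OF saturated(1)] saturatedD(1)[OF saturated(2)]])
  then obtain g where g: "isomorphism \<L> g M limit"
    using saturated_isomorphism[OF saturated, of "{}"] by (metis empty_subsetI finite.emptyI)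
  show ?thesis
    using g M by (intro L1_structure_isomorphic[OF limit_L1]) (auto simp: isomorphism_def Fraisse_limit_def K_structure_def L_structure_def)
qed

text \<open>
  The tuple with the prescribed values exists in the space, and universality yields a copy of it in
  \<open>N\<close>. An automorphism moves the first \<open>n\<close> points of this copy to the given tuple, and the last one to
  the point required.
\<close>

lemma universal_ultrahomogeneous_saturated:
  fixes N :: "('n, div_symbol) rel_struct"
  assumes L1N: "L1_structure N" and compN: "complete_structure \<L> N" and sepN: "separable_structure \<L> N"
    and ultN: "ultrahomogeneous \<L> N" and univN: "universal_L1 TYPE(real) N"
  shows "saturated N"
proof -
  note rep = L1_structureD(2)[OF L1N] and cut = L1_structure_cut_diversity[OF L1N]
  note divN = cut_diversityD[OF cut]
  have "extension_property (univ N) (div_of N)"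
    unfolding extension_property_def
  proof (intro allI impI, elim conjE)
    fix n and a :: "nat \<Rightarrow> 'n" and \<gamma> :: "nat set \<Rightarrow> real"
    assume a: "a ` {..<n} \<subseteq> univ N" and rep\<gamma>: "cut_rep {..n} \<gamma>" and match: "\<forall>F\<subseteq>{..<n}. \<gamma> F = div_of N (a ` F)"
    have "{..<Suc n} = {..n}" by auto
    then obtain x where x: "x ` {..n} \<subseteq> X" "\<And>F. F \<subseteq> {..n} \<Longrightarrow> \<delta> (x ` F) = \<gamma> F"
      using realize_cut_rep[OF extension div, of "Suc n" \<gamma>] rep\<gamma> by metis
    define S where "S = x ` {..n}"
    have S: "finite S" "S \<subseteq> X" using x(1) by (auto simp: S_def)
    have "inj_on (\<lambda>s. s) S" by simp
    then have L1S: "L1_diversity S \<delta>" using L1_diversity_image[OF L1, of "\<lambda>s. s" S] S(2) by simp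
    then have divS: "diversity S \<delta>" by (simp add: L1_diversity_def)
    have repS: "represents (div_structure S \<delta>) \<delta>" by (rule represents_div_structure) (rule diversity_empty[OF divS])
    have "separable_div S \<delta>"
      unfolding separable_div_def using S(1) diversity_singleton[OF divS]
      by (intro exI[of _ S]) (auto simp: countable_finite intro!: bexI)
    then have "separable_structure \<L> (div_structure S \<delta>)"
      using separable_structure_iff[OF repS] divS by simp
    then obtain f where "embedding \<L> f (div_structure S \<delta>) N"
      using univN L1S unfolding universal_L1_def by blast
    then have f: "f ` S \<subseteq> univ N" "\<And>F. F \<subseteq> S \<Longrightarrow> div_of N (f ` F) = \<delta> F"
      unfolding embedding_iff[OF repS rep] using in_FpowI[OF S(1)] by auto
    have val: "div_of N ((\<lambda>i. f (x i)) ` F) = \<gamma> F" if F: "F \<subseteq> {..n}" for F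
    proof -
      have "x ` F \<subseteq> S" using F by (auto simp: S_def)
      then have "div_of N (f ` x ` F) = \<delta> (x ` F)" by (rule f(2))
      then show ?thesis using x(2)[OF F] by (simp add: image_image)
    qed
    have fxN: "(\<lambda>i. f (x i)) ` {..n} \<subseteq> univ N" using f(1) by (auto simp: S_def)
    obtain h where h: "\<And>i. i < n \<Longrightarrow> h (f (x i)) = a i"
      "\<And>G. G \<subseteq> (\<lambda>i. f (x i)) ` {..<n} \<Longrightarrow> div_of N (h ` G) = div_of N G"
    proof (rule matching_tuples_map[OF divN divN, of "\<lambda>i. f (x i)" n a])
      show "(\<lambda>i. f (x i)) ` {..<n} \<subseteq> univ N" using fxN by auto
      show "div_of N ((\<lambda>i. f (x i)) ` F) = div_of N (a ` F)" if "F \<subseteq> {..<n}" for F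
      proof -
        have "F \<subseteq> {..n}" using that by auto
        then show ?thesis using val match that by simp
      qed
    qed (use a in blast)+
    define T where "T = (\<lambda>i. f (x i)) ` {..<n}"
    have T: "finite T" "T \<subseteq> univ N" using fxN by (auto simp: T_def)
    have hT: "h ` T \<subseteq> univ N" using h(1) a by (auto simp: T_def)
    have "embedding \<L> h (induced N T) N"
      unfolding embedding_iff[OF represents_induced[OF rep T(2)] rep] using hT h(2) by (auto simp: Fpow_def T_def)
    then obtain g where g: "isomorphism \<L> g N N" "\<forall>t\<in>T. g t = h t"
      using ultN T unfolding ultrahomogeneous_def by blast
    have g': "g ` univ N = univ N" "\<And>F. F \<in> Fpow (univ N) \<Longrightarrow> div_of N (g ` F) = div_of N F"
      using g(1) unfolding isomorphism_def embedding_iff[OF rep rep] by auto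
    have "div_of N (insert (g (f (x n))) (a ` F)) = \<gamma> (insert n F)" if F: "F \<subseteq> {..<n}" for F
    proof -
      have Fn: "insert n F \<subseteq> {..n}" using F by auto
      have "g (f (x i)) = a i" if "i \<in> F" for i
        using g(2) h(1)[of i] that F by (auto simp: T_def)
      then have "insert (g (f (x n))) (a ` F) = g ` (\<lambda>i. f (x i)) ` insert n F" by (auto simp: image_iff)
      moreover have in_N: "(\<lambda>i. f (x i)) ` insert n F \<in> Fpow (univ N)"
        using fxN Fn finite_subset[OF F] by (auto simp: Fpow_def)
      ultimately show ?thesis using g'(2)[OF in_N] val[OF Fn] by (simp only:)
    qed
    moreover have "g (f (x n)) \<in> univ N" using g'(1) fxN by auto
    ultimately show "\<exists>z\<in>univ N. \<forall>F\<subseteq>{..<n}. div_of N (insert z (a ` F)) = \<gamma> (insert n F)" by blast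
  qed
  then show ?thesis
    unfolding saturated_def
    using rep cut complete_structure_iff[OF rep divN] compN separable_structure_iff[OF rep divN] sepN by blast
qed

end

theorem theorem26:
  shows
    "HP div_language finite_L1_diversities \<and>
     JEP div_language finite_L1_diversities \<and>
     bAP div_language finite_L1_diversities \<and>
     PP div_language finite_L1_diversities \<and>
     CP div_language finite_L1_diversities \<and>
     Fraisse_class div_language finite_L1_diversities \<and>
     (\<exists>M :: (real, div_symbol) rel_struct. Fraisse_limit div_language finite_L1_diversities M) \<and>
     (\<forall>M :: ('m, div_symbol) rel_struct.
        Fraisse_limit div_language finite_L1_diversities M \<longrightarrow>
        L1_structure M \<and>
        complete_structure div_language M \<and>
        separable_structure div_language M \<and>
        ultrahomogeneous div_language M \<and>
        universal_L1 TYPE('x) M \<and>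
        (\<forall>M' :: ('n, div_symbol) rel_struct.
           L1_structure M' \<and>
           complete_structure div_language M' \<and>
           separable_structure div_language M' \<and>
           ultrahomogeneous div_language M' \<and>
           universal_L1 TYPE(real) M' \<longrightarrow>
           isomorphic div_language M M'))"
proof -
  obtain X :: "real set" and \<delta> where "L1_diversity X \<delta>" "separable_div X \<delta>" "complete_div X \<delta>"
    "\<And>n. \<exists>c. extends_within X \<delta> n c" "X \<noteq> {}"
    using universal_L1_space by metis
  then interpret universal_space X \<delta> by unfold_locales
  have "L1_structure M \<and> complete_structure \<L> M \<and> separable_structure \<L> M \<and>
    ultrahomogeneous \<L> M \<and> universal_L1 TYPE('x) M \<and>
    (\<forall>M' :: ('n, div_symbol) rel_struct. L1_structure M' \<and> complete_structure \<L> M' \<and>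
      separable_structure \<L> M' \<and> ultrahomogeneous \<L> M' \<and> universal_L1 TYPE(real) M' \<longrightarrow>
      isomorphic \<L> M M')"
    if M: "Fraisse_limit \<L> \<K> M" for M :: "('m, div_symbol) rel_struct"
  proof (intro conjI allI impI, goal_cases)
    case 1
    show ?case using M by (rule Fraisse_limit_L1)
  next
    case 2
    show ?case using M by (simp add: Fraisse_limit_def K_structure_def L_structure_def)
  next
    case 3
    show ?case using M by (simp add: Fraisse_limit_def)
  next
    case 4
    show ?case using Fraisse_limit_saturated[OF M] by (rule saturated_ultrahomogeneous)
  next
    case 5
    show ?case using Fraisse_limit_saturated[OF M] by (rule saturated_universal)
  next
    case (6 M')
    then have saturated: "saturated M" "saturated M'"
      using Fraisse_limit_saturated[OF M] universal_ultrahomogeneous_saturated[of M'] by blast+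
    have "embedding \<L> f (induced M {}) M'" for f
      by (rule empty_embedding[OF saturatedD(1)[OF saturated(1)] saturatedD(1)[OF saturated(2)]])
    then obtain g where "isomorphism \<L> g M M'"
      using saturated_isomorphism[OF saturated, of "{}"] by (metis empty_subsetI finite.emptyI)
    then show ?case by (auto simp: isomorphic_def)
  qed
  then show ?thesis
    using HP JEP AP bAP PP CP Fraisse_limit_limit unfolding Fraisse_class_def by blast
qed

end
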